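(* Consider two reservoirs ($N=2$) coupled to a finite-dimensional system by a finite-rank coupling $V$, with one-particle space $\mathcal{H}=\mathcal{H}_{\mathcal{S}}\oplus\mathcal{H}_1\oplus\mathcal{H}_2$, decoupled Hamiltonian $H_0=H_{\mathcal{S}}+H_1+H_2$ and coupled Hamiltonian $H=H_0+V$, satisfying all the assumptions listed in the context. Let $\Omega_+$ be the Møller operator, $T(E)=(T_{jk}(E))_{j,k=1,2}$ the transition matrix at energy $E$, and $\Pi_0F_0\Pi_0=\sum_{j=1}^{2}f^{FD}_{\beta_j,\mu_j}(H_j)$ the initial one-particle density operator of the reservoirs, where $\beta_j>0$ and $\mu_j\in\mathbb{R}$. Then the steady current out of reservoir $1$, $$j_1 := i e\,\mathrm{Tr}_{\mathcal{H}}\big(\Omega_{+}\Pi_{0}F_{0}\Pi_{0}\Omega_{+}^{*}[V,\Pi_{1}]\big),$$ satisfies $$j_1=-2\pi e\int_{\sigma_{0}}\big(f_{\beta_{1},\mu_{1}}^{FD}(E)-f_{\beta_{2},\mu_{2}}^{FD}(E)\big)\,|T_{12}(E)|^{2}\,dE .$$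
   Context: Inner products are linear in the second argument; $|a\rangle\langle b|$ denotes the operator $u\mapsto \langle b,u\rangle a$. $e>0$ is a constant (the electron charge is $-e$). **Decoupled system.** $\mathcal{H}=\mathcal{H}_{\mathcal{S}}\oplus\mathcal{H}_1\oplus\mathcal{H}_2$ is an orthogonal sum of Hilbert spaces with $\dim\mathcal{H}_{\mathcal{S}}=M<\infty$. $H_{\mathcal{S}}$, $H_1$, $H_2$ are self-adjoint on $\mathcal{H}_{\mathcal{S}},\mathcal{H}_1,\mathcal{H}_2$, and $H_0=H_{\mathcal{S}}+H_1+H_2$ (direct sum). $\Pi_j$ is the orthogonal projection of $\mathcal{H}$ onto $\mathcal{H}_j$, and $\Pi_0=\Pi_1+\Pi_2$. Each $H_j$, $j=1,2$, has simple (multiplicity one) purely absolutely continuous spectrum, the same set $\sigma_0\subset[0,\infty)$ for both. Its spectral representation is given by generalized eigenfunctions $\psi^0_{j,E}\in\mathcal{K}_j^*$, $E\in\sigma_0$, where $\mathcal{K}_j\subset\mathcal{H}_j\subset\mathcal{K}_j^*$ is a Gelfand triple, with $H_j\psi^0_{j,E}=E\psi^0_{j,E}$. That is, $u\mapsto u(E)=\langle\psi^0_{j,E},u\rangle$ (generalized Fourier transform) extends to a unitary map $\mathcal{H}_j\to L^2(\sigma_0,dE)$ turning $H_j$ into multiplication by $E$. **Coupling.** $V$ is self-adjoint, and in the decomposition $\mathcal{H}_{\mathcal{S}}\oplus\mathcal{H}_1\oplus\mathcal{H}_2$ $$V=\begin{pmatrix}0&V_{\mathcal{S}1}&V_{\mathcal{S}2}\\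 V_{\mathcal{S}1}^*&0&V_{12}\\ V_{\mathcal{S}2}^*&V_{12}^*&0\end{pmatrix},\quad V_{\mathcal{S}j}=\sum_{l=1}^{m_j}v_{jl}|s_{jl}\rangle\langle f_{jl}|,\quad V_{12}=\sum_{l=1}^{m}v_l|g_{1l}\rangle\langle g_{2l}|,$$ with $m_j\le M$, $m<\infty$, $v_{jl},v_l>0$, where, for $j=1,2$, $\{s_{jl}\}_l$ is an orthonormal system in $\mathcal{H}_{\mathcal{S}}$ and $\{f_{jl}\}_l$, $\{g_{jl}\}_l$ are orthonormal systems in $\mathcal{H}_j$. **Scattering theory.** The Møller operators $\Omega_\pm=\operatorname{s-lim}_{t\to\mp\infty}e^{itH}e^{-itH_0}\Pi_0$ exist and are unitary from $\Pi_0\mathcal{H}$ onto the absolutely continuous subspace of $H$. The scattering operator is $S=\Omega_-^*\Omega_+$ on $\Pi_0\mathcal{H}$, and $T$ is defined by $S=1-2\pi i\,T$. Since $S$ and $T$ commute with $H_0$, in the representation $\Pi_0\mathcal{H}\cong L^2(\sigma_0,dE;\mathbb{C}^2)$ they act as multiplication by $2\times2$ matrices $S(E)$ (unitary) and $T(E)=(T_{jk}(E))$. **Standing technical assumptions.** The $f_{jl},g_{jl}$ are such that their generalized Fourier transforms $f_{jl}(E),g_{jl}(E)$ are smooth in $E$, and such that, for all $E\in\sigma_0$ outside a discrete exceptional set, $\Omega_\pm$ have bounded extensions to the orthogonal sum of the $\mathcal{K}_j^*$, $\psi^\pm_{j,E}=\Omega_\pm\psi^0_{j,E}$ are generalized eigenfunctions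 of $H$ ($H\psi^\pm_{j,E}=E\psi^\pm_{j,E}$) giving spectral representations of the absolutely continuous part of $H$, they satisfy the Lippmann–Schwinger equation $\psi^\pm_{j,E}=\psi^0_{j,E}-(H_0-E\mp i0)^{-1}V\psi^\pm_{j,E}$, and $T_{jk}(E)=\langle\psi^0_{j,E},V\psi^+_{k,E}\rangle$. (Exponential spatial localization of $f_{jl},g_{jl}$ is a sufficient condition when the $H_j$ are discrete or continuous Laplacians with boundary conditions.) **Initial state.** $f^{FD}_{\beta,\mu}(x)=(1+e^{\beta(x-\mu)})^{-1}$ is the Fermi–Dirac function, with $\beta_j>0$ the inverse temperature and $\mu_j\in\mathbb{R}$ the chemical potential of reservoir $j$; $\Pi_0F_0\Pi_0=\sum_{j=1}^2 f^{FD}_{\beta_j,\mu_j}(H_j)$. *)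

theory Defs
  imports "HOL-Analysis.Analysis"
begin

section \<open>Complex Hilbert spaces\<close>

text \<open>The inner product is linear in the second argument.\<close>

class complex_hilbert = banach +
  fixes scaleC :: "complex \<Rightarrow> 'a \<Rightarrow> 'a"  (infixr "*\<^sub>C" 75)
    and cinner :: "'a \<Rightarrow> 'a \<Rightarrow> complex"
  assumes scaleC_of_real: "complex_of_real r *\<^sub>C x = r *\<^sub>R x"
    and scaleC_scaleC: "a *\<^sub>C b *\<^sub>C x = (a * b) *\<^sub>C x"
    and scaleC_add_left: "(a + b) *\<^sub>C x = a *\<^sub>C x + b *\<^sub>C x"
    and scaleC_add_right: "a *\<^sub>C (x + y) = a *\<^sub>C x + a *\<^sub>C y"
    and cinner_add_right: "cinner x (y + z) = cinner x y + cinner x z"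
    and cinner_scaleC_right: "cinner x (a *\<^sub>C y) = a * cinner x y"
    and cinner_commute: "cinner x y = cnj (cinner y x)"
    and cinner_self: "cinner x x = complex_of_real ((norm x)\<^sup>2)"

lemma scaleC_one: "1 *\<^sub>C x = (x :: 'a::complex_hilbert)"
  using scaleC_of_real[of 1 x] by simp

interpretation cvec: vector_space "scaleC :: complex \<Rightarrow> 'a \<Rightarrow> 'a::complex_hilbert"
  by unfold_locales (simp_all add: scaleC_add_left scaleC_add_right scaleC_scaleC scaleC_one)

definition orthonormal_family :: "nat \<Rightarrow> (nat \<Rightarrow> 'h::complex_hilbert) \<Rightarrow> bool" where
  "orthonormal_family n b \<longleftrightarrow>
     (\<forall>k<n. \<forall>l<n. cinner (b k) (b l) = (if k = l then 1 else 0))"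

definition orthonormal_basis :: "'h::complex_hilbert set \<Rightarrow> bool" where
  "orthonormal_basis B \<longleftrightarrow>
     (\<forall>a\<in>B. \<forall>b\<in>B. cinner a b = (if a = b then 1 else 0)) \<and>
     closure (cvec.span B) = UNIV"

text \<open>For bounded operators, unconditional convergence of the diagonal sums in every
  orthonormal basis is equivalent to being trace class, and the sum is then basis independent.\<close>

definition has_trace :: "('h::complex_hilbert \<Rightarrow> 'h) \<Rightarrow> complex \<Rightarrow> bool" where
  "has_trace A c \<longleftrightarrow>
     (\<forall>B. orthonormal_basis B \<longrightarrow> ((\<lambda>b. cinner b (A b)) has_sum c) B)"

definition op_trace :: "('h::complex_hilbert \<Rightarrow> 'h) \<Rightarrow> complex" where
  "op_trace A = (THE c. has_trace A c)"

definition cadjoint :: "('h::complex_hilbert \<Rightarrow> 'h) \<Rightarrow> 'h \<Rightarrow> 'h" where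
  "cadjoint A = (THE B. \<forall>x y. cinner (B x) y = cinner x (A y))"

definition ortho_proj :: "'h::complex_hilbert set \<Rightarrow> 'h \<Rightarrow> 'h" where
  "ortho_proj V x = (THE y. y \<in> V \<and> (\<forall>z\<in>V. cinner z (x - y) = 0))"

definition clinear_on :: "'h::complex_hilbert set \<Rightarrow> ('h \<Rightarrow> 'h) \<Rightarrow> bool" where
  "clinear_on V A \<longleftrightarrow>
     (\<forall>x\<in>V. \<forall>y\<in>V. \<forall>a. A (x + a *\<^sub>C y) = A x + a *\<^sub>C A y)"

definition unitary_onto ::
    "'h::complex_hilbert set \<Rightarrow> 'h set \<Rightarrow> ('h \<Rightarrow> 'h) \<Rightarrow> bool" where
  "unitary_onto V W A \<longleftrightarrow>
     clinear_on V A \<and> (\<forall>x\<in>V. \<forall>y\<in>V. cinner (A x) (A y) = cinner x y) \<and> A ` V = W"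

definition commutator :: "('h \<Rightarrow> 'h) \<Rightarrow> ('h \<Rightarrow> 'h) \<Rightarrow> 'h \<Rightarrow> 'h::complex_hilbert" where
  "commutator A B x = A (B x) - B (A x)"


section \<open>Unbounded operators on closed subspaces\<close>

text \<open>An operator is given by its domain \<open>D\<close> and a total function \<open>A\<close>, of which only the values
  on \<open>D\<close> matter. The last clause of self-adjointness says that the domain of the adjoint is
  contained in \<open>D\<close>.\<close>

definition self_adjoint_on ::
    "'h::complex_hilbert set \<Rightarrow> 'h set \<Rightarrow> ('h \<Rightarrow> 'h) \<Rightarrow> bool" where
  "self_adjoint_on V D A \<longleftrightarrow>
     cvec.subspace D \<and> D \<subseteq> V \<and> V \<subseteq> closure D \<and>
     clinear_on D A \<and> A ` D \<subseteq> V \<and>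
     (\<forall>x\<in>D. \<forall>y\<in>D. cinner (A x) y = cinner x (A y)) \<and>
     (\<forall>x\<in>V. (\<exists>y\<in>V. \<forall>u\<in>D. cinner (A u) x = cinner u y) \<longrightarrow> x \<in> D)"

definition spectrum_on ::
    "'h::complex_hilbert set \<Rightarrow> 'h set \<Rightarrow> ('h \<Rightarrow> 'h) \<Rightarrow> complex set" where
  "spectrum_on V D A = {z. \<not> (bij_betw (\<lambda>x. A x - z *\<^sub>C x) D V \<and>
     (\<exists>c>0. \<forall>x\<in>D. norm (A x - z *\<^sub>C x) \<ge> c * norm x))}"

definition resolvent ::
    "'h::complex_hilbert set \<Rightarrow> ('h \<Rightarrow> 'h) \<Rightarrow> complex \<Rightarrow> 'h \<Rightarrow> 'h" where
  "resolvent D A z y = (THE x. x \<in> D \<and> A x - z *\<^sub>C x = y)"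

text \<open>By Stone's theorem, a self-adjoint \<open>A\<close> has exactly one such group, namely
  \<open>t \<mapsto> exp (i t A)\<close>.\<close>

definition unitary_group_of ::
    "'h::complex_hilbert set \<Rightarrow> ('h \<Rightarrow> 'h) \<Rightarrow> (real \<Rightarrow> 'h \<Rightarrow> 'h) \<Rightarrow> bool" where
  "unitary_group_of D A U \<longleftrightarrow>
     (\<forall>t. unitary_onto UNIV UNIV (U t)) \<and>
     (\<forall>x. U 0 x = x) \<and> (\<forall>s t x. U (s + t) x = U s (U t x)) \<and>
     (\<forall>x. continuous_on UNIV (\<lambda>t. U t x)) \<and>
     (\<forall>x y. x \<in> D \<and> A x = y \<longleftrightarrow>
        ((\<lambda>t. (1 / t) *\<^sub>R (U t x - x)) \<longlongrightarrow> \<i> *\<^sub>C y) (at 0))"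

definition exp_i ::
    "'h::complex_hilbert set \<Rightarrow> ('h \<Rightarrow> 'h) \<Rightarrow> real \<Rightarrow> 'h \<Rightarrow> 'h" where
  "exp_i D A = (THE U. unitary_group_of D A U)"

definition vector_measure :: "(real set \<Rightarrow> 'h \<Rightarrow> 'h) \<Rightarrow> 'h::complex_hilbert \<Rightarrow> real measure" where
  "vector_measure P x = measure_of UNIV (sets borel) (\<lambda>B. ennreal ((norm (P B x))\<^sup>2))"

text \<open>Projection-valued measure of the self-adjoint operator \<open>(D, A)\<close>. Linearity of \<open>P B\<close> follows
  from its symmetry, and \<open>A\<close> is determined on \<open>D\<close> by its quadratic form.\<close>

definition spectral_resolution ::
    "'h::complex_hilbert set \<Rightarrow> ('h \<Rightarrow> 'h) \<Rightarrow> (real set \<Rightarrow> 'h \<Rightarrow> 'h) \<Rightarrow> bool" where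
  "spectral_resolution D A P \<longleftrightarrow>
     (\<forall>B\<in>sets borel. \<forall>x y. P B (P B x) = P B x \<and> cinner (P B x) y = cinner x (P B y)) \<and>
     (\<forall>x. P UNIV x = x) \<and>
     (\<forall>B x. range B \<subseteq> sets borel \<and> disjoint_family B \<longrightarrow>
        (\<lambda>n::nat. P (B n) x) sums P (\<Union>n. B n) x) \<and>
     D = {x. integrable (vector_measure P x) (\<lambda>l. l\<^sup>2)} \<and>
     (\<forall>x\<in>D. cinner x (A x) = complex_of_real (LINT l|vector_measure P x. l))"

definition ac_subspace :: "'h::complex_hilbert set \<Rightarrow> ('h \<Rightarrow> 'h) \<Rightarrow> 'h set" where
  "ac_subspace D A =
     {x. \<exists>P. spectral_resolution D A P \<and> absolutely_continuous lborel (vector_measure P x)}"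


section \<open>Spectral representations\<close>

definition L2_on :: "real set \<Rightarrow> (real \<Rightarrow> complex) \<Rightarrow> bool" where
  "L2_on \<sigma> h \<longleftrightarrow> set_borel_measurable lborel \<sigma> h \<and>
     set_integrable lborel \<sigma> (\<lambda>E. (cmod (h E))\<^sup>2)"

text \<open>\<open>W\<close> is (a choice of representatives of) a unitary map from \<open>V\<close> onto \<open>L\<^sup>2(\<sigma>, dE; \<complex>\<^sup>J)\<close> turning
  \<open>(D, A)\<close> into multiplication by \<open>E\<close>.\<close>

definition spectral_representation ::
    "nat set \<Rightarrow> 'h::complex_hilbert set \<Rightarrow> 'h set \<Rightarrow> ('h \<Rightarrow> 'h) \<Rightarrow> real set \<Rightarrow>
     (nat \<Rightarrow> 'h \<Rightarrow> real \<Rightarrow> complex) \<Rightarrow> bool" where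
  "spectral_representation J V D A \<sigma> W \<longleftrightarrow>
     (\<forall>j\<in>J. \<forall>x\<in>V. L2_on \<sigma> (W j x)) \<and>
     (\<forall>j\<in>J. \<forall>x\<in>V. \<forall>y\<in>V. \<forall>a. AE E in lborel. E \<in> \<sigma> \<longrightarrow>
        W j (x + a *\<^sub>C y) E = W j x E + a * W j y E) \<and>
     (\<forall>x\<in>V. (\<Sum>j\<in>J. LINT E:\<sigma>|lborel. (cmod (W j x E))\<^sup>2) = (norm x)\<^sup>2) \<and>
     (\<forall>h. (\<forall>j\<in>J. L2_on \<sigma> (h j)) \<longrightarrow>
        (\<exists>x\<in>V. \<forall>j\<in>J. AE E in lborel. E \<in> \<sigma> \<longrightarrow> W j x E = h j E)) \<and>
     D = {x\<in>V. \<forall>j\<in>J. L2_on \<sigma> (\<lambda>E. complex_of_real E * W j x E)} \<and>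
     (\<forall>x\<in>D. \<forall>j\<in>J. AE E in lborel. E \<in> \<sigma> \<longrightarrow> W j (A x) E = complex_of_real E * W j x E)"

text \<open>Function of an operator, defined through its (simple) spectral representation \<open>w\<close>.\<close>

definition op_function ::
    "'h::complex_hilbert set \<Rightarrow> real set \<Rightarrow> ('h \<Rightarrow> real \<Rightarrow> complex) \<Rightarrow> (real \<Rightarrow> real) \<Rightarrow> 'h \<Rightarrow> 'h" where
  "op_function V \<sigma> w h x = (THE y. y \<in> V \<and>
     (AE E in lborel. E \<in> \<sigma> \<longrightarrow> w y E = complex_of_real (h E) * w x E))"

definition smooth_on_open :: "real set \<Rightarrow> (real \<Rightarrow> complex) \<Rightarrow> bool" where
  "smooth_on_open U h \<longleftrightarrow>
     (\<forall>n. \<forall>t\<in>U. ((\<lambda>g t. vector_derivative g (at t)) ^^ n) h differentiable (at t))"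


section \<open>Gelfand triples\<close>

text \<open>\<open>K\<close> with inner product \<open>kin\<close> is a Hilbert space, continuously and densely embedded in \<open>V\<close>.\<close>

definition knorm :: "('h \<Rightarrow> 'h \<Rightarrow> complex) \<Rightarrow> 'h::complex_hilbert \<Rightarrow> real" where
  "knorm kin u = sqrt (Re (kin u u))"

definition gelfand_triple ::
    "'h::complex_hilbert set \<Rightarrow> 'h set \<Rightarrow> ('h \<Rightarrow> 'h \<Rightarrow> complex) \<Rightarrow> bool" where
  "gelfand_triple V K kin \<longleftrightarrow>
     cvec.subspace K \<and> K \<subseteq> V \<and> V \<subseteq> closure K \<and>
     (\<forall>u\<in>K. \<forall>v\<in>K. \<forall>w\<in>K. \<forall>a. kin u (v + a *\<^sub>C w) = kin u v + a * kin u w) \<and>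
     (\<forall>u\<in>K. \<forall>v\<in>K. kin u v = cnj (kin v u)) \<and>
     (\<forall>u\<in>K. u \<noteq> 0 \<longrightarrow> 0 < Re (kin u u)) \<and>
     (\<exists>C. \<forall>u\<in>K. norm u \<le> C * knorm kin u) \<and>
     (\<forall>X. (\<forall>n. X n \<in> K) \<and>
          (\<forall>\<epsilon>>0. \<exists>N. \<forall>m\<ge>N. \<forall>n\<ge>N. knorm kin (X m - X n) < \<epsilon>) \<longrightarrow>
        (\<exists>x\<in>K. (\<lambda>n. knorm kin (X n - x)) \<longlonglongrightarrow> 0))"

text \<open>An element \<open>\<psi>\<close> of the dual \<open>K\<^sup>*\<close> is represented by the bounded antilinear functional
  \<open>u \<mapsto> \<langle>u, \<psi>\<rangle>\<close> on \<open>K\<close> (the values outside \<open>K\<close> are irrelevant), so that \<open>V \<subseteq> K\<^sup>*\<close> via \<open>embed\<close> is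
  linear; \<open>\<langle>\<psi>, u\<rangle>\<close> is the complex conjugate of \<open>\<psi> u\<close>. The argument \<open>N\<close> is the norm of \<open>K\<close>.\<close>

definition antidual ::
    "'h::complex_hilbert set \<Rightarrow> ('h \<Rightarrow> real) \<Rightarrow> ('h \<Rightarrow> complex) set" where
  "antidual K N = {\<psi>.
     (\<forall>u\<in>K. \<forall>v\<in>K. \<forall>a. \<psi> (u + a *\<^sub>C v) = \<psi> u + cnj a * \<psi> v) \<and>
     (\<exists>C. \<forall>u\<in>K. cmod (\<psi> u) \<le> C * N u)}"

definition embed :: "'h::complex_hilbert \<Rightarrow> 'h \<Rightarrow> complex" where
  "embed x u = cinner u x"

definition generalized_eigenfunction ::
    "'h::complex_hilbert set \<Rightarrow> 'h set \<Rightarrow> ('h \<Rightarrow> 'h) \<Rightarrow> real \<Rightarrow> ('h \<Rightarrow> complex) \<Rightarrow> bool" where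
  "generalized_eigenfunction K D A E \<psi> \<longleftrightarrow>
     (\<forall>u\<in>K \<inter> D. A u \<in> K \<longrightarrow> \<psi> (A u) = complex_of_real E * \<psi> u)"


section \<open>Two reservoirs coupled to a system\<close>

text \<open>Reservoirs carry the indices 1 and 2; \<open>coefS j l\<close>, \<open>vecS j l\<close>, \<open>vecR j l\<close>
  for \<open>l < nS j\<close> are the \<open>v\<^sub>j\<^sub>l\<close>, \<open>s\<^sub>j\<^sub>l\<close>, \<open>f\<^sub>j\<^sub>l\<close>, and \<open>coef12 l\<close>, \<open>vec12 j l\<close> for
  \<open>l < n12\<close> are the \<open>v\<^sub>l\<close>, \<open>g\<^sub>j\<^sub>l\<close>. \<open>psi0 j E\<close> is an element
  of \<open>K\<^sub>j\<^sup>*\<close>, and \<open>fourier j\<close> is the extension to all of \<open>H\<^sub>j\<close> of the generalized Fourier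
  transform.\<close>

record 'h two_reservoirs =
  spS :: "'h set"
  hamS :: "'h \<Rightarrow> 'h"
  sp :: "nat \<Rightarrow> 'h set"
  domR :: "nat \<Rightarrow> 'h set"
  hamR :: "nat \<Rightarrow> 'h \<Rightarrow> 'h"
  sigma0 :: "real set"
  spK :: "nat \<Rightarrow> 'h set"
  innerK :: "nat \<Rightarrow> 'h \<Rightarrow> 'h \<Rightarrow> complex"
  psi0 :: "nat \<Rightarrow> real \<Rightarrow> 'h \<Rightarrow> complex"
  fourier :: "nat \<Rightarrow> 'h \<Rightarrow> real \<Rightarrow> complex"
  nS :: "nat \<Rightarrow> nat"
  coefS :: "nat \<Rightarrow> nat \<Rightarrow> real"
  vecS :: "nat \<Rightarrow> nat \<Rightarrow> 'h"
  vecR :: "nat \<Rightarrow> nat \<Rightarrow> 'h"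
  n12 :: nat
  coef12 :: "nat \<Rightarrow> real"
  vec12 :: "nat \<Rightarrow> nat \<Rightarrow> 'h"

definition PiS :: "'h::complex_hilbert two_reservoirs \<Rightarrow> 'h \<Rightarrow> 'h" where
  "PiS R = ortho_proj (spS R)"

definition PiR :: "'h::complex_hilbert two_reservoirs \<Rightarrow> nat \<Rightarrow> 'h \<Rightarrow> 'h" where
  "PiR R j = ortho_proj (sp R j)"

definition Pi0 :: "'h::complex_hilbert two_reservoirs \<Rightarrow> 'h \<Rightarrow> 'h" where
  "Pi0 R x = PiR R 1 x + PiR R 2 x"

definition dom0 :: "'h::complex_hilbert two_reservoirs \<Rightarrow> 'h set" where
  "dom0 R = {x. \<forall>j\<in>{1,2}. PiR R j x \<in> domR R j}"

definition H0 :: "'h::complex_hilbert two_reservoirs \<Rightarrow> 'h \<Rightarrow> 'h" where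
  "H0 R x = hamS R (PiS R x) + (\<Sum>j\<in>{1,2}. hamR R j (PiR R j x))"

text \<open>The total space \<open>K = H\<^sub>S \<oplus> K\<^sub>1 \<oplus> K\<^sub>2\<close> and its norm; the orthogonal sum of the
  \<open>K\<^sub>j\<^sup>*\<close>, \<open>j = 1, 2\<close>, is the set of elements of \<open>K\<^sup>*\<close> that vanish on \<open>H\<^sub>S\<close>.\<close>

definition Ktot :: "'h::complex_hilbert two_reservoirs \<Rightarrow> 'h set" where
  "Ktot R = {x. \<forall>j\<in>{1,2}. PiR R j x \<in> spK R j}"

definition Ktot_norm :: "'h::complex_hilbert two_reservoirs \<Rightarrow> 'h \<Rightarrow> real" where
  "Ktot_norm R u =
     sqrt ((norm (PiS R u))\<^sup>2 + (\<Sum>j\<in>{1,2}. (knorm (innerK R j) (PiR R j u))\<^sup>2))"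

definition Kdual :: "'h::complex_hilbert two_reservoirs \<Rightarrow> ('h \<Rightarrow> complex) set" where
  "Kdual R = antidual (Ktot R) (Ktot_norm R)"

definition Kdual0 :: "'h::complex_hilbert two_reservoirs \<Rightarrow> ('h \<Rightarrow> complex) set" where
  "Kdual0 R = {\<psi> \<in> Kdual R. \<forall>u\<in>spS R. \<psi> u = 0}"

definition psi0_tot :: "'h::complex_hilbert two_reservoirs \<Rightarrow> nat \<Rightarrow> real \<Rightarrow> 'h \<Rightarrow> complex" where
  "psi0_tot R j E u = psi0 R j E (PiR R j u)"

definition orthogonal_sum :: "'h::complex_hilbert two_reservoirs \<Rightarrow> nat \<Rightarrow> bool" where
  "orthogonal_sum R M \<longleftrightarrow>
     (\<exists>B. finite B \<and> card B = M \<and> cvec.independent B \<and> cvec.span B = spS R) \<and>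
     (\<forall>j\<in>{1,2}. closed (sp R j) \<and> cvec.subspace (sp R j)) \<and>
     (\<forall>j\<in>{1,2}. \<forall>x\<in>spS R. \<forall>y\<in>sp R j. cinner x y = 0) \<and>
     (\<forall>x\<in>sp R 1. \<forall>y\<in>sp R 2. cinner x y = 0) \<and>
     (\<forall>x. \<exists>a\<in>spS R. \<exists>b\<in>sp R 1. \<exists>c\<in>sp R 2. x = a + b + c)"

definition free_hamiltonians :: "'h::complex_hilbert two_reservoirs \<Rightarrow> bool" where
  "free_hamiltonians R \<longleftrightarrow>
     self_adjoint_on (spS R) (spS R) (hamS R) \<and>
     (\<forall>j\<in>{1,2}. self_adjoint_on (sp R j) (domR R j) (hamR R j)) \<and>
     sigma0 R \<in> sets borel \<and> sigma0 R \<subseteq> {0..} \<and>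
     (\<forall>j\<in>{1,2}. spectrum_on (sp R j) (domR R j) (hamR R j) = complex_of_real ` sigma0 R)"

definition free_eigenfunctions :: "'h::complex_hilbert two_reservoirs \<Rightarrow> bool" where
  "free_eigenfunctions R \<longleftrightarrow>
     (\<forall>j\<in>{1,2}. gelfand_triple (sp R j) (spK R j) (innerK R j) \<and>
        (\<forall>E\<in>sigma0 R.
           psi0 R j E \<in> antidual (spK R j) (knorm (innerK R j)) \<and>
           generalized_eigenfunction (spK R j) (domR R j) (hamR R j) E (psi0 R j E)) \<and>
        spectral_representation {j} (sp R j) (domR R j) (hamR R j) (sigma0 R) (fourier R) \<and>
        (\<forall>u\<in>spK R j. AE E in lborel. E \<in> sigma0 R \<longrightarrow> fourier R j u E = cnj (psi0 R j E u)))"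

definition decoupled_system :: "'h::complex_hilbert two_reservoirs \<Rightarrow> nat \<Rightarrow> bool" where
  "decoupled_system R M \<longleftrightarrow>
     orthogonal_sum R M \<and> free_hamiltonians R \<and> free_eigenfunctions R"

definition coupling :: "'h::complex_hilbert two_reservoirs \<Rightarrow> nat \<Rightarrow> bool" where
  "coupling R M \<longleftrightarrow>
     (\<forall>j\<in>{1,2}. nS R j \<le> M \<and>
        (\<forall>l<nS R j. 0 < coefS R j l \<and> vecS R j l \<in> spS R \<and> vecR R j l \<in> sp R j) \<and>
        orthonormal_family (nS R j) (vecS R j) \<and> orthonormal_family (nS R j) (vecR R j) \<and>
        (\<forall>l<n12 R. vec12 R j l \<in> sp R j) \<and> orthonormal_family (n12 R) (vec12 R j)) \<and>
     (\<forall>l<n12 R. 0 < coef12 R l)"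

text \<open>The coupling is a finite sum of operators \<open>|a\<rangle>\<langle>b|\<close> (those of \<open>V\<^sub>S\<^sub>j\<close> and \<open>V\<^sub>1\<^sub>2\<close> together with
  their adjoints). Since all \<open>b\<close> belong to \<open>K\<close>, it acts on \<open>\<psi> \<in> K\<^sup>*\<close> by replacing
  \<open>\<langle>b, x\<rangle>\<close> with \<open>\<langle>b, \<psi>\<rangle> = \<psi> b\<close>; the result is a vector.\<close>

definition V_gen :: "'h::complex_hilbert two_reservoirs \<Rightarrow> ('h \<Rightarrow> complex) \<Rightarrow> 'h" where
  "V_gen R \<psi> =
     (\<Sum>j\<in>{1,2}. \<Sum>l<nS R j. complex_of_real (coefS R j l) *\<^sub>C
        (\<psi> (vecR R j l) *\<^sub>C vecS R j l + \<psi> (vecS R j l) *\<^sub>C vecR R j l)) +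
     (\<Sum>l<n12 R. complex_of_real (coef12 R l) *\<^sub>C
        (\<psi> (vec12 R 2 l) *\<^sub>C vec12 R 1 l + \<psi> (vec12 R 1 l) *\<^sub>C vec12 R 2 l))"

definition V_op :: "'h::complex_hilbert two_reservoirs \<Rightarrow> 'h \<Rightarrow> 'h" where
  "V_op R x = V_gen R (embed x)"

definition Ham :: "'h::complex_hilbert two_reservoirs \<Rightarrow> 'h \<Rightarrow> 'h" where
  "Ham R x = H0 R x + V_op R x"


section \<open>Scattering theory\<close>

datatype pm = Plus | Minus

primrec time_limit :: "pm \<Rightarrow> real filter" where
  "time_limit Plus = at_bot"
| "time_limit Minus = at_top"

primrec pm_sign :: "pm \<Rightarrow> complex" where
  "pm_sign Plus = 1"
| "pm_sign Minus = - 1"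

text \<open>Bounded perturbations do not change the domain, so \<open>Ham R\<close> also has domain \<open>dom0 R\<close>.\<close>

definition moller_evolution :: "'h::complex_hilbert two_reservoirs \<Rightarrow> real \<Rightarrow> 'h \<Rightarrow> 'h" where
  "moller_evolution R t x =
     exp_i (dom0 R) (Ham R) t (exp_i (dom0 R) (H0 R) (- t) (Pi0 R x))"

definition Omega :: "'h::complex_hilbert two_reservoirs \<Rightarrow> pm \<Rightarrow> 'h \<Rightarrow> 'h" where
  "Omega R p x = Lim (time_limit p) (\<lambda>t. moller_evolution R t x)"

definition H_ac :: "'h::complex_hilbert two_reservoirs \<Rightarrow> 'h set" where
  "H_ac R = ac_subspace (dom0 R) (Ham R)"

definition scattering_theory :: "'h::complex_hilbert two_reservoirs \<Rightarrow> bool" where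
  "scattering_theory R \<longleftrightarrow>
     (\<forall>p. (\<forall>x. \<exists>y. ((\<lambda>t. moller_evolution R t x) \<longlongrightarrow> y) (time_limit p)) \<and>
          unitary_onto (range (Pi0 R)) (H_ac R) (Omega R p))"

definition S_op :: "'h::complex_hilbert two_reservoirs \<Rightarrow> 'h \<Rightarrow> 'h" where
  "S_op R x = cadjoint (Omega R Minus) (Omega R Plus x)"

definition T_op :: "'h::complex_hilbert two_reservoirs \<Rightarrow> 'h \<Rightarrow> 'h" where
  "T_op R x = (1 / (2 * complex_of_real pi * \<i>)) *\<^sub>C (x - S_op R x)"

text \<open>\<open>Tm j k E\<close> are the entries of the matrix by which \<open>T\<close> acts on
  \<open>L\<^sup>2(\<sigma>\<^sub>0, dE; \<complex>\<^sup>2)\<close>.\<close>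

definition transition_matrix ::
    "'h::complex_hilbert two_reservoirs \<Rightarrow> (nat \<Rightarrow> nat \<Rightarrow> real \<Rightarrow> complex) \<Rightarrow> bool" where
  "transition_matrix R Tm \<longleftrightarrow>
     (\<forall>j\<in>{1,2}. \<forall>k\<in>{1,2}. set_borel_measurable lborel (sigma0 R) (Tm j k)) \<and>
     (\<forall>x\<in>range (Pi0 R). \<forall>j\<in>{1,2}. AE E in lborel. E \<in> sigma0 R \<longrightarrow>
        fourier R j (PiR R j (T_op R x)) E =
          (\<Sum>k\<in>{1,2}. Tm j k E * fourier R k (PiR R k x) E))"

text \<open>Bounded linear maps from \<open>Kdual0 R\<close> to \<open>Kdual R\<close> extending \<open>Omega R p\<close>. The boundedness
  clause compares dual norms.\<close>

definition bounded_extension ::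
    "'h::complex_hilbert two_reservoirs \<Rightarrow> pm \<Rightarrow> (('h \<Rightarrow> complex) \<Rightarrow> 'h \<Rightarrow> complex) \<Rightarrow> bool" where
  "bounded_extension R p \<Omega> \<longleftrightarrow>
     (\<forall>\<psi>\<in>Kdual0 R. \<Omega> \<psi> \<in> Kdual R) \<and>
     (\<forall>\<psi>\<in>Kdual0 R. \<forall>\<phi>\<in>Kdual0 R. \<forall>a. \<forall>u\<in>Ktot R.
        \<Omega> (\<lambda>w. \<psi> w + a * \<phi> w) u = \<Omega> \<psi> u + a * \<Omega> \<phi> u) \<and>
     (\<exists>C. \<forall>\<psi>\<in>Kdual0 R. \<forall>c\<ge>0. (\<forall>u\<in>Ktot R. cmod (\<psi> u) \<le> c * Ktot_norm R u) \<longrightarrow>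
        (\<forall>u\<in>Ktot R. cmod (\<Omega> \<psi> u) \<le> C * c * Ktot_norm R u)) \<and>
     (\<forall>x\<in>range (Pi0 R). \<forall>u\<in>Ktot R. \<Omega> (embed x) u = cinner u (Omega R p x))"

text \<open>Standing technical assumptions, with \<open>\<Omega> p\<close> the extensions of the Moller operators, \<open>X\<close> the
  exceptional set of energies, and \<open>\<psi> = \<Omega> p (psi0_tot R j E)\<close> the distorted eigenfunctions. The
  boundary value of the resolvent in the Lippmann-Schwinger equation is a weak limit in
  \<open>K\<^sup>*\<close>.\<close>

definition technical_assumptions ::
    "'h::complex_hilbert two_reservoirs \<Rightarrow> (nat \<Rightarrow> nat \<Rightarrow> real \<Rightarrow> complex) \<Rightarrow>
     (pm \<Rightarrow> ('h \<Rightarrow> complex) \<Rightarrow> 'h \<Rightarrow> complex) \<Rightarrow> real set \<Rightarrow> bool" where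
  "technical_assumptions R Tm \<Omega> X \<longleftrightarrow>
     (\<forall>j\<in>{1,2}. \<forall>l<nS R j. vecR R j l \<in> spK R j \<and>
        smooth_on_open (interior (sigma0 R)) (\<lambda>E. cnj (psi0 R j E (vecR R j l)))) \<and>
     (\<forall>j\<in>{1,2}. \<forall>l<n12 R. vec12 R j l \<in> spK R j \<and>
        smooth_on_open (interior (sigma0 R)) (\<lambda>E. cnj (psi0 R j E (vec12 R j l)))) \<and>
     X \<subseteq> sigma0 R \<and> discrete X \<and>
     (\<forall>p. bounded_extension R p (\<Omega> p)) \<and>
     (\<forall>p. \<forall>j\<in>{1,2}. \<forall>E\<in>sigma0 R - X. let \<psi> = \<Omega> p (psi0_tot R j E) in
        generalized_eigenfunction (Ktot R) (dom0 R) (Ham R) E \<psi> \<and>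
        (\<forall>u\<in>Ktot R.
           ((\<lambda>\<epsilon>. cinner u (resolvent (dom0 R) (H0 R)
                    (complex_of_real E + pm_sign p * \<i> * complex_of_real \<epsilon>) (V_gen R \<psi>)))
              \<longlongrightarrow> psi0_tot R j E u - \<psi> u) (at_right 0))) \<and>
     (\<forall>p. \<exists>W. spectral_representation {1,2} (H_ac R) (dom0 R \<inter> H_ac R) (Ham R) (sigma0 R) W \<and>
        (\<forall>j\<in>{1,2}. \<forall>u\<in>Ktot R. AE E in lborel. E \<in> sigma0 R \<longrightarrow>
           W j (ortho_proj (H_ac R) u) E = cnj (\<Omega> p (psi0_tot R j E) u))) \<and>
     (\<forall>j\<in>{1,2}. \<forall>k\<in>{1,2}. \<forall>E\<in>sigma0 R - X.
        Tm j k E = cnj (psi0_tot R j E (V_gen R (\<Omega> Plus (psi0_tot R k E)))))"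


section \<open>Initial state and steady current\<close>

definition fermi_dirac :: "real \<Rightarrow> real \<Rightarrow> real \<Rightarrow> real" where
  "fermi_dirac \<beta> \<mu> x = 1 / (1 + exp (\<beta> * (x - \<mu>)))"

definition initial_state ::
    "'h::complex_hilbert two_reservoirs \<Rightarrow> (nat \<Rightarrow> real) \<Rightarrow> (nat \<Rightarrow> real) \<Rightarrow> ('h \<Rightarrow> 'h) \<Rightarrow> bool" where
  "initial_state R \<beta> \<mu> F0 \<longleftrightarrow>
     (\<forall>x. Pi0 R (F0 (Pi0 R x)) =
        (\<Sum>j\<in>{1,2}. op_function (sp R j) (sigma0 R) (fourier R j)
                      (fermi_dirac (\<beta> j) (\<mu> j)) (PiR R j x)))"

definition current_op :: "'h::complex_hilbert two_reservoirs \<Rightarrow> ('h \<Rightarrow> 'h) \<Rightarrow> 'h \<Rightarrow> 'h" where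
  "current_op R F0 =
     Omega R Plus \<circ> Pi0 R \<circ> F0 \<circ> Pi0 R \<circ> cadjoint (Omega R Plus) \<circ> commutator (V_op R) (PiR R 1)"

definition steady_current ::
    "'h::complex_hilbert two_reservoirs \<Rightarrow> ('h \<Rightarrow> 'h) \<Rightarrow> real \<Rightarrow> complex" where
  "steady_current R F0 e = \<i> * complex_of_real e * op_trace (current_op R F0)"

end

theory Submission
  imports Defs "HOL-Probability.Sinc_Integral"
begin

text \<open>Write \<open>\<psi>\<^sub>k = \<Omega>\<^sub>+ \<psi>\<^sup>0\<^sub>k\<close>. The operator \<open>\<rho> = \<Omega>\<^sub>+ \<Pi>\<^sub>0 F\<^sub>0 \<Pi>\<^sub>0 \<Omega>\<^sub>+\<^sup>*\<close> has the form
  \<open>\<langle>x, \<rho> y\<rangle> = \<Sum>\<^sub>k \<integral> f\<^sub>k(E) \<langle>x, \<psi>\<^sub>k\<rangle> \<langle>\<psi>\<^sub>k, y\<rangle> dE\<close> for \<open>x\<close>, \<open>y\<close> in \<open>K\<close>. As \<open>[V, \<Pi>\<^sub>1]\<close> has finite rank, the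
  trace is \<open>\<Sum>\<^sub>k \<integral> f\<^sub>k \<langle>\<psi>\<^sub>k, [V, \<Pi>\<^sub>1] \<psi>\<^sub>k\<rangle> dE\<close>, with integrand
  \<open>2 i f\<^sub>k Im \<langle>\<Pi>\<^sub>1 V \<psi>\<^sub>k, \<psi>\<^sub>k\<rangle>\<close>. Pairing the Lippmann-Schwinger equation with
  \<open>\<Pi>\<^sub>1 V \<psi>\<^sub>k\<close>, the imaginary part of the boundary value of the resolvent is a limit of Poisson
  integrals, and \<open>Im \<langle>\<Pi>\<^sub>1 V \<psi>\<^sub>k, \<psi>\<^sub>k\<rangle> = - \<delta>\<^sub>1\<^sub>k Im T\<^sub>1\<^sub>1 - \<pi> |T\<^sub>1\<^sub>k|\<^sup>2\<close>
  for almost every energy. Unitarity of \<open>S(E) = 1 - 2 \<pi> i T(E)\<close> gives the optical theorem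
  \<open>Im T\<^sub>1\<^sub>1 = - \<pi> (|T\<^sub>1\<^sub>1|\<^sup>2 + |T\<^sub>1\<^sub>2|\<^sup>2)\<close>, after which only
  \<open>\<plusminus> \<pi> |T\<^sub>1\<^sub>2|\<^sup>2\<close> is left.\<close>

section \<open>Complex inner products\<close>

text \<open>Two obstacles shape the proof. First, the extension of \<open>\<Omega>\<^sub>+\<close>
  is given as a bounded linear map between dual spaces, with no weak-star continuity among the
  hypotheses. Hence the function E to <psi_k, u> is not at once the Fourier transform of the adjoint
  wave operator applied to u. Reflexivity of \<open>K\<^sub>k\<close>, obtained from Riesz, provides
  this link. Second, the vector V psi_k changes with the very energy at which its resolvent is
  evaluated, whereas statements about L2 transforms hold off a null set that depends on the vector.
  Finite rank removes the difficulty: V psi_k stays in the span of finitely many fixed vectors, and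
  all null sets are chosen for those. Isometry of S controls the columns of S(E), while the current
  out of reservoir 1 involves the first row of T(E); a computation special to 2x2 matrices passes
  from columns to rows.\<close>

lemma cinner_add_left: "cinner (x + y) z = cinner x z + cinner y z"
  by (metis cinner_add_right cinner_commute complex_cnj_add)

lemma cinner_scaleC_left: "cinner (a *\<^sub>C x) y = cnj a * cinner x y"
  by (metis cinner_scaleC_right cinner_commute complex_cnj_mult)

lemma cinner_zero_right [simp]: "cinner x 0 = 0"
  using cinner_add_right[of x 0 0] by simp

lemma cinner_zero_left [simp]: "cinner 0 x = 0"
  using cinner_add_left[of 0 0 x] by simp

lemma cinner_diff_right: "cinner x (y - z) = cinner x y - cinner x z"
  using cinner_add_right[of x "y - z" z] by simp

lemma cinner_diff_left: "cinner (x - y) z = cinner x z - cinner y z"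
  using cinner_add_left[of "x - y" y z] by simp

lemma cinner_sum_right: "cinner x (\<Sum>i\<in>I. f i) = (\<Sum>i\<in>I. cinner x (f i))"
  by (induction I rule: infinite_finite_induct) (auto simp: cinner_add_right)

lemma cinner_self_eq_0 [simp]: "cinner x x = 0 \<longleftrightarrow> x = 0"
  by (simp add: cinner_self)

lemma cinner_ext: "(\<And>z. cinner z x = cinner z y) \<Longrightarrow> x = y"
  using cinner_self_eq_0[of "x - y"] by (simp add: cinner_diff_right)

lemma norm_scaleC: "norm (a *\<^sub>C x) = cmod a * norm x"
proof -
  have "cinner (a *\<^sub>C x) (a *\<^sub>C x) = (a * cnj a) * cinner x x"
    by (simp add: cinner_scaleC_left cinner_scaleC_right mult_ac)
  then have "complex_of_real ((norm (a *\<^sub>C x))\<^sup>2) = complex_of_real ((cmod a * norm x)\<^sup>2)"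
    unfolding complex_norm_square[symmetric] by (simp add: cinner_self power_mult_distrib)
  then show ?thesis
    by (metis norm_ge_zero of_real_eq_iff power2_eq_iff_nonneg zero_le_mult_iff)
qed

lemma scaleR_eq_scaleC: "r *\<^sub>R x = complex_of_real r *\<^sub>C x"
  by (simp add: scaleC_of_real)

section \<open>Riesz representation and reflexivity for a Hilbert space form on a subspace\<close>

locale hilbert_form =
  fixes K :: "'h::complex_hilbert set" and kin :: "'h \<Rightarrow> 'h \<Rightarrow> complex"
  assumes subspace: "cvec.subspace K"
    and kin_linear: "\<lbrakk>u \<in> K; v \<in> K; w \<in> K\<rbrakk> \<Longrightarrow> kin u (v + a *\<^sub>C w) = kin u v + a * kin u w"
    and kin_commute: "\<lbrakk>u \<in> K; v \<in> K\<rbrakk> \<Longrightarrow> kin u v = cnj (kin v u)"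
    and kin_pos: "\<lbrakk>u \<in> K; u \<noteq> 0\<rbrakk> \<Longrightarrow> 0 < Re (kin u u)"
    and complete: "\<lbrakk>\<And>n. X n \<in> K;
      \<And>\<epsilon>. \<epsilon> > 0 \<Longrightarrow> \<exists>N. \<forall>m\<ge>N. \<forall>n\<ge>N. knorm kin (X m - X n) < \<epsilon>\<rbrakk> \<Longrightarrow>
      \<exists>x\<in>K. (\<lambda>n. knorm kin (X n - x)) \<longlonglongrightarrow> 0"
begin

lemma mem_0 [simp]: "0 \<in> K"
  and mem_add: "u \<in> K \<Longrightarrow> v \<in> K \<Longrightarrow> u + v \<in> K"
  and mem_diff: "u \<in> K \<Longrightarrow> v \<in> K \<Longrightarrow> u - v \<in> K"
  and mem_scale: "u \<in> K \<Longrightarrow> a *\<^sub>C u \<in> K"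
  using subspace
  by (auto intro: cvec.subspace_0 cvec.subspace_add cvec.subspace_diff cvec.subspace_scale)

lemmas mems = mem_add mem_diff mem_scale

lemma kin_add_right: "\<lbrakk>u \<in> K; v \<in> K; w \<in> K\<rbrakk> \<Longrightarrow> kin u (v + w) = kin u v + kin u w"
  using kin_linear[of u v w 1] by (simp add: scaleC_one)

lemma kin_0_right [simp]: "u \<in> K \<Longrightarrow> kin u 0 = 0"
  using kin_add_right[of u 0 0] by simp

lemma kin_scale_right: "\<lbrakk>u \<in> K; v \<in> K\<rbrakk> \<Longrightarrow> kin u (a *\<^sub>C v) = a * kin u v"
  using kin_linear[of u 0 v a] by simp

lemma kin_diff_right: "\<lbrakk>u \<in> K; v \<in> K; w \<in> K\<rbrakk> \<Longrightarrow> kin u (v - w) = kin u v - kin u w"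
  using kin_add_right[of u "v - w" w] by (simp add: mems)

lemma kin_add_left: "\<lbrakk>u \<in> K; v \<in> K; w \<in> K\<rbrakk> \<Longrightarrow> kin (v + w) u = kin v u + kin w u"
  by (metis complex_cnj_add kin_add_right kin_commute mem_add)

lemma kin_scale_left: "\<lbrakk>u \<in> K; v \<in> K\<rbrakk> \<Longrightarrow> kin (a *\<^sub>C v) u = cnj a * kin v u"
  by (metis complex_cnj_mult kin_scale_right kin_commute mem_scale)

lemma kin_diff_left: "\<lbrakk>u \<in> K; v \<in> K; w \<in> K\<rbrakk> \<Longrightarrow> kin (v - w) u = kin v u - kin w u"
  by (metis complex_cnj_diff kin_diff_right kin_commute mem_diff)

lemma Re_kin_nonneg: "u \<in> K \<Longrightarrow> 0 \<le> Re (kin u u)"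
  using kin_pos[of u] by (cases "u = 0") auto

lemma kin_self: "u \<in> K \<Longrightarrow> kin u u = complex_of_real ((knorm kin u)\<^sup>2)"
  using kin_commute[of u u] Re_kin_nonneg[of u]
  by (auto simp: knorm_def complex_eq_iff)

lemma knorm_nonneg [simp]: "u \<in> K \<Longrightarrow> 0 \<le> knorm kin u"
  by (simp add: knorm_def Re_kin_nonneg)

lemma knorm_power2: "u \<in> K \<Longrightarrow> (knorm kin u)\<^sup>2 = Re (kin u u)"
  by (simp add: knorm_def Re_kin_nonneg)

lemma knorm_diff_commute: "\<lbrakk>u \<in> K; v \<in> K\<rbrakk> \<Longrightarrow> knorm kin (u - v) = knorm kin (v - u)"
  by (simp add: knorm_def kin_diff_left kin_diff_right mems)

lemma cauchy_schwarz:
  assumes u: "u \<in> K" and v: "v \<in> K"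
  shows "cmod (kin u v) \<le> knorm kin u * knorm kin v"
proof (cases "v = 0")
  case True
  then show ?thesis using u by (simp add: knorm_def)
next
  case False
  define n where "n = (knorm kin v)\<^sup>2"
  have n: "n > 0"
    using kin_pos[OF v False] by (simp add: n_def knorm_power2 v)
  \<comment> \<open>With this coefficient, \<open>a *\<^sub>C v\<close> is the projection of
    \<open>u\<close> onto the line through \<open>v\<close>, so nonnegativity of the remainder's
    squared norm is the claim.\<close>
  define a where "a = kin v u / complex_of_real n"
  have vu: "kin u v = cnj (kin v u)"
    using kin_commute u v by blast
  have "kin (u - a *\<^sub>C v) (u - a *\<^sub>C v) =
      kin u u - a * kin u v - cnj a * kin v u + cnj a * a * kin v v"
    using u v by (simp add: kin_diff_left kin_diff_right kin_scale_left kin_scale_right mems algebra_simps)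
  also have "\<dots> = kin u u - kin v u * cnj (kin v u) / complex_of_real n"
    using n vu kin_self[OF v] by (simp add: a_def n_def[symmetric] field_simps)
  also have "\<dots> = complex_of_real ((knorm kin u)\<^sup>2 - (cmod (kin u v))\<^sup>2 / n)"
    unfolding kin_self[OF u] vu complex_mod_cnj by (simp only: of_real_diff of_real_divide complex_norm_square)
  finally have "0 \<le> (knorm kin u)\<^sup>2 - (cmod (kin u v))\<^sup>2 / n"
    using Re_kin_nonneg[of "u - a *\<^sub>C v"] u v by (simp add: mems)
  then have "(cmod (kin u v))\<^sup>2 \<le> (knorm kin u * knorm kin v)\<^sup>2"
    using n by (simp add: field_simps n_def power_mult_distrib)
  then show ?thesis
    using u v by (meson abs_le_square_iff abs_le_square_iff knorm_nonneg mult_nonneg_nonneg power2_le_imp_le)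
qed

text \<open>Variational proof: the representing vector minimises \<open>J\<close>. No projection
  theorem is presupposed; projections and adjoints are derived from this result. The same proof
  serves each \<open>K\<^sub>j\<close> with its own form and closed subspaces with
  \<open>cinner\<close>.\<close>

theorem riesz:
  assumes lin: "\<And>u v a. u \<in> K \<Longrightarrow> v \<in> K \<Longrightarrow> f (u + a *\<^sub>C v) = f u + a * f v"
    and bdd: "\<And>u. u \<in> K \<Longrightarrow> cmod (f u) \<le> C * knorm kin u"
  obtains k where "k \<in> K" "\<And>u. u \<in> K \<Longrightarrow> f u = kin k u"
proof -
  define J where "J u = (knorm kin u)\<^sup>2 - 2 * Re (f u)" for u
  have J_ge: "J u \<ge> - (C\<^sup>2)" if "u \<in> K" for u
  proof -
    have "Re (f u) \<le> C * knorm kin u"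
      using bdd[OF that] complex_Re_le_cmod order_trans by blast
    moreover have "0 \<le> (knorm kin u - C)\<^sup>2" by simp
    ultimately show ?thesis
      by (simp add: J_def power2_eq_square algebra_simps)
  qed
  define m where "m = Inf (J ` K)"
  have bb: "bdd_below (J ` K)"
    using J_ge by (auto intro!: bdd_belowI)
  have m_le: "m \<le> J u" if "u \<in> K" for u
    unfolding m_def using bb that by (simp add: cInf_lower)
  have "\<exists>u\<in>K. J u < m + 1 / real (Suc n)" for n
  proof -
    have "Inf (J ` K) < m + 1 / real (Suc n)" by (simp add: m_def)
    moreover have "J ` K \<noteq> {}" using mem_0 by blast
    ultimately have "\<exists>y\<in>J ` K. y < m + 1 / real (Suc n)"
      by (metis cInf_lessD)
    then show ?thesis by blast
  qed
  then obtain x where x: "\<And>n. x n \<in> K" "\<And>n. J (x n) < m + 1 / real (Suc n)"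
    by metis
  have Jx: "J (u + a *\<^sub>C v) = J u + (cmod a)\<^sup>2 * (knorm kin v)\<^sup>2 + 2 * Re (a * (kin u v - f v))"
    if u: "u \<in> K" and v: "v \<in> K" for u v a
  proof -
    have "kin (u + a *\<^sub>C v) (u + a *\<^sub>C v) =
        kin u u + a * kin u v + cnj (a * kin u v) + (cnj a * a) * kin v v"
      using u v kin_commute[of v u]
      by (simp add: kin_add_left kin_add_right kin_scale_left kin_scale_right mems algebra_simps)
    then have "(knorm kin (u + a *\<^sub>C v))\<^sup>2 =
        (knorm kin u)\<^sup>2 + 2 * Re (a * kin u v) + Re ((cnj a * a) * kin v v)"
      using u v by (simp add: knorm_power2 mems)
    also have "Re ((cnj a * a) * kin v v) = (cmod a)\<^sup>2 * (knorm kin v)\<^sup>2"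
      using kin_self[OF v] cmod_power2[of a] by (simp add: power2_eq_square)
    finally show ?thesis
      using lin[OF u v] by (simp add: J_def algebra_simps)
  qed
  \<comment> \<open>Parallelogram law in terms of \<open>J\<close>: the midpoint of two
    near-minimisers has value at least \<open>m\<close>, which forces them to be close.\<close>
  have cauchy: "(knorm kin (x i - x j))\<^sup>2 \<le> 2 / real (Suc i) + 2 / real (Suc j)" for i j
  proof -
    let ?d = "x j - x i"
    have d: "?d \<in> K" using x by (simp add: mems)
    have "J (x i + (1/2) *\<^sub>C ?d) = J (x i) + (1/4) * (knorm kin ?d)\<^sup>2 + Re (kin (x i) ?d - f ?d)"
      using Jx[OF x(1) d, of i "1/2"] by (simp add: power2_eq_square norm_divide)
    moreover have "J (x j) = J (x i) + (knorm kin ?d)\<^sup>2 + 2 * Re (kin (x i) ?d - f ?d)"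
      using Jx[OF x(1) d, of i "1"] by (simp add: scaleC_one)
    ultimately have "(knorm kin ?d)\<^sup>2 = 2 * J (x i) + 2 * J (x j) - 4 * J (x i + (1/2) *\<^sub>C ?d)"
      by simp
    moreover have "m \<le> J (x i + (1/2) *\<^sub>C ?d)"
      using d x by (simp add: m_le mems)
    moreover have "J (x i) < m + 1 / real (Suc i)" "J (x j) < m + 1 / real (Suc j)"
      by (rule x)+
    ultimately have "(knorm kin ?d)\<^sup>2 \<le> 2 * (1 / real (Suc i)) + 2 * (1 / real (Suc j))"
      by linarith
    then show ?thesis
      using knorm_diff_commute[of "x i" "x j"] x by simp
  qed
  have "\<exists>N. \<forall>i\<ge>N. \<forall>j\<ge>N. knorm kin (x i - x j) < \<epsilon>" if "\<epsilon> > 0" for \<epsilon>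
  proof -
    obtain N where N: "4 / \<epsilon>\<^sup>2 < real (Suc N)"
      by (meson reals_Archimedean2 lessI less_trans of_nat_less_iff)
    have N': "4 / real (Suc N) < \<epsilon>\<^sup>2"
      using N that by (simp add: field_simps)
    have "knorm kin (x i - x j) < \<epsilon>" if ij: "i \<ge> N" "j \<ge> N" for i j
    proof -
      have "2 / real (Suc i) \<le> 2 / real (Suc N)" "2 / real (Suc j) \<le> 2 / real (Suc N)"
        using ij by (auto intro!: divide_left_mono)
      then have "(knorm kin (x i - x j))\<^sup>2 < \<epsilon>\<^sup>2"
        using cauchy[of i j] N' by simp
      then show ?thesis using \<open>\<epsilon> > 0\<close> by (simp add: power2_less_imp_less)
    qed
    then show ?thesis by blast
  qed
  with x obtain k where k: "k \<in> K" and lim: "(\<lambda>n. knorm kin (x n - k)) \<longlonglongrightarrow> 0"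
    using complete[of x] by blast
  \<comment> \<open>First-variation inequality at the minimiser. It holds at \<open>x n\<close> up
    to the error 1/(n+1) and only \<open>kin (x n) v\<close> has to converge, so \<open>J k\<close>
    itself is never evaluated.\<close>
  have key: "0 \<le> (cmod a)\<^sup>2 * (knorm kin v)\<^sup>2 + 2 * Re (a * (kin k v - f v))" if v: "v \<in> K" for v a
  proof -
    have l1: "(\<lambda>n. kin (x n) v) \<longlonglongrightarrow> kin k v"
    proof (rule Lim_null_comparison[THEN LIM_zero_cancel])
      show "\<forall>\<^sub>F n in sequentially. norm (kin (x n) v - kin k v) \<le> knorm kin (x n - k) * knorm kin v"
        using cauchy_schwarz x k v by (intro always_eventually) (simp add: mems flip: kin_diff_left)
      show "(\<lambda>n. knorm kin (x n - k) * knorm kin v) \<longlonglongrightarrow> 0"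
        using tendsto_mult_left_zero[OF lim] by simp
    qed
    have "0 \<le> (cmod a)\<^sup>2 * (knorm kin v)\<^sup>2 + 2 * Re (a * (kin (x n) v - f v)) + 1 / real (Suc n)" for n
      using m_le[of "x n + a *\<^sub>C v"] x(1)[of n] x(2)[of n] v Jx[OF x(1) v, of n a]
      by (simp add: mems)
    moreover have "(\<lambda>n. (cmod a)\<^sup>2 * (knorm kin v)\<^sup>2 + 2 * Re (a * (kin (x n) v - f v)) + 1 / real (Suc n))
        \<longlonglongrightarrow> (cmod a)\<^sup>2 * (knorm kin v)\<^sup>2 + 2 * Re (a * (kin k v - f v)) + 0"
      by (intro tendsto_intros l1 LIMSEQ_Suc[OF lim_1_over_n])
    ultimately have "0 \<le> (cmod a)\<^sup>2 * (knorm kin v)\<^sup>2 + 2 * Re (a * (kin k v - f v)) + 0"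
      by (intro LIMSEQ_le_const) auto
    then show ?thesis by simp
  qed
  have "f v = kin k v" if v: "v \<in> K" for v
  proof (rule ccontr)
    assume ne: "f v \<noteq> kin k v"
    define z where "z = kin k v - f v"
    \<comment> \<open>Step length for the variation along \<open>v\<close> with scalar
      \<open>- s * cnj z\<close>. Since \<open>s * (knorm kin v)^2 < 1\<close>, the quadratic term
      is smaller than the linear gain; the \<open>+ 1\<close> also covers
      \<open>v = 0\<close>.\<close>
    define s where "s = 1 / ((knorm kin v)\<^sup>2 + 1)"
    have z: "(cmod z)\<^sup>2 > 0" using ne by (simp add: z_def)
    have s: "s > 0" by (simp add: s_def add_nonneg_pos)
    have sN: "s * (knorm kin v)\<^sup>2 < 1"
      using s by (simp add: s_def divide_less_eq split: if_splits)
    have "0 \<le> (cmod (- s * cnj z))\<^sup>2 * (knorm kin v)\<^sup>2 + 2 * Re (- s * cnj z * z)"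
      using key[OF v, of "- s * cnj z"] by (simp add: z_def)
    moreover have "Re (- s * cnj z * z) = - s * (cmod z)\<^sup>2"
      using cmod_power2[of z] by (simp add: power2_eq_square algebra_simps)
    moreover have "(cmod (- s * cnj z))\<^sup>2 = s * (s * (cmod z)\<^sup>2)"
      using s by (simp add: norm_mult power_mult_distrib power2_eq_square)
    ultimately have "0 \<le> s * (s * (cmod z)\<^sup>2) * (knorm kin v)\<^sup>2 + 2 * (- s * (cmod z)\<^sup>2)"
      by (simp only:)
    then have "0 \<le> s * (cmod z)\<^sup>2 * (s * (knorm kin v)\<^sup>2) - 2 * (s * (cmod z)\<^sup>2)"
      by (simp add: mult_ac)
    moreover have "s * (cmod z)\<^sup>2 * (s * (knorm kin v)\<^sup>2) \<le> s * (cmod z)\<^sup>2 * 1"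
      using s z sN by (intro mult_left_mono) auto
    moreover have "s * (cmod z)\<^sup>2 > 0" using s z by simp
    ultimately show False by linarith
  qed
  with k show ?thesis using that by blast
qed

text \<open>Riesz is used twice: on k to \<open>L (ev k)\<close>, which produces
  \<open>\<kappa>\<close>, and on the conjugate of \<open>\<psi>\<close>, which shows that every
  antilinear functional agrees on \<open>K\<close> with some \<open>ev k\<close>. Boundedness of
  \<open>L\<close> is phrased with an arbitrary admissible constant \<open>c\<close> in place of a
  dual norm, matching \<open>bounded_extension\<close>.\<close>

lemma reflexive:
  fixes L :: "('h \<Rightarrow> complex) \<Rightarrow> complex"
  assumes lin: "\<And>\<psi> \<phi> a. \<psi> \<in> antidual K (knorm kin) \<Longrightarrow> \<phi> \<in> antidual K (knorm kin) \<Longrightarrow>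
      L (\<lambda>w. \<psi> w + a * \<phi> w) = L \<psi> + a * L \<phi>"
    and bdd: "\<And>\<psi> c. \<psi> \<in> antidual K (knorm kin) \<Longrightarrow> 0 \<le> c \<Longrightarrow>
      (\<And>u. u \<in> K \<Longrightarrow> cmod (\<psi> u) \<le> c * knorm kin u) \<Longrightarrow> cmod (L \<psi>) \<le> C * c"
  obtains \<kappa> where "\<kappa> \<in> K" "\<And>\<psi>. \<psi> \<in> antidual K (knorm kin) \<Longrightarrow> L \<psi> = \<psi> \<kappa>"
proof -
  define ev where "ev k = (\<lambda>u. kin u k)" for k
  have ev_bound: "cmod (ev k u) \<le> knorm kin k * knorm kin u" if "k \<in> K" "u \<in> K" for k u
    using cauchy_schwarz[of u k] that by (simp add: ev_def mult.commute)
  have ev: "ev k \<in> antidual K (knorm kin)" if "k \<in> K" for k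
    using ev_bound that unfolding antidual_def ev_def
    by (auto simp: kin_add_left kin_scale_left mem_scale)
  text \<open>\<open>\<psi>\<close> only matters on \<open>K\<close>: apply the bound with \<open>c = 0\<close>.\<close>
  have ext: "L \<psi> = L \<phi>"
    if \<psi>: "\<psi> \<in> antidual K (knorm kin)" and \<phi>: "\<phi> \<in> antidual K (knorm kin)"
      and eq: "\<And>u. u \<in> K \<Longrightarrow> \<psi> u = \<phi> u" for \<psi> \<phi>
  proof -
    have "(\<lambda>w. \<psi> w + (- 1) * \<phi> w) \<in> antidual K (knorm kin)"
      using eq unfolding antidual_def by (auto simp: mems intro!: exI[of _ 0])
    then have "cmod (L (\<lambda>w. \<psi> w + (- 1) * \<phi> w)) \<le> C * 0"
      by (rule bdd) (auto simp: eq)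
    then show ?thesis using lin[OF \<psi> \<phi>, of "- 1"] by simp
  qed
  have ev_add: "L (ev (u + a *\<^sub>C v)) = L (ev u) + a * L (ev v)" if "u \<in> K" "v \<in> K" for u v a
  proof -
    have "L (ev (u + a *\<^sub>C v)) = L (\<lambda>w. ev u w + a * ev v w)"
    proof (rule ext)
      show "(\<lambda>w. ev u w + a * ev v w) \<in> antidual K (knorm kin)"
      proof -
        have "ev (u + a *\<^sub>C v) \<in> antidual K (knorm kin)"
          using that by (simp add: ev mems)
        moreover have "ev (u + a *\<^sub>C v) w = ev u w + a * ev v w" if "w \<in> K" for w
          unfolding ev_def using that \<open>u \<in> K\<close> \<open>v \<in> K\<close> by (rule kin_linear)
        ultimately show ?thesis by (simp add: antidual_def mems)
      qed
      show "ev (u + a *\<^sub>C v) \<in> antidual K (knorm kin)"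
        using that by (simp add: ev mems)
      show "ev (u + a *\<^sub>C v) w = ev u w + a * ev v w" if "w \<in> K" for w
        unfolding ev_def using that \<open>u \<in> K\<close> \<open>v \<in> K\<close> by (rule kin_linear)
    qed
    then show ?thesis using lin[OF ev[OF that(1)] ev[OF that(2)]] by simp
  qed
  obtain \<kappa> where \<kappa>: "\<kappa> \<in> K" "\<And>k. k \<in> K \<Longrightarrow> L (ev k) = kin \<kappa> k"
  proof (rule riesz[of "\<lambda>k. L (ev k)"])
    show "cmod (L (ev k)) \<le> C * knorm kin k" if "k \<in> K" for k
      using that by (intro bdd) (auto simp: ev ev_bound)
  qed (use ev_add in auto)
  have "L \<psi> = \<psi> \<kappa>" if \<psi>: "\<psi> \<in> antidual K (knorm kin)" for \<psi>
  proof -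
    obtain c where c: "\<And>u. u \<in> K \<Longrightarrow> cmod (\<psi> u) \<le> c * knorm kin u"
      using \<psi> unfolding antidual_def by blast
    obtain k where k: "k \<in> K" "\<And>u. u \<in> K \<Longrightarrow> cnj (\<psi> u) = kin k u"
    proof (rule riesz[of "\<lambda>u. cnj (\<psi> u)"])
      show "cmod (cnj (\<psi> u)) \<le> c * knorm kin u" if "u \<in> K" for u using c[OF that] by simp
    qed (use \<psi> in \<open>auto simp: antidual_def\<close>)
    have \<psi>k: "\<psi> u = ev k u" if "u \<in> K" for u
      using k(2)[OF that] kin_commute[OF that k(1)] unfolding ev_def by (metis complex_cnj_cnj)
    then have "L \<psi> = L (ev k)" using \<psi> ev[OF k(1)] by (intro ext)
    also have "\<dots> = ev k \<kappa>" using \<kappa> k by (simp add: ev_def)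
    finally show ?thesis using \<psi>k[OF \<kappa>(1)] by simp
  qed
  with \<kappa>(1) show ?thesis using that by blast
qed

end

section \<open>Closed subspaces, orthogonal projections and adjoints\<close>

lemma knorm_cinner [simp]: "knorm cinner x = norm x"
  by (simp add: knorm_def cinner_self)

lemma hilbert_form_closed:
  assumes "closed V" "cvec.subspace V"
  shows "hilbert_form V cinner"
proof
  fix X :: "nat \<Rightarrow> 'a"
  assume X: "\<And>n. X n \<in> V"
    and c: "\<And>\<epsilon>. \<epsilon> > 0 \<Longrightarrow> \<exists>N. \<forall>m\<ge>N. \<forall>n\<ge>N. knorm cinner (X m - X n) < \<epsilon>"
  have "Cauchy X"
    using c by (auto simp: Cauchy_def dist_norm)
  then obtain x where x: "X \<longlonglongrightarrow> x"
    using Cauchy_convergent_iff convergent_def by blast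
  then have "x \<in> V"
    using assms(1) X closed_sequentially by blast
  moreover have "(\<lambda>n. knorm cinner (X n - x)) \<longlonglongrightarrow> 0"
    using x by (simp add: LIM_zero tendsto_norm_zero)
  ultimately show "\<exists>x\<in>V. (\<lambda>n. knorm cinner (X n - x)) \<longlonglongrightarrow> 0" by blast
next
  show "cinner u v = cnj (cinner v u)" for u v :: 'a by (rule cinner_commute)
qed (use assms in \<open>auto simp: cinner_add_right cinner_scaleC_right cinner_self\<close>)

lemma cinner_bound: "cmod (cinner x y) \<le> norm x * norm y"
  using hilbert_form.cauchy_schwarz[OF hilbert_form_closed, of UNIV x y] by simp

lemma bounded_linear_cinner_right: "bounded_linear (cinner x)"
proof (rule bounded_linear_intro)
  show "norm (cinner x y) \<le> norm y * norm x" for y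
    using cinner_bound[of x y] by (simp add: mult.commute)
qed (simp_all add: cinner_add_right scaleR_eq_scaleC cinner_scaleC_right scaleR_conv_of_real)

lemmas tendsto_cinner_right = bounded_linear.tendsto[OF bounded_linear_cinner_right]

text \<open>The projection of \<open>x\<close> represents the restriction of \<open>cinner x\<close>
  to \<open>V\<close>.\<close>

lemma projection_exists:
  assumes "closed V" "cvec.subspace V"
  obtains y where "y \<in> V" "\<And>z. z \<in> V \<Longrightarrow> cinner z (x - y) = 0"
proof -
  interpret hilbert_form V cinner by (rule hilbert_form_closed[OF assms])
  obtain y where y: "y \<in> V" "\<And>u. u \<in> V \<Longrightarrow> cinner x u = cinner y u"
  proof (rule riesz[of "cinner x"])
    show "cmod (cinner x u) \<le> norm x * knorm cinner u" for u
      by (simp add: cinner_bound)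
  qed (auto simp: cinner_add_right cinner_scaleC_right)
  have "cinner z (x - y) = 0" if "z \<in> V" for z
    using y(2)[OF that] cinner_commute[of z "x - y"] by (simp add: cinner_diff_left)
  with y(1) show ?thesis using that by blast
qed

lemma ortho_proj_eq:
  assumes "cvec.subspace V" "y \<in> V" "\<And>z. z \<in> V \<Longrightarrow> cinner z (x - y) = 0"
  shows "ortho_proj V x = y"
  unfolding ortho_proj_def
proof (rule the_equality)
  fix y' assume y': "y' \<in> V \<and> (\<forall>z\<in>V. cinner z (x - y') = 0)"
  have d: "y' - y \<in> V" using assms y' by (simp add: cvec.subspace_diff)
  have "cinner (y' - y) ((x - y) - (x - y')) = 0"
    using assms(3)[OF d] y' d by (subst cinner_diff_right) simp
  then show "y' = y" by simp
qed (use assms in auto)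

text \<open>Boundedness is what makes the definite description in \<open>cadjoint\<close> denote:
  Riesz gives existence, and \<open>cinner_ext\<close> gives uniqueness.\<close>

lemma cadjoint_eq:
  fixes A :: "'h::complex_hilbert \<Rightarrow> 'h"
  assumes lin: "\<And>x y a. A (x + a *\<^sub>C y) = A x + a *\<^sub>C A y"
    and bdd: "\<And>x. norm (A x) \<le> C * norm x"
  shows "cinner (cadjoint A x) y = cinner x (A y)"
proof -
  have "\<exists>z. \<forall>y. cinner x (A y) = cinner z y" for x
  proof -
    interpret hilbert_form "UNIV :: 'h set" cinner by (rule hilbert_form_closed) auto
    obtain z where "\<And>y. cinner x (A y) = cinner z y"
    proof (rule riesz[of "\<lambda>y. cinner x (A y)"])
      show "cmod (cinner x (A u)) \<le> (norm x * C) * knorm cinner u" for u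
        using cinner_bound[of x "A u"] mult_left_mono[OF bdd[of u], of "norm x"]
        by (simp add: mult.assoc)
    qed (auto simp: lin cinner_add_right cinner_scaleC_right)
    then show ?thesis by blast
  qed
  then obtain B where B: "\<And>x y. cinner (B x) y = cinner x (A y)" by metis
  have "cadjoint A = B"
    unfolding cadjoint_def
  proof (rule the_equality)
    fix B' assume B': "\<forall>x y. cinner (B' x) y = cinner x (A y)"
    show "B' = B"
    proof (rule ext, rule cinner_ext)
      show "cinner z (B' x) = cinner z (B x)" for x z
        by (metis B B' cinner_commute)
    qed
  qed (use B in auto)
  then show ?thesis by (simp add: B)
qed

lemma norm_add_sq:
  fixes A :: "'h::complex_hilbert \<Rightarrow> 'h"
  shows "norm (x + y) ^ 2 = norm x ^ 2 + norm y ^ 2 + 2 * Re (cinner x y)"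
proof -
  have "Re (cinner y x) = Re (cinner x y)"
    by (subst cinner_commute) simp
  then have "Re (cinner (x + y) (x + y)) = Re (cinner x x) + Re (cinner y y) + 2 * Re (cinner x y)"
    by (simp add: cinner_add_left cinner_add_right)
  then show ?thesis by (simp add: cinner_self)
qed

section \<open>Orthonormal bases and traces\<close>

lemma bounded_linear_scaleC: "bounded_linear ((*\<^sub>C) c :: 'h::complex_hilbert \<Rightarrow> 'h)"
  by (rule bounded_linear_intro[where K = "cmod c"])
     (auto simp: scaleC_add_right scaleR_eq_scaleC scaleC_scaleC mult_ac norm_scaleC)

lemma subspace_closure:
  fixes S :: "'h::complex_hilbert set"
  assumes "cvec.subspace S"
  shows "cvec.subspace (closure S)"
proof (rule cvec.subspaceI)
  show "0 \<in> closure S"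
    using assms cvec.subspace_0 closure_subset by blast
next
  fix x y assume "x \<in> closure S" "y \<in> closure S"
  then obtain f g where f: "\<forall>n. f n \<in> S" "f \<longlonglongrightarrow> x" and g: "\<forall>n. g n \<in> S" "g \<longlonglongrightarrow> y"
    by (auto simp: closure_sequential)
  then have "(\<lambda>n. f n + g n) \<longlonglongrightarrow> x + y" "\<forall>n. f n + g n \<in> S"
    by (auto intro: tendsto_add cvec.subspace_add[OF assms])
  then show "x + y \<in> closure S" by (auto simp: closure_sequential)
next
  fix c and x :: 'h assume "x \<in> closure S"
  then obtain f where f: "\<forall>n. f n \<in> S" "f \<longlonglongrightarrow> x"
    by (auto simp: closure_sequential)
  then have "(\<lambda>n. c *\<^sub>C f n) \<longlonglongrightarrow> c *\<^sub>C x"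
    using bounded_linear.tendsto[OF bounded_linear_scaleC] by blast
  with f show "c *\<^sub>C x \<in> closure S"
    using cvec.subspace_scale[OF assms] unfolding closure_sequential
    by (intro exI[of _ "\<lambda>n. c *\<^sub>C f n"]) blast
qed

text \<open>\<open>has_trace\<close> quantifies over all bases, so its value is unique only if some
  basis exists. A maximal orthonormal set has dense span, because otherwise the normalised component
  of a vector orthogonal to the closed span could be added.\<close>

lemma orthonormal_basis_exists: "\<exists>B :: 'h::complex_hilbert set. orthonormal_basis B"
proof -
  define ON where "ON = {B :: 'h set. \<forall>a\<in>B. \<forall>b\<in>B. cinner a b = (if a = b then 1 else 0)}"
  have "\<exists>M\<in>ON. \<forall>X\<in>ON. M \<subseteq> X \<longrightarrow> X = M"
  proof (rule subset_Zorn_nonempty)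
    show "ON \<noteq> {}" by (auto simp: ON_def)
    fix \<C> assume C: "\<C> \<noteq> {}" "subset.chain ON \<C>"
    have "cinner a b = (if a = b then 1 else 0)" if ab: "a \<in> \<Union>\<C>" "b \<in> \<Union>\<C>" for a b
    proof -
      obtain X Y where XY: "X \<in> \<C>" "Y \<in> \<C>" "a \<in> X" "b \<in> Y" using ab by blast
      then have "X \<subseteq> Y \<or> Y \<subseteq> X"
        using C(2) by (auto simp: subset.chain_def)
      then obtain Z where "Z \<in> \<C>" "a \<in> Z" "b \<in> Z" using XY by blast
      then show ?thesis
        using C(2) by (auto simp: subset.chain_def ON_def)
    qed
    then show "\<Union>\<C> \<in> ON" by (auto simp: ON_def)
  qed
  then obtain B where B: "B \<in> ON" and max: "\<And>X. X \<in> ON \<Longrightarrow> B \<subseteq> X \<Longrightarrow> X = B" by blast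
  let ?W = "closure (cvec.span B)"
  have W: "closed ?W" "cvec.subspace ?W"
    by (auto intro: subspace_closure cvec.subspace_span)
  have BW: "B \<subseteq> ?W"
    using cvec.span_superset closure_subset by blast
  have "x \<in> ?W" for x
  proof (rule ccontr)
    assume x: "x \<notin> ?W"
    obtain y where y: "y \<in> ?W" "\<And>z. z \<in> ?W \<Longrightarrow> cinner z (x - y) = 0"
      using projection_exists[OF W, of x] by blast
    have ne: "x - y \<noteq> 0" using x y(1) by auto
    define w where "w = complex_of_real (1 / norm (x - y)) *\<^sub>C (x - y)"
    have w1: "cinner w w = 1"
      using ne by (simp add: w_def cinner_self norm_scaleC norm_divide)
    have w0: "cinner z w = 0" "cinner w z = 0" if "z \<in> B" for z
    proof -
      show "cinner z w = 0" using y(2) that BW by (auto simp: w_def cinner_scaleC_right)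
      then show "cinner w z = 0" by (metis cinner_commute complex_cnj_zero)
    qed
    have "insert w B \<in> ON"
      using B w1 w0 by (auto simp: ON_def)
    then have "w \<in> B" using max[of "insert w B"] by auto
    then show False using w0 w1 by fastforce
  qed
  then have "orthonormal_basis B"
    using B by (auto simp: orthonormal_basis_def ON_def)
  then show ?thesis ..
qed

text \<open>This sum is the trace of the rank-one operator |a><b|, the building block of the trace
  of the finite-rank current.\<close>

lemma parseval:
  fixes B :: "'h::complex_hilbert set"
  assumes B: "orthonormal_basis B"
  shows "((\<lambda>x. cinner b x * cinner x a) has_sum cinner b a) B"
proof -
  define P where "P F = (\<Sum>x\<in>F. cinner x a *\<^sub>C x)" for F
  have on: "cinner x y = (if x = y then 1 else 0)" if "x \<in> B" "y \<in> B" for x y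
    using B that by (auto simp: orthonormal_basis_def)
  have "(P \<longlongrightarrow> a) (finite_subsets_at_top B)"
  proof (rule tendstoI)
    fix e :: real assume "e > 0"
    have "a \<in> closure (cvec.span B)"
      using B by (simp add: orthonormal_basis_def)
    then obtain s where s: "s \<in> cvec.span B" "dist s a < e"
      using \<open>e > 0\<close> closure_approachable by blast
    obtain F0 r where F0: "finite F0" "F0 \<subseteq> B" "s = (\<Sum>x\<in>F0. r x *\<^sub>C x)"
      using s(1) unfolding cvec.span_explicit by blast
    have sF: "s \<in> cvec.span F0"
      unfolding F0(3) by (intro cvec.span_sum cvec.span_scale cvec.span_base)
    have "dist (P F) a < e" if F: "finite F" "F0 \<subseteq> F" "F \<subseteq> B" for F
    proof -
      have perp: "cinner y (a - P F) = 0" if "y \<in> F" for y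
      proof -
        have "cinner y (P F) = (\<Sum>x\<in>F. cinner x a * (if y = x then 1 else 0))"
          unfolding P_def cinner_sum_right
          using F that by (intro sum.cong) (auto simp: cinner_scaleC_right on subset_iff)
        then show ?thesis using F that by (simp add: cinner_diff_right if_distrib sum.delta cong: if_cong)
      qed
      have "cinner z (a - P F) = 0" if "z \<in> cvec.span F" for z
        using that
        by (induction rule: cvec.span_induct_alt)
           (auto simp: cinner_add_left cinner_scaleC_left perp)
      moreover have "P F \<in> cvec.span F" unfolding P_def
        by (intro cvec.span_sum cvec.span_scale cvec.span_base)
      moreover have "s \<in> cvec.span F"
        using sF F(2) cvec.span_mono by blast
      \<comment> \<open>\<open>P F\<close> is the orthogonal projection of \<open>a\<close> onto the
        span of \<open>F\<close>. By Pythagoras it is at least as close to \<open>a\<close> as the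
        approximant \<open>s\<close>, for every \<open>F\<close> that contains
        \<open>F0\<close>.\<close>
      ultimately have "cinner (P F - s) (a - P F) = 0"
        by (simp add: cvec.span_diff)
      then have "norm (a - s) ^ 2 = norm (P F - s) ^ 2 + norm (a - P F) ^ 2"
        using norm_add_sq[of "P F - s" "a - P F"] by simp
      then have "norm (a - P F) ^ 2 \<le> norm (a - s) ^ 2" by simp
      then have "norm (a - P F) \<le> norm (a - s)"
        using power2_le_imp_le norm_ge_zero by blast
      then show ?thesis using s(2) by (simp add: dist_norm norm_minus_commute)
    qed
    then show "\<forall>\<^sub>F F in finite_subsets_at_top B. dist (P F) a < e"
      using F0 by (auto simp: eventually_finite_subsets_at_top)
  qed
  then have "((\<lambda>F. cinner b (P F)) \<longlongrightarrow> cinner b a) (finite_subsets_at_top B)"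
    by (rule tendsto_cinner_right)
  then show ?thesis
    by (simp add: has_sum_def P_def cinner_sum_right cinner_scaleC_right mult.commute)
qed

lemma has_trace_unique:
  assumes "has_trace A c" "has_trace A d"
  shows "c = d"
  using assms orthonormal_basis_exists has_sum_unique unfolding has_trace_def by blast

lemma op_trace_eq: "has_trace A c \<Longrightarrow> op_trace A = c"
  unfolding op_trace_def by (rule the_equality) (auto intro: has_trace_unique)

lemma has_sum_diff_complex:
  fixes f g :: "'a \<Rightarrow> complex"
  assumes "(f has_sum a) A" "(g has_sum b) A"
  shows "((\<lambda>x. f x - g x) has_sum a - b) A"
  using assms unfolding has_sum_def sum_subtractf by (rule tendsto_diff)

lemma has_sum_sum_finite:
  fixes f :: "'i \<Rightarrow> 'a \<Rightarrow> complex"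
  assumes "\<And>i. i \<in> I \<Longrightarrow> (f i has_sum s i) A"
  shows "((\<lambda>x. \<Sum>i\<in>I. f i x) has_sum (\<Sum>i\<in>I. s i)) A"
  using assms by (induction I rule: infinite_finite_induct) (auto intro!: has_sum_add)

section \<open>Boundary values of Poisson integrals\<close>

definition L1_shift :: "(real \<Rightarrow> complex) \<Rightarrow> real \<Rightarrow> real" where
  "L1_shift g h = (LINT x|lborel. norm (g (x + h) - g x))"

lemma integrable_shift:
  fixes g :: "real \<Rightarrow> complex"
  assumes "integrable lborel g"
  shows "integrable lborel (\<lambda>x. g (x + h))"
  using lborel_integrable_real_affine[OF assms, of 1 h] by (simp add: add.commute)

lemma integral_norm_shift:
  fixes g :: "real \<Rightarrow> complex"
  shows "(LINT x|lborel. norm (g (x + h))) = (LINT x|lborel. norm (g x))"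
  using lborel_integral_real_affine[of 1 "\<lambda>x. norm (g x)" h] by (simp add: add.commute)

lemma L1_shift_nonneg: "0 \<le> L1_shift g h"
  by (simp add: L1_shift_def)

lemma L1_shift_bound:
  assumes g: "integrable lborel g"
  shows "L1_shift g h \<le> 2 * (LINT x|lborel. norm (g x))"
proof -
  have "L1_shift g h \<le> (LINT x|lborel. norm (g (x + h)) + norm (g x))"
    unfolding L1_shift_def
    by (rule integral_mono)
       (auto intro!: g integrable_shift Bochner_Integration.integrable_diff
          Bochner_Integration.integrable_add integrable_norm norm_triangle_ineq4)
  also have "\<dots> = 2 * (LINT x|lborel. norm (g x))"
    using g by (simp add: integrable_shift integral_norm_shift)
  finally show ?thesis .
qed

lemma L1_shift_add:
  assumes f: "integrable lborel f" and g: "integrable lborel g"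
  shows "L1_shift (\<lambda>x. f x + g x) h \<le> L1_shift f h + L1_shift g h"
proof -
  have "L1_shift (\<lambda>x. f x + g x) h \<le>
      (LINT x|lborel. norm (f (x + h) - f x) + norm (g (x + h) - g x))"
    unfolding L1_shift_def
  proof (rule integral_mono)
    show "norm (f (x + h) + g (x + h) - (f x + g x)) \<le> norm (f (x + h) - f x) + norm (g (x + h) - g x)"
      for x by (metis add_diff_add norm_triangle_ineq)
  qed (auto intro!: f g integrable_shift Bochner_Integration.integrable_diff
      Bochner_Integration.integrable_add integrable_norm)
  also have "\<dots> = L1_shift f h + L1_shift g h"
    unfolding L1_shift_def
    by (rule Bochner_Integration.integral_add)
       (auto intro!: f g integrable_shift Bochner_Integration.integrable_diff integrable_norm)
  finally show ?thesis .
qed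

definition L1_shift_continuous :: "(real \<Rightarrow> complex) \<Rightarrow> bool" where
  "L1_shift_continuous g \<longleftrightarrow> (L1_shift g \<longlongrightarrow> 0) (at 0)"

lemma L1_shift_continuous_0: "L1_shift_continuous (\<lambda>x. 0)"
proof -
  have "L1_shift (\<lambda>x. 0) = (\<lambda>h. 0)" by (simp add: L1_shift_def fun_eq_iff)
  then show ?thesis by (simp add: L1_shift_continuous_def)
qed

lemma L1_shift_continuous_add:
  assumes "integrable lborel f" "integrable lborel g"
    and "L1_shift_continuous f" "L1_shift_continuous g"
  shows "L1_shift_continuous (\<lambda>x. f x + g x)"
  unfolding L1_shift_continuous_def
proof (rule real_tendsto_sandwich[where f = "\<lambda>_. 0"])
  show "((\<lambda>h. L1_shift f h + L1_shift g h) \<longlongrightarrow> 0) (at 0)"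
    using assms(3,4) tendsto_add_zero unfolding L1_shift_continuous_def by blast
  show "\<forall>\<^sub>F h in at (0::real). (0::real) \<le> L1_shift (\<lambda>x. f x + g x) h"
    by (intro always_eventually allI L1_shift_nonneg)
  show "\<forall>\<^sub>F h in at 0. L1_shift (\<lambda>x. f x + g x) h \<le> L1_shift f h + L1_shift g h"
    by (intro always_eventually allI L1_shift_add assms)
qed (rule tendsto_const)

lemma L1_shift_continuous_cmult:
  assumes "L1_shift_continuous g"
  shows "L1_shift_continuous (\<lambda>x. c * g x)"
proof -
  have "L1_shift (\<lambda>x. c * g x) = (\<lambda>h. norm c * L1_shift g h)"
    by (auto simp: L1_shift_def fun_eq_iff norm_mult simp flip: right_diff_distrib)
  then show ?thesis
    using assms tendsto_mult_right_zero[of "L1_shift g" "at 0" "norm c"]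
    by (simp add: L1_shift_continuous_def)
qed

text \<open>Dominated convergence brings \<open>s i\<close> close to \<open>f\<close> in L1, and the
  shift of the difference costs at most twice that distance, uniformly in \<open>h\<close>.\<close>

lemma L1_shift_continuous_limit:
  fixes s :: "nat \<Rightarrow> real \<Rightarrow> complex"
  assumes s: "\<And>i. integrable lborel (s i)" "\<And>i. L1_shift_continuous (s i)"
    and lim: "\<And>x. (\<lambda>i. s i x) \<longlonglongrightarrow> f x"
    and w: "integrable lborel w" "\<And>i x. norm (s i x) \<le> w x"
    and f: "integrable lborel f"
  shows "L1_shift_continuous f"
proof -
  have "(\<lambda>i. LINT x|lborel. norm (f x - s i x)) \<longlonglongrightarrow> (LINT x|lborel. norm (f x - f x))"
  proof (rule integral_dominated_convergence[where w = "\<lambda>x. norm (f x) + w x"])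
    show "AE x in lborel. (\<lambda>i. norm (f x - s i x)) \<longlonglongrightarrow> norm (f x - f x)"
      by (intro AE_I2 tendsto_intros lim)
    show "AE x in lborel. norm (norm (f x - s i x)) \<le> norm (f x) + w x" for i
    proof (intro AE_I2)
      fix x
      have "norm (f x - s i x) \<le> norm (f x) + norm (s i x)" by (rule norm_triangle_ineq4)
      then show "norm (norm (f x - s i x)) \<le> norm (f x) + w x"
        using w(2)[of i x] by simp
    qed
  qed (use f s w in \<open>auto intro!: borel_measurable_integrable\<close>)
  then have lim0: "(\<lambda>i. LINT x|lborel. norm (f x - s i x)) \<longlonglongrightarrow> 0" by simp
  show ?thesis
    unfolding L1_shift_continuous_def
  proof (rule tendstoI)
    fix e :: real assume "e > 0"
    then obtain i where i: "(LINT x|lborel. norm (f x - s i x)) < e / 4"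
      using order_tendstoD(2)[OF lim0, of "e / 4"] by (auto simp: eventually_sequentially)
    have "\<forall>\<^sub>F h in at 0. L1_shift (s i) h < e / 2"
      using s(2)[of i] \<open>e > 0\<close> unfolding L1_shift_continuous_def
      by (auto dest!: order_tendstoD(2)[where a = "e / 2"])
    then show "\<forall>\<^sub>F h in at 0. dist (L1_shift f h) 0 < e"
    proof eventually_elim
      case (elim h)
      have "L1_shift (\<lambda>x. s i x + (f x - s i x)) h \<le> L1_shift (s i) h + L1_shift (\<lambda>x. f x - s i x) h"
        using s f by (intro L1_shift_add) auto
      moreover have "L1_shift (\<lambda>x. f x - s i x) h \<le> 2 * (LINT x|lborel. norm (f x - s i x))"
        using s f by (intro L1_shift_bound) auto
      ultimately show ?case
        using elim i L1_shift_nonneg[of f h] by (simp add: dist_norm)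
    qed
  qed
qed

lemma integrable_complex_indicator:
  assumes "A \<in> sets borel" "emeasure lborel A < \<infinity>"
  shows "integrable lborel (\<lambda>x. indicator A x :: complex)"
proof -
  have "(\<lambda>x. indicator A x *\<^sub>R (1::complex)) = (\<lambda>x. indicator A x)"
    by (auto simp: indicator_def fun_eq_iff)
  then show ?thesis
    using integrable_indicator[of A lborel "1::complex"] assms by simp
qed

lemma emeasure_interval_finite: "emeasure lborel {a<..<b::real} < \<infinity>"
  by (rule le_less_trans[OF emeasure_mono[of _ "{a..b}"]]) (auto simp: emeasure_lborel_Icc_eq)

text \<open>Shifting by \<open>h\<close> changes the indicator only within distance |h| of an
  endpoint; the two neighbourhoods have total length 4|h|.\<close>

lemma L1_shift_continuous_interval: "L1_shift_continuous (\<lambda>x. indicator {a<..<b} x)"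
proof -
  have "L1_shift (\<lambda>x. indicator {a<..<b} x) h \<le> 4 * \<bar>h\<bar>" for h
  proof -
    let ?I = "\<lambda>c. {c - \<bar>h\<bar>..c + \<bar>h\<bar>}"
    have "L1_shift (\<lambda>x. indicator {a<..<b} x) h \<le>
        (LINT x|lborel. indicator (?I a) x + indicator (?I b) x)"
      unfolding L1_shift_def
    proof (rule integral_mono)
      have "integrable lborel (\<lambda>x. indicator {a<..<b} x :: complex)"
        by (intro integrable_complex_indicator emeasure_interval_finite) auto
      then show "integrable lborel (\<lambda>x. norm (indicator {a<..<b} (x + h) - indicator {a<..<b} x :: complex))"
        by (auto intro!: integrable_shift Bochner_Integration.integrable_diff integrable_norm)
      show "norm (indicator {a<..<b} (x + h) - indicator {a<..<b} x :: complex) \<le>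
          indicator (?I a) x + indicator (?I b) x" for x
        by (auto simp: indicator_def)
    qed (auto intro!: integrable_real_indicator Bochner_Integration.integrable_add)
    also have "\<dots> = 4 * \<bar>h\<bar>"
      by (subst Bochner_Integration.integral_add) auto
    finally show ?thesis .
  qed
  then have "\<forall>\<^sub>F h in at (0::real). norm (L1_shift (\<lambda>x. indicator {a<..<b} x) h) \<le> 4 * \<bar>h\<bar>"
    by (intro always_eventually allI) (simp add: L1_shift_nonneg)
  moreover have "((\<lambda>h::real. 4 * \<bar>h\<bar>) \<longlongrightarrow> 0) (at 0)"
    by (rule tendsto_mult_right_zero[OF tendsto_rabs_zero[OF tendsto_ident_at]])
  ultimately show ?thesis
    unfolding L1_shift_continuous_def by (rule Lim_null_comparison)
qed

lemma integrable_indicator_Int: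
  assumes "A \<in> sets borel"
  shows "integrable lborel (\<lambda>x. indicator (A \<inter> {a<..<b::real}) x :: complex)"
proof -
  have "emeasure lborel (A \<inter> {a<..<b}) \<le> emeasure lborel {a<..<b}"
    using assms by (intro emeasure_mono) auto
  also have "\<dots> < \<infinity>" by (rule emeasure_interval_finite)
  finally show ?thesis
    using assms by (intro integrable_complex_indicator) auto
qed

text \<open>Intersecting with a bounded interval keeps every indicator integrable, complements
  included, so that the sets with this property form a Dynkin system containing the open
  intervals.\<close>

lemma L1_shift_continuous_Int_interval:
  assumes "A \<in> sets borel"
  shows "L1_shift_continuous (\<lambda>x. indicator (A \<inter> {a<..<b}) x)"
proof -
  let ?G = "range (\<lambda>(c, d). {c<..<d :: real})"
  have borel: "sigma_sets UNIV ?G = sets borel"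
    unfolding borel_eq_box by (simp add: case_prod_beta box_real(1))
  have "Int_stable ?G"
    by (auto simp: Int_stable_def Int_greaterThanLessThan)
  moreover have "?G \<subseteq> Pow UNIV" by auto
  moreover have "A \<in> sigma_sets UNIV ?G" using assms borel by simp
  ultimately show ?thesis
  proof (induction rule: sigma_sets_induct_disjoint)
    case (basic A)
    then show ?case by (auto intro!: L1_shift_continuous_interval)
  next
    case empty
    then show ?case by (simp add: L1_shift_continuous_0)
  next
    case (compl A)
    then have A: "A \<in> sets borel" using borel by simp
    have "(\<lambda>x. indicator ((UNIV - A) \<inter> {a<..<b}) x :: complex) =
        (\<lambda>x. indicator {a<..<b} x + (- 1) * indicator (A \<inter> {a<..<b}) x)"
      by (auto simp: indicator_def fun_eq_iff)
    moreover have "integrable lborel (\<lambda>x. indicator {a<..<b} x :: complex)"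
      using integrable_indicator_Int[of UNIV a b] by simp
    ultimately show ?case
      using integrable_indicator_Int[OF A, of a b] compl(2)
      by (simp only:) (intro L1_shift_continuous_add L1_shift_continuous_cmult
          L1_shift_continuous_interval integrable_mult_right)
  next
    case (union A)
    have A: "A i \<in> sets borel" for i using union(2) borel by auto
    have step: "L1_shift_continuous (\<lambda>x. indicator ((\<Union>i<n. A i) \<inter> {a<..<b}) x)" for n
    proof (induction n)
      case 0
      then show ?case by (simp add: L1_shift_continuous_0)
    next
      case (Suc n)
      have "(\<lambda>x. indicator ((\<Union>i<Suc n. A i) \<inter> {a<..<b}) x :: complex) =
        (\<lambda>x. indicator ((\<Union>i<n. A i) \<inter> {a<..<b}) x + indicator (A n \<inter> {a<..<b}) x)"
      proof
        fix x
        have "x \<notin> A n" if "i < n" "x \<in> A i" for i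
          using union(1) that unfolding disjoint_family_on_def by (metis Int_iff UNIV_I empty_iff less_irrefl)
        then show "(indicator ((\<Union>i<Suc n. A i) \<inter> {a<..<b}) x :: complex) =
            indicator ((\<Union>i<n. A i) \<inter> {a<..<b}) x + indicator (A n \<inter> {a<..<b}) x"
          unfolding lessThan_Suc by (auto simp: indicator_def)
      qed
      moreover have "(\<Union>i<n. A i) \<in> sets borel" using A by auto
      ultimately show ?case
        using Suc union(3)[of n] A
        by (simp only:) (intro L1_shift_continuous_add integrable_indicator_Int)
    qed
    show ?case
    proof (rule L1_shift_continuous_limit[OF _ step])
      show "integrable lborel (\<lambda>x. indicator {a<..<b} x :: real)"
        using emeasure_interval_finite[of a b] by auto
      show "(\<lambda>n. indicator ((\<Union>i<n. A i) \<inter> {a<..<b}) x :: complex) \<longlonglongrightarrow>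
          indicator (\<Union> (range A) \<inter> {a<..<b}) x" for x
      proof (cases "\<exists>i. x \<in> A i")
        case True
        then obtain i where "x \<in> A i" by blast
        then have "\<forall>\<^sub>F n in sequentially. (indicator (\<Union> (range A) \<inter> {a<..<b}) x :: complex) =
            indicator ((\<Union>i<n. A i) \<inter> {a<..<b}) x"
          unfolding eventually_sequentially by (intro exI[of _ "Suc i"]) (auto simp: indicator_def)
        then show ?thesis by (rule Lim_transform_eventually[OF tendsto_const])
      next
        case False
        then have "(indicator ((\<Union>i<n. A i) \<inter> {a<..<b}) x :: complex) = 0"
          "(indicator (\<Union> (range A) \<inter> {a<..<b}) x :: complex) = 0" for n
          by (auto simp: indicator_def)
        then show ?thesis by simp
      qed
      show "norm (indicator ((\<Union>i<n. A i) \<inter> {a<..<b}) x :: complex) \<le> indicator {a<..<b} x" for n x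
        by (simp add: indicator_def)
    qed (use A in \<open>auto intro!: integrable_indicator_Int simp del: Int_iff indicator_simps\<close>)
  qed
qed

text \<open>Induction on integrable functions. The base case, a set of finite measure, is reached
  from its truncations to the intervals from -n to n.\<close>

lemma L1_shift_continuous_integrable:
  fixes g :: "real \<Rightarrow> complex"
  assumes "integrable lborel g"
  shows "L1_shift_continuous g"
  using assms
proof (induction rule: integrable_induct)
  case (base A c)
  then have A: "A \<in> sets borel" by simp
  have iA: "integrable lborel (\<lambda>x. indicator A x :: complex)" "integrable lborel (\<lambda>x. indicator A x :: real)"
    using base A by (auto intro!: integrable_complex_indicator)
  have "L1_shift_continuous (\<lambda>x. indicator A x)"
  proof (rule L1_shift_continuous_limit[where s = "\<lambda>n x. indicator (A \<inter> {- real n<..<real n}) x"])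
    show "(\<lambda>n. indicator (A \<inter> {- real n<..<real n}) x :: complex) \<longlonglongrightarrow> indicator A x" for x
    proof -
      obtain N where "\<bar>x\<bar> < real N" using reals_Archimedean2 by blast
      then have "\<forall>\<^sub>F n in sequentially. (indicator A x :: complex) =
            indicator (A \<inter> {- real n<..<real n}) x"
        unfolding eventually_sequentially by (intro exI[of _ N]) (auto simp: indicator_def)
      then show ?thesis by (rule Lim_transform_eventually[OF tendsto_const])
    qed
    show "norm (indicator (A \<inter> {- real n<..<real n}) x :: complex) \<le> indicator A x" for n x
      by (simp add: indicator_def)
  qed (use A iA in \<open>auto intro!: integrable_indicator_Int L1_shift_continuous_Int_interval
      simp del: Int_iff indicator_simps\<close>)
  moreover have "(\<lambda>x. indicat_real A x *\<^sub>R c) = (\<lambda>x. c * indicator A x)"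
    by (auto simp: fun_eq_iff indicator_def)
  ultimately show ?case
    by (simp only:) (rule L1_shift_continuous_cmult)
next
  case (add f g)
  then show ?case by (intro L1_shift_continuous_add)
next
  case (lim f s)
  show ?case
  proof (rule L1_shift_continuous_limit)
    show "integrable lborel (\<lambda>x. 2 * norm (f x))" using lim by simp
    show "norm (s i x) \<le> 2 * norm (f x)" for i x using lim by simp
    show "(\<lambda>i. s i x) \<longlonglongrightarrow> f x" for x using lim by simp
  qed (use lim in blast)+
qed

section \<open>Poisson integrals in L1 and almost everywhere\<close>

lemma cauchy_density: "integrable lborel (\<lambda>t::real. 1 / (1 + t\<^sup>2))"
  "(LINT t|lborel. 1 / (1 + t\<^sup>2)) = pi"
proof -
  have [simp]: "einterval (- \<infinity>) \<infinity> = UNIV" by (auto simp: einterval_def)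
  show "integrable lborel (\<lambda>t::real. 1 / (1 + t\<^sup>2))"
    using Sinc_Integral.integrable_inverse_1_plus_square
    by (simp add: set_integrable_def inverse_eq_divide)
  show "(LINT t|lborel. 1 / (1 + t\<^sup>2)) = pi"
    using Sinc_Integral.LBINT_inverse_1_plus_square
    by (simp add: interval_lebesgue_integral_def set_lebesgue_integral_def inverse_eq_divide)
qed

text \<open>Substituting E' = E + t/(n+1) turns the kernel into 1/(1 + t^2), which is independent of
  n and has mass pi. Fubini then bounds the L1 norm of \<open>u n\<close> by the integral of this
  kernel against \<open>L1_shift g (t/(n+1))\<close>, which vanishes by dominated
  convergence.\<close>

lemma poisson_L1:
  fixes g :: "real \<Rightarrow> complex"
  assumes g: "integrable lborel g"
  defines "u \<equiv> \<lambda>(n::nat) E. (LINT E'|lborel. ((1 / real (Suc n)) / ((E' - E)\<^sup>2 + (1 / real (Suc n))\<^sup>2)) *\<^sub>R g E') - pi *\<^sub>R g E"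
  shows "integrable lborel (u n)" "(\<lambda>n. LINT E|lborel. norm (u n E)) \<longlonglongrightarrow> 0"
proof -
  let ?k = "\<lambda>t::real. 1 / (1 + t\<^sup>2)"
  define \<epsilon> where "\<epsilon> n = 1 / real (Suc n)" for n
  have \<epsilon>: "\<epsilon> n > 0" for n by (simp add: \<epsilon>_def)
  define F where "F n p = ?k (fst p) *\<^sub>R (g (snd p + \<epsilon> n * fst p) - g (snd p))" for n and p :: "real \<times> real"
  note [measurable] = borel_measurable_integrable[OF g]
  have u: "u n E = (LINT t|lborel. F n (t, E))" for n E
  proof -
    have "(LINT E'|lborel. (\<epsilon> n / ((E' - E)\<^sup>2 + (\<epsilon> n)\<^sup>2)) *\<^sub>R g E') =
        \<epsilon> n *\<^sub>R (LINT t|lborel. (\<epsilon> n / ((E + \<epsilon> n * t - E)\<^sup>2 + (\<epsilon> n)\<^sup>2)) *\<^sub>R g (E + \<epsilon> n * t))"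
      using \<epsilon>[of n] by (subst lborel_integral_real_affine[of "\<epsilon> n" _ E]) auto
    also have "\<dots> = (LINT t|lborel. \<epsilon> n *\<^sub>R ((\<epsilon> n / ((E + \<epsilon> n * t - E)\<^sup>2 + (\<epsilon> n)\<^sup>2)) *\<^sub>R g (E + \<epsilon> n * t)))"
      by (rule integral_scaleR_right[symmetric])
    also have "\<dots> = (LINT t|lborel. ?k t *\<^sub>R g (E + \<epsilon> n * t))"
    proof (rule Bochner_Integration.integral_cong[OF refl])
      fix t
      have "\<epsilon> n * (\<epsilon> n / ((E + \<epsilon> n * t - E)\<^sup>2 + (\<epsilon> n)\<^sup>2)) = (\<epsilon> n)\<^sup>2 / ((\<epsilon> n)\<^sup>2 * (1 + t\<^sup>2))"
        by (simp add: power2_eq_square algebra_simps)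
      also have "\<dots> = ?k t" using \<epsilon>[of n] by simp
      finally show "\<epsilon> n *\<^sub>R ((\<epsilon> n / ((E + \<epsilon> n * t - E)\<^sup>2 + (\<epsilon> n)\<^sup>2)) *\<^sub>R g (E + \<epsilon> n * t)) = ?k t *\<^sub>R g (E + \<epsilon> n * t)"
        by simp
    qed
    finally have 1: "u n E = (LINT t|lborel. ?k t *\<^sub>R g (E + \<epsilon> n * t)) - pi *\<^sub>R g E"
      by (simp add: u_def \<epsilon>_def)
    have "integrable lborel (\<lambda>t. g (E + \<epsilon> n * t))"
      using \<epsilon>[of n] by (intro lborel_integrable_real_affine g) auto
    then have i1: "integrable lborel (\<lambda>t. ?k t *\<^sub>R g (E + \<epsilon> n * t))"
    proof (rule Bochner_Integration.integrable_bound)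
      show "AE t in lborel. norm (?k t *\<^sub>R g (E + \<epsilon> n * t)) \<le> norm (g (E + \<epsilon> n * t))"
      proof (intro AE_I2)
        fix t :: real
        have "\<bar>?k t\<bar> \<le> 1" by (simp add: abs_of_nonneg divide_le_eq add_pos_nonneg)
        then show "norm (?k t *\<^sub>R g (E + \<epsilon> n * t)) \<le> norm (g (E + \<epsilon> n * t))"
          unfolding norm_scaleR by (intro mult_left_le_one_le) auto
      qed
    qed measurable
    have i2: "integrable lborel (\<lambda>t. ?k t *\<^sub>R g E)"
      using cauchy_density(1) by (intro integrable_scaleR_left)
    have "(LINT t|lborel. F n (t, E)) = (LINT t|lborel. ?k t *\<^sub>R g (E + \<epsilon> n * t) - ?k t *\<^sub>R g E)"
      by (simp add: F_def scaleR_diff_right)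
    also have "\<dots> = (LINT t|lborel. ?k t *\<^sub>R g (E + \<epsilon> n * t)) - (LINT t|lborel. ?k t *\<^sub>R g E)"
      by (rule Bochner_Integration.integral_diff[OF i1 i2])
    also have "(LINT t|lborel. ?k t *\<^sub>R g E) = pi *\<^sub>R g E"
      using cauchy_density by (subst integral_scaleR_left) auto
    finally show ?thesis using 1 by simp
  qed
  have normF: "(LINT E|lborel. norm (F n (t, E))) = ?k t * L1_shift g (\<epsilon> n * t)" for n t
    by (simp add: F_def L1_shift_def abs_of_nonneg)
  have [measurable]: "F n \<in> borel_measurable (lborel \<Otimes>\<^sub>M lborel)" for n
    unfolding F_def by measurable
  have FE: "integrable lborel (\<lambda>E. F n (t, E))" for n t
    unfolding F_def by (auto intro!: integrable_scaleR_right Bochner_Integration.integrable_diff integrable_shift g)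
  let ?G = "LINT x|lborel. norm (g x)"
  have bound: "norm (?k t * L1_shift g (\<epsilon> n * t)) \<le> ?k t * (2 * ?G)" for n t
    using L1_shift_bound[OF g, of "\<epsilon> n * t"] L1_shift_nonneg[of g "\<epsilon> n * t"]
    by (simp add: abs_mult abs_of_nonneg divide_right_mono)
  have meas: "(\<lambda>t. ?k t * L1_shift g (\<epsilon> n * t)) \<in> borel_measurable lborel" for n
    unfolding normF[symmetric] by measurable
  have dom: "integrable lborel (\<lambda>t. ?k t * (2 * ?G))"
    using cauchy_density(1) by (rule integrable_mult_left)
  have Fp: "integrable (lborel \<Otimes>\<^sub>M lborel) (F n)" for n
  proof (rule lborel_pair.Fubini_integrable)
    show "integrable lborel (\<lambda>x. LINT y|lborel. norm (F n (x, y)))"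
      unfolding normF by (rule Bochner_Integration.integrable_bound[OF dom meas]) (use bound in force)
  qed (use FE in auto)
  show iu: "integrable lborel (u n)" for n
    unfolding u using lborel_pair.integrable_snd[of "\<lambda>x y. F n (x, y)"] Fp[of n] by simp
  have le: "(LINT E|lborel. norm (u n E)) \<le> (LINT t|lborel. ?k t * L1_shift g (\<epsilon> n * t))" for n
  proof -
    have "integrable (lborel \<Otimes>\<^sub>M lborel) (\<lambda>p. norm (F n p))" using Fp by simp
    then have Fn: "integrable (lborel \<Otimes>\<^sub>M lborel) (\<lambda>(t, E). norm (F n (t, E)))"
      by (simp only: case_prod_unfold prod.collapse)
    have "(LINT E|lborel. norm (u n E)) \<le> (LINT E|lborel. LINT t|lborel. norm (F n (t, E)))"
    proof (rule integral_mono)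
      show "integrable lborel (\<lambda>E. LINT t|lborel. norm (F n (t, E)))"
        by (rule lborel_pair.integrable_snd) (fact Fn)
      show "norm (u n E) \<le> (LINT t|lborel. norm (F n (t, E)))" for E
        unfolding u by (rule integral_norm_bound)
    qed (use iu in simp)
    also have "\<dots> = (LINT t|lborel. LINT E|lborel. norm (F n (t, E)))"
      by (rule lborel_pair.Fubini_integral) (fact Fn)
    finally show ?thesis unfolding normF .
  qed
  have "(\<lambda>n. LINT t|lborel. ?k t * L1_shift g (\<epsilon> n * t)) \<longlonglongrightarrow> (LINT t|(lborel :: real measure). (0::real))"
  proof (rule integral_dominated_convergence[where w = "\<lambda>t. ?k t * (2 * ?G)"])
    show "AE t in lborel. norm (?k t * L1_shift g (\<epsilon> n * t)) \<le> ?k t * (2 * ?G)" for n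
      using bound by (intro AE_I2)
    show "AE t in lborel. (\<lambda>n. ?k t * L1_shift g (\<epsilon> n * t)) \<longlonglongrightarrow> 0"
    proof (rule AE_I2, rule tendsto_mult_right_zero)
      fix t
      have e0: "\<epsilon> \<longlonglongrightarrow> 0" unfolding \<epsilon>_def by (rule LIMSEQ_Suc[OF lim_1_over_n])
      \<comment> \<open>The filter \<open>at 0\<close> excludes the point 0, so t = 0 needs its own
        case.\<close>
      show "(\<lambda>n. L1_shift g (\<epsilon> n * t)) \<longlonglongrightarrow> 0"
      proof (cases "t = 0")
        case True
        then show ?thesis by (simp add: L1_shift_def)
      next
        case False
        have "filterlim (\<lambda>n. \<epsilon> n * t) (at 0) sequentially"
          unfolding filterlim_at using e0 False \<epsilon>
          by (auto intro!: tendsto_mult_left_zero always_eventually) (metis less_irrefl)+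
        then show ?thesis
          using L1_shift_continuous_integrable[OF g] unfolding L1_shift_continuous_def
          by (rule filterlim_compose[rotated])
      qed
    qed
  qed (use meas dom in auto)
  then have lim: "(\<lambda>n. LINT t|lborel. ?k t * L1_shift g (\<epsilon> n * t)) \<longlonglongrightarrow> 0" by simp
  have "\<forall>\<^sub>F n in sequentially. norm (LINT E|lborel. norm (u n E)) \<le> (LINT t|lborel. ?k t * L1_shift g (\<epsilon> n * t))"
    using le by simp
  then show "(\<lambda>n. LINT E|lborel. norm (u n E)) \<longlonglongrightarrow> 0"
    using lim by (rule Lim_null_comparison)
qed

text \<open>Convergence in \<open>L\<^sup>1\<close> suffices, because the limits in the Lippmann-Schwinger equation are known
  to exist; this avoids the maximal function.\<close>

lemma poisson_AE_subseq:
  fixes g :: "'i \<Rightarrow> real \<Rightarrow> complex"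
  assumes I: "finite I" and g: "\<And>i. i \<in> I \<Longrightarrow> integrable lborel (g i)"
  obtains \<epsilon> :: "nat \<Rightarrow> real" where "\<And>n. \<epsilon> n > 0" "\<epsilon> \<longlonglongrightarrow> 0"
    "AE E in lborel. \<forall>i\<in>I.
       (\<lambda>n. LINT E'|lborel. (\<epsilon> n / ((E' - E)\<^sup>2 + (\<epsilon> n)\<^sup>2)) *\<^sub>R g i E') \<longlonglongrightarrow> pi *\<^sub>R g i E"
proof -
  define \<delta> where "\<delta> n = 1 / real (Suc n)" for n
  define u where "u i n E = (LINT E'|lborel. (\<delta> n / ((E' - E)\<^sup>2 + (\<delta> n)\<^sup>2)) *\<^sub>R g i E') - pi *\<^sub>R g i E" for i n E
  have u: "integrable lborel (u i n)" "(\<lambda>n. LINT E|lborel. norm (u i n E)) \<longlonglongrightarrow> 0" if "i \<in> I" for i n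
    using poisson_L1[OF g[OF that]] unfolding u_def \<delta>_def by auto
  \<comment> \<open>Summing over the finite family lets one subsequence and one null set serve every
    index.\<close>
  define U where "U n E = (\<Sum>i\<in>I. norm (u i n E))" for n E
  have "integrable lborel (U n)" for n
    unfolding U_def using u by auto
  moreover have "(\<lambda>n. LINT E|lborel. norm (U n E)) \<longlonglongrightarrow> 0"
  proof -
    have "(LINT E|lborel. norm (U n E)) = (\<Sum>i\<in>I. LINT E|lborel. norm (u i n E))" for n
      unfolding U_def using u by (simp add: sum_nonneg abs_of_nonneg)
    moreover have "(\<lambda>n. \<Sum>i\<in>I. LINT E|lborel. norm (u i n E)) \<longlonglongrightarrow> (\<Sum>i\<in>I. 0)"
      using u by (intro tendsto_sum) auto
    ultimately show ?thesis by simp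
  qed
  ultimately obtain r :: "nat \<Rightarrow> nat" where r: "strict_mono r"
    and ae: "AE E in lborel. (\<lambda>n. U (r n) E) \<longlonglongrightarrow> 0"
    using tendsto_L1_AE_subseq[of lborel U] by blast
  show ?thesis
  proof (rule that[of "\<delta> \<circ> r"])
    show "(\<delta> \<circ> r) n > 0" for n by (simp add: \<delta>_def)
    have "\<delta> \<longlonglongrightarrow> 0" unfolding \<delta>_def by (rule LIMSEQ_Suc[OF lim_1_over_n])
    then show "(\<delta> \<circ> r) \<longlonglongrightarrow> 0" by (rule LIMSEQ_subseq_LIMSEQ[OF _ r])
    show "AE E in lborel. \<forall>i\<in>I.
       (\<lambda>n. LINT E'|lborel. ((\<delta> \<circ> r) n / ((E' - E)\<^sup>2 + ((\<delta> \<circ> r) n)\<^sup>2)) *\<^sub>R g i E') \<longlonglongrightarrow> pi *\<^sub>R g i E"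
      using ae
    proof eventually_elim
      case (elim E)
      show ?case
      proof
        fix i assume i: "i \<in> I"
        have "(\<lambda>n. u i (r n) E) \<longlonglongrightarrow> 0"
        proof (rule Lim_null_comparison[OF _ elim])
          show "\<forall>\<^sub>F n in sequentially. norm (u i (r n) E) \<le> U (r n) E"
            unfolding U_def using I i by (intro always_eventually allI member_le_sum) auto
        qed
        then show "(\<lambda>n. LINT E'|lborel. ((\<delta> \<circ> r) n / ((E' - E)\<^sup>2 + ((\<delta> \<circ> r) n)\<^sup>2)) *\<^sub>R g i E') \<longlonglongrightarrow> pi *\<^sub>R g i E"
          by (simp add: u_def LIM_zero_cancel)
      qed
    qed
  qed
qed

section \<open>Square integrable functions\<close>

lemma borel_measurable_cnj [measurable]: "cnj \<in> borel_measurable borel"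
  by (intro borel_measurable_continuous_onI continuous_intros)

lemma cmod_add_mult_sq:
  "(cmod (p + a * q))\<^sup>2 = (cmod p)\<^sup>2 + (cmod a)\<^sup>2 * (cmod q)\<^sup>2 + 2 * Re (a * (cnj p * q))"
  unfolding cmod_power2 by (simp add: power2_eq_square algebra_simps)

lemma L2_on_indicator:
  assumes "L2_on \<sigma> f"
  shows "(\<lambda>E. indicator \<sigma> E *\<^sub>R f E) \<in> borel_measurable lborel"
    and "integrable lborel (\<lambda>E. (cmod (indicator \<sigma> E *\<^sub>R f E))\<^sup>2)"
proof -
  show "(\<lambda>E. indicator \<sigma> E *\<^sub>R f E) \<in> borel_measurable lborel"
    using assms by (simp add: L2_on_def set_borel_measurable_def)
  have "(\<lambda>E. (cmod (indicator \<sigma> E *\<^sub>R f E))\<^sup>2) = (\<lambda>E. indicator \<sigma> E *\<^sub>R (cmod (f E))\<^sup>2)"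
    by (auto simp: fun_eq_iff indicator_def)
  then show "integrable lborel (\<lambda>E. (cmod (indicator \<sigma> E *\<^sub>R f E))\<^sup>2)"
    using assms by (simp add: L2_on_def set_integrable_def)
qed

lemma L2_onI:
  assumes "(\<lambda>E. indicator \<sigma> E *\<^sub>R f E) \<in> borel_measurable lborel"
    and "integrable lborel (\<lambda>E. (cmod (indicator \<sigma> E *\<^sub>R f E))\<^sup>2)"
  shows "L2_on \<sigma> f"
proof -
  have "(\<lambda>E. (cmod (indicator \<sigma> E *\<^sub>R f E))\<^sup>2) = (\<lambda>E. indicator \<sigma> E *\<^sub>R (cmod (f E))\<^sup>2)"
    by (auto simp: fun_eq_iff indicator_def)
  then show ?thesis
    using assms by (simp add: L2_on_def set_integrable_def set_borel_measurable_def)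
qed

lemma integrable_cnj_mult_L2:
  fixes f g :: "real \<Rightarrow> complex"
  assumes [measurable]: "f \<in> borel_measurable lborel" "g \<in> borel_measurable lborel"
    and "integrable lborel (\<lambda>E. (cmod (f E))\<^sup>2)" "integrable lborel (\<lambda>E. (cmod (g E))\<^sup>2)"
  shows "integrable lborel (\<lambda>E. cnj (f E) * g E)"
proof (rule Bochner_Integration.integrable_bound)
  show "integrable lborel (\<lambda>E. (cmod (f E))\<^sup>2 + (cmod (g E))\<^sup>2)"
    using assms by simp
  show "AE E in lborel. norm (cnj (f E) * g E) \<le> norm ((cmod (f E))\<^sup>2 + (cmod (g E))\<^sup>2)"
  proof (intro AE_I2)
    fix E
    have "0 \<le> (cmod (f E) - cmod (g E))\<^sup>2" "0 \<le> cmod (f E) * cmod (g E)" by auto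
    then have "cmod (f E) * cmod (g E) \<le> (cmod (f E))\<^sup>2 + (cmod (g E))\<^sup>2"
      unfolding power2_diff by linarith
    then show "norm (cnj (f E) * g E) \<le> norm ((cmod (f E))\<^sup>2 + (cmod (g E))\<^sup>2)"
      by (simp add: norm_mult)
  qed
qed measurable

section \<open>Simple spectral representations\<close>

locale simple_spectral_rep =
  fixes j :: nat and V D :: "'h::complex_hilbert set" and A :: "'h \<Rightarrow> 'h" and \<sigma> :: "real set"
    and W :: "nat \<Rightarrow> 'h \<Rightarrow> real \<Rightarrow> complex"
  assumes subspace_V: "cvec.subspace V"
    and sigma_borel [measurable]: "\<sigma> \<in> sets borel"
    and rep: "spectral_representation {j} V D A \<sigma> W"
begin

text \<open>\<open>W j x\<close> is constrained on \<open>\<sigma>\<close> only. Cutting it off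
  there makes representatives comparable almost everywhere on the line and replaces set integrals by
  plain ones.\<close>

definition ft :: "'h \<Rightarrow> real \<Rightarrow> complex" where
  "ft x E = indicator \<sigma> E *\<^sub>R W j x E"

lemma mem_add: "x \<in> V \<Longrightarrow> y \<in> V \<Longrightarrow> x + y \<in> V"
  and mem_scale: "x \<in> V \<Longrightarrow> a *\<^sub>C x \<in> V"
  and mem_diff: "x \<in> V \<Longrightarrow> y \<in> V \<Longrightarrow> x - y \<in> V"
  and mem_0: "0 \<in> V"
  using subspace_V
  by (auto intro: cvec.subspace_add cvec.subspace_scale cvec.subspace_diff cvec.subspace_0)

lemma mem_sum: "(\<And>i. i \<in> I \<Longrightarrow> x i \<in> V) \<Longrightarrow> (\<Sum>i\<in>I. x i) \<in> V"
  by (rule cvec.subspace_sum[OF subspace_V])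

lemma ft_measurable [measurable]: "x \<in> V \<Longrightarrow> ft x \<in> borel_measurable lborel"
  and ft_integrable_sq: "x \<in> V \<Longrightarrow> integrable lborel (\<lambda>E. (cmod (ft x E))\<^sup>2)"
  using rep L2_on_indicator[of \<sigma> "W j x"] by (auto simp: spectral_representation_def ft_def[abs_def])

lemma ft_integrable_mult:
  "x \<in> V \<Longrightarrow> y \<in> V \<Longrightarrow> integrable lborel (\<lambda>E. cnj (ft x E) * ft y E)"
  by (intro integrable_cnj_mult_L2 ft_measurable ft_integrable_sq)

lemma ft_linear:
  assumes "x \<in> V" "y \<in> V"
  shows "AE E in lborel. ft (x + a *\<^sub>C y) E = ft x E + a * ft y E"
proof -
  have "AE E in lborel. E \<in> \<sigma> \<longrightarrow> W j (x + a *\<^sub>C y) E = W j x E + a * W j y E"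
    using rep assms by (auto simp: spectral_representation_def)
  then show ?thesis
    by eventually_elim (auto simp: ft_def indicator_def)
qed

lemma ft_norm: "x \<in> V \<Longrightarrow> (LINT E|lborel. (cmod (ft x E))\<^sup>2) = (norm x)\<^sup>2"
proof -
  assume "x \<in> V"
  moreover have "(\<lambda>E. (cmod (ft x E))\<^sup>2) = (\<lambda>E. indicator \<sigma> E *\<^sub>R (cmod (W j x E))\<^sup>2)"
    by (auto simp: fun_eq_iff indicator_def ft_def)
  ultimately show ?thesis
    using rep by (simp add: spectral_representation_def set_lebesgue_integral_def)
qed

lemma ft_surj:
  assumes "L2_on \<sigma> h"
  obtains x where "x \<in> V" "AE E in lborel. ft x E = indicator \<sigma> E *\<^sub>R h E"
proof -
  have "\<forall>g. (\<forall>i\<in>{j}. L2_on \<sigma> (g i)) \<longrightarrow>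
      (\<exists>x\<in>V. \<forall>i\<in>{j}. AE E in lborel. E \<in> \<sigma> \<longrightarrow> W i x E = g i E)"
    using rep unfolding spectral_representation_def by (elim conjE)
  from this[rule_format, of "\<lambda>_. h"] have "\<exists>x\<in>V. \<forall>i\<in>{j}. AE E in lborel. E \<in> \<sigma> \<longrightarrow> W i x E = h E"
    using assms by simp
  then obtain x where x: "x \<in> V" "AE E in lborel. E \<in> \<sigma> \<longrightarrow> W j x E = h E" by auto
  have "AE E in lborel. ft x E = indicator \<sigma> E *\<^sub>R h E"
    using x(2) by eventually_elim (auto simp: ft_def indicator_def)
  with x(1) that show ?thesis by blast
qed

lemma ft_inj:
  assumes "x \<in> V" "y \<in> V" "AE E in lborel. ft x E = ft y E"
  shows "x = y"
proof -
  have m: "x - y \<in> V" using assms by (simp add: mem_diff)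
  have "AE E in lborel. ft (x - y) E = 0"
    using ft_linear[OF assms(1,2), of "- 1"] assms(3)
    by eventually_elim (simp add: scaleC_one)
  then have "(LINT E|lborel. (cmod (ft (x - y) E))\<^sup>2) = (LINT E|(lborel :: real measure). 0)"
    using m by (intro integral_cong_AE) auto
  then show ?thesis using ft_norm[OF m] by simp
qed

lemma ft_0: "AE E in lborel. ft 0 E = 0"
  using ft_linear[OF mem_0 mem_0, of 1] by simp

lemma ft_sum:
  assumes "finite I" "\<And>i. i \<in> I \<Longrightarrow> u i \<in> V"
  shows "AE E in lborel. ft (\<Sum>i\<in>I. d i *\<^sub>C u i) E = (\<Sum>i\<in>I. d i * ft (u i) E)"
  using assms
proof (induction I rule: finite_induct)
  case empty
  then show ?case using ft_0 by simp
next
  case (insert i I)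
  then have "AE E in lborel. ft (\<Sum>i\<in>I. d i *\<^sub>C u i) E = (\<Sum>i\<in>I. d i * ft (u i) E)" by simp
  moreover have "AE E in lborel. ft ((\<Sum>i\<in>I. d i *\<^sub>C u i) + d i *\<^sub>C u i) E =
      ft (\<Sum>i\<in>I. d i *\<^sub>C u i) E + d i * ft (u i) E"
    using insert by (intro ft_linear mem_sum mem_scale) auto
  ultimately show ?case
    by eventually_elim (use insert in \<open>simp add: add.commute\<close>)
qed

text \<open>The representation is given through norms only. Expanding the norm of
  \<open>x + a *\<^sub>C y\<close> on both sides isolates \<open>Re (a * cinner x y)\<close>; the
  choices a = 1 and a = -i return the real and imaginary parts.\<close>

lemma cinner_ft:
  assumes x: "x \<in> V" and y: "y \<in> V"
  shows "cinner x y = (LINT E|lborel. cnj (ft x E) * ft y E)"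
proof -
  let ?I = "LINT E|lborel. cnj (ft x E) * ft y E"
  have re: "Re (a * cinner x y) = Re (a * ?I)" for a
  proof -
    have m: "x + a *\<^sub>C y \<in> V" using x y by (simp add: mem_add mem_scale)
    have i: "integrable lborel (\<lambda>E. a * (cnj (ft x E) * ft y E))"
      using ft_integrable_mult[OF x y] by (rule integrable_mult_right)
    have "(norm (x + a *\<^sub>C y))\<^sup>2 = (LINT E|lborel. (cmod (ft (x + a *\<^sub>C y) E))\<^sup>2)"
      by (simp add: ft_norm m)
    also have "\<dots> = (LINT E|lborel. ((cmod (ft x E))\<^sup>2 + (cmod a)\<^sup>2 * (cmod (ft y E))\<^sup>2) +
        2 * Re (a * (cnj (ft x E) * ft y E)))"
    proof (rule integral_cong_AE)
      show "AE E in lborel. (cmod (ft (x + a *\<^sub>C y) E))\<^sup>2 =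
          ((cmod (ft x E))\<^sup>2 + (cmod a)\<^sup>2 * (cmod (ft y E))\<^sup>2) + 2 * Re (a * (cnj (ft x E) * ft y E))"
        using ft_linear[OF x y, of a] by eventually_elim (simp only: cmod_add_mult_sq)
    qed (use m x y in \<open>auto intro!: borel_measurable_Re\<close>)
    also have "\<dots> = (LINT E|lborel. (cmod (ft x E))\<^sup>2) + (cmod a)\<^sup>2 * (LINT E|lborel. (cmod (ft y E))\<^sup>2) +
        2 * (LINT E|lborel. Re (a * (cnj (ft x E) * ft y E)))"
    proof -
      have ir: "integrable lborel (\<lambda>E. Re (a * (cnj (ft x E) * ft y E)))"
        using i by (rule integrable_Re)
      show ?thesis
        using ir ft_integrable_sq[OF x] ft_integrable_sq[OF y]
        by (simp only: Bochner_Integration.integral_add integral_mult_right_zero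
            integrable_mult_right Bochner_Integration.integrable_add)
    qed
    also have "(LINT E|lborel. Re (a * (cnj (ft x E) * ft y E))) = Re (a * ?I)"
      using i by (simp only: integral_Re integral_mult_right_zero)
    finally have "(norm (x + a *\<^sub>C y))\<^sup>2 = (norm x)\<^sup>2 + (cmod a)\<^sup>2 * (norm y)\<^sup>2 + 2 * Re (a * ?I)"
      by (simp add: ft_norm x y)
    moreover have "(norm (x + a *\<^sub>C y))\<^sup>2 = (norm x)\<^sup>2 + (cmod a)\<^sup>2 * (norm y)\<^sup>2 + 2 * Re (a * cinner x y)"
      using norm_add_sq[of x "a *\<^sub>C y"]
      by (simp add: norm_scaleC cinner_scaleC_right power_mult_distrib)
    ultimately show ?thesis by simp
  qed
  show ?thesis
    using re[of 1] re[of "- \<i>"] by (simp add: complex_eq_iff)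
qed

text \<open>The definite description in \<open>op_function\<close> denotes: a bounded multiplier
  preserves L2, so surjectivity gives a vector, and injectivity of the transform makes it
  unique.\<close>

lemma op_function_ft:
  assumes x: "x \<in> V" and [measurable]: "h \<in> borel_measurable borel" and bdd: "\<And>E. \<bar>h E\<bar> \<le> C"
  shows "op_function V \<sigma> (W j) h x \<in> V"
    and "AE E in lborel. ft (op_function V \<sigma> (W j) h x) E = complex_of_real (h E) * ft x E"
proof -
  let ?P = "\<lambda>y. y \<in> V \<and> (AE E in lborel. E \<in> \<sigma> \<longrightarrow> W j y E = complex_of_real (h E) * W j x E)"
  have P: "?P y \<longleftrightarrow> y \<in> V \<and> (AE E in lborel. ft y E = complex_of_real (h E) * ft x E)" for y
    by (intro conj_cong refl AE_cong) (auto simp: ft_def indicator_def)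
  have eq: "indicator \<sigma> E *\<^sub>R (complex_of_real (h E) * W j x E) = complex_of_real (h E) * ft x E" for E
    by (simp add: ft_def)
  have "L2_on \<sigma> (\<lambda>E. complex_of_real (h E) * W j x E)"
  proof (rule L2_onI; simp only: eq)
    show "(\<lambda>E. complex_of_real (h E) * ft x E) \<in> borel_measurable lborel"
      using x by measurable
    show "integrable lborel (\<lambda>E. (cmod (complex_of_real (h E) * ft x E))\<^sup>2)"
    proof (rule Bochner_Integration.integrable_bound)
      show "integrable lborel (\<lambda>E. C\<^sup>2 * (cmod (ft x E))\<^sup>2)"
        using ft_integrable_sq[OF x] by simp
      have "(h E)\<^sup>2 \<le> C\<^sup>2" for E
        using bdd[of E] by (metis abs_ge_zero power2_abs power_mono)
      then show "AE E in lborel. norm ((cmod (complex_of_real (h E) * ft x E))\<^sup>2) \<le> norm (C\<^sup>2 * (cmod (ft x E))\<^sup>2)"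
        by (intro AE_I2) (simp add: norm_mult power_mult_distrib mult_right_mono)
    qed (use x in measurable)
  qed
  then obtain y where y: "?P y"
    unfolding P using ft_surj[of "\<lambda>E. complex_of_real (h E) * W j x E"] unfolding eq by blast
  have "?P (op_function V \<sigma> (W j) h x)"
    unfolding op_function_def
  proof (rule theI[of ?P])
    show "?P y" by (rule y)
    fix y' assume "?P y'"
    then have "AE E in lborel. ft y' E = ft y E"
      using y unfolding P by (auto elim: eventually_elim2)
    then show "y' = y" using y \<open>?P y'\<close> by (intro ft_inj) auto
  qed
  then show "op_function V \<sigma> (W j) h x \<in> V"
    "AE E in lborel. ft (op_function V \<sigma> (W j) h x) E = complex_of_real (h E) * ft x E"
    unfolding P by auto
qed

lemma cinner_op_function:
  assumes x: "x \<in> V" and y: "y \<in> V"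
    and h [measurable]: "h \<in> borel_measurable borel" and bdd: "\<And>E. \<bar>h E\<bar> \<le> C"
  shows "cinner x (op_function V \<sigma> (W j) h y) = (LINT E|lborel. complex_of_real (h E) * (cnj (ft x E) * ft y E))"
proof -
  note o = op_function_ft[OF y h bdd]
  have "cinner x (op_function V \<sigma> (W j) h y) =
      (LINT E|lborel. cnj (ft x E) * ft (op_function V \<sigma> (W j) h y) E)"
    by (rule cinner_ft[OF x o(1)])
  also have "\<dots> = (LINT E|lborel. complex_of_real (h E) * (cnj (ft x E) * ft y E))"
  proof (rule integral_cong_AE)
    show "AE E in lborel. cnj (ft x E) * ft (op_function V \<sigma> (W j) h y) E =
        complex_of_real (h E) * (cnj (ft x E) * ft y E)"
      using o(2) by eventually_elim simp
  qed (use x y o in measurable)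
  finally show ?thesis .
qed

text \<open>In the spectral representation x is v divided by E - e - i eps, and the imaginary part
  of that quotient against v is the Poisson kernel times |v(E)|^2. Stating it for a solution
  \<open>x\<close> lets it apply directly to a component of the resolvent of
  \<open>H0\<close>.\<close>

lemma Im_cinner_resolvent:
  assumes x: "x \<in> D" and Ax: "A x \<in> V" and \<epsilon>: "\<epsilon> > 0"
    and v: "A x - (complex_of_real e + \<i> * complex_of_real \<epsilon>) *\<^sub>C x = v"
  shows "Im (cinner v x) = (LINT E|lborel. \<epsilon> / ((E - e)\<^sup>2 + \<epsilon>\<^sup>2) * (cmod (ft v E))\<^sup>2)"
proof -
  let ?z = "complex_of_real e + \<i> * complex_of_real \<epsilon>"
  have xV: "x \<in> V" and AE_A: "AE E in lborel. E \<in> \<sigma> \<longrightarrow> W j (A x) E = complex_of_real E * W j x E"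
    using rep x by (auto simp: spectral_representation_def)
  have vV: "v \<in> V" using v Ax xV by (auto intro: mem_diff mem_scale)
  have "AE E in lborel. ft v E = (complex_of_real E - ?z) * ft x E"
    using AE_A ft_linear[OF Ax xV, of "- ?z"]
  proof eventually_elim
    case (elim E)
    have "A x + (- ?z) *\<^sub>C x = v" unfolding cvec.scale_minus_left using v by simp
    then have "ft v E = ft (A x) E + - ?z * ft x E" using elim(2) by (simp only:)
    also have "ft (A x) E = complex_of_real E * ft x E"
      using elim(1) by (auto simp: ft_def indicator_def)
    finally show ?case by (simp add: algebra_simps)
  qed
  then have pt: "AE E in lborel. Im (cnj (ft v E) * ft x E) = \<epsilon> / ((E - e)\<^sup>2 + \<epsilon>\<^sup>2) * (cmod (ft v E))\<^sup>2"
  proof eventually_elim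
    case (elim E)
    have pos: "(E - e)\<^sup>2 + \<epsilon>\<^sup>2 > 0" using \<epsilon> by (simp add: add_nonneg_pos)
    have "(cmod (complex_of_real E - ?z))\<^sup>2 = (E - e)\<^sup>2 + \<epsilon>\<^sup>2"
      by (simp add: cmod_power2)
    then have "(cmod (ft v E))\<^sup>2 = ((E - e)\<^sup>2 + \<epsilon>\<^sup>2) * (cmod (ft x E))\<^sup>2"
      by (simp add: elim norm_mult power_mult_distrib)
    then have "\<epsilon> / ((E - e)\<^sup>2 + \<epsilon>\<^sup>2) * (cmod (ft v E))\<^sup>2 = \<epsilon> * (cmod (ft x E))\<^sup>2"
      using pos by simp
    moreover have "Im (cnj (ft v E) * ft x E) = \<epsilon> * (cmod (ft x E))\<^sup>2"
      unfolding elim cmod_power2 by (simp add: power2_eq_square algebra_simps)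
    ultimately show ?case by simp
  qed
  have "Im (cinner v x) = (LINT E|lborel. Im (cnj (ft v E) * ft x E))"
    using cinner_ft[OF vV xV] ft_integrable_mult[OF vV xV] by (simp only: integral_Im)
  also have "\<dots> = (LINT E|lborel. \<epsilon> / ((E - e)\<^sup>2 + \<epsilon>\<^sup>2) * (cmod (ft v E))\<^sup>2)"
    using xV vV by (intro integral_cong_AE pt) measurable
  finally show ?thesis .
qed

text \<open>The coefficients \<open>d\<close> may depend on the energy \<open>e\<close>: the exceptional null set depends on
  the finite family \<open>u\<close> only.\<close>

lemma resolvent_boundary_value:
  fixes I :: "'i set"
  assumes I: "finite I" and u: "\<And>i. i \<in> I \<Longrightarrow> u i \<in> V"
    and AV: "\<And>x. x \<in> D \<Longrightarrow> A x \<in> V"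
  obtains \<epsilon> :: "nat \<Rightarrow> real" where "\<And>n. \<epsilon> n > 0" "\<epsilon> \<longlonglongrightarrow> 0"
    "AE e in lborel. \<forall>d x. (\<forall>n. x n \<in> D \<and>
        A (x n) - (complex_of_real e + \<i> * complex_of_real (\<epsilon> n)) *\<^sub>C x n = (\<Sum>i\<in>I. d i *\<^sub>C u i)) \<longrightarrow>
      (\<lambda>n. Im (cinner (\<Sum>i\<in>I. d i *\<^sub>C u i) (x n))) \<longlonglongrightarrow> pi * (cmod (\<Sum>i\<in>I. d i * ft (u i) e))\<^sup>2"
proof -
  \<comment> \<open>The squared modulus of the combined transform is a combination of these pairwise
    products with coefficients \<open>cnj (d i) * d j\<close>. Convergence for the finitely many
    products therefore settles all coefficients \<open>d\<close> at once.\<close>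
  define g where "g p E = cnj (ft (u (fst p)) E) * ft (u (snd p)) E" for p E
  have g: "integrable lborel (g p)" if "p \<in> I \<times> I" for p
    unfolding g_def using that by (intro ft_integrable_mult u) auto
  obtain \<epsilon> :: "nat \<Rightarrow> real" where \<epsilon>: "\<And>n. \<epsilon> n > 0" "\<epsilon> \<longlonglongrightarrow> 0"
    and lim: "AE e in lborel. \<forall>p\<in>I \<times> I.
       (\<lambda>n. LINT E|lborel. (\<epsilon> n / ((E - e)\<^sup>2 + (\<epsilon> n)\<^sup>2)) *\<^sub>R g p E) \<longlonglongrightarrow> pi *\<^sub>R g p e"
    by (rule poisson_AE_subseq[OF finite_cartesian_product[OF I I] g]) (assumption | rule that)+
  define P where "P n e E = \<epsilon> n / ((E - e)\<^sup>2 + (\<epsilon> n)\<^sup>2)" for n e E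
  have P_le: "\<bar>P n e E\<bar> \<le> 1 / \<epsilon> n" for n e E
  proof -
    have "\<epsilon> n / ((E - e)\<^sup>2 + (\<epsilon> n)\<^sup>2) \<le> \<epsilon> n / (\<epsilon> n)\<^sup>2"
      using \<epsilon>(1)[of n] by (intro divide_left_mono mult_pos_pos add_nonneg_pos) auto
    also have "\<dots> = 1 / \<epsilon> n" by (simp add: power2_eq_square)
    finally show ?thesis using \<epsilon>(1)[of n] by (simp add: P_def abs_of_nonneg)
  qed
  have [measurable]: "P n e \<in> borel_measurable borel" for n e unfolding P_def by measurable
  have Pg: "integrable lborel (\<lambda>E. P n e E *\<^sub>R g p E)" if "p \<in> I \<times> I" for n e p
  proof (rule Bochner_Integration.integrable_bound)
    show "integrable lborel (\<lambda>E. (1 / \<epsilon> n) *\<^sub>R g p E)" using g[OF that] by (rule integrable_scaleR_right)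
    show "AE E in lborel. norm (P n e E *\<^sub>R g p E) \<le> norm ((1 / \<epsilon> n) *\<^sub>R g p E)"
      using P_le[of n e] \<epsilon>(1)[of n] by (intro AE_I2) (simp only: norm_scaleR, intro mult_right_mono, auto)
    show "(\<lambda>E. P n e E *\<^sub>R g p E) \<in> borel_measurable lborel"
      using borel_measurable_integrable[OF g[OF that]] by measurable
  qed
  show ?thesis
  proof (rule that[OF \<epsilon>])
    show "AE e in lborel. \<forall>d x. (\<forall>n. x n \<in> D \<and>
        A (x n) - (complex_of_real e + \<i> * complex_of_real (\<epsilon> n)) *\<^sub>C x n = (\<Sum>i\<in>I. d i *\<^sub>C u i)) \<longrightarrow>
      (\<lambda>n. Im (cinner (\<Sum>i\<in>I. d i *\<^sub>C u i) (x n))) \<longlonglongrightarrow> pi * (cmod (\<Sum>i\<in>I. d i * ft (u i) e))\<^sup>2"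
      using lim
    proof eventually_elim
      case (elim e)
      show ?case
      proof (intro allI impI)
        fix d :: "'i \<Rightarrow> complex" and x
        let ?v = "\<Sum>i\<in>I. d i *\<^sub>C u i"
        assume x: "\<forall>n. x n \<in> D \<and> A (x n) - (complex_of_real e + \<i> * complex_of_real (\<epsilon> n)) *\<^sub>C x n = ?v"
        have vV: "?v \<in> V" by (intro mem_sum mem_scale u)
        have ft_v: "AE E in lborel. ft ?v E = (\<Sum>i\<in>I. d i * ft (u i) E)"
          by (intro ft_sum I u)
        have sq: "complex_of_real ((cmod (\<Sum>i\<in>I. d i * ft (u i) E))\<^sup>2) =
            (\<Sum>p\<in>I \<times> I. (cnj (d (fst p)) * d (snd p)) * g p E)" for E
        proof -
          let ?s = "\<Sum>i\<in>I. d i * ft (u i) E"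
          have "complex_of_real ((cmod ?s)\<^sup>2) = cnj ?s * ?s"
            by (subst complex_norm_square) (rule mult.commute)
          then show ?thesis
            unfolding cnj_sum sum_product sum.cartesian_product case_prod_unfold g_def
            by (simp add: mult_ac)
        qed
        have "Im (cinner ?v (x n)) = Re (\<Sum>p\<in>I \<times> I. (cnj (d (fst p)) * d (snd p)) *
            (LINT E|lborel. P n e E *\<^sub>R g p E))" for n
        proof -
          have "Im (cinner ?v (x n)) = (LINT E|lborel. P n e E * (cmod (ft ?v E))\<^sup>2)"
            unfolding P_def using x \<epsilon>(1) AV by (intro Im_cinner_resolvent) auto
          also have "\<dots> = (LINT E|lborel. P n e E * (cmod (\<Sum>i\<in>I. d i * ft (u i) E))\<^sup>2)"
          proof (rule integral_cong_AE)
            have [measurable]: "ft (u i) \<in> borel_measurable lborel" if "i \<in> I" for i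
              using u that by measurable
            show "(\<lambda>E. P n e E * (cmod (\<Sum>i\<in>I. d i * ft (u i) E))\<^sup>2) \<in> borel_measurable lborel"
              by measurable
            show "(\<lambda>E. P n e E * (cmod (ft ?v E))\<^sup>2) \<in> borel_measurable lborel"
              using vV by measurable
            show "AE E in lborel. P n e E * (cmod (ft ?v E))\<^sup>2 = P n e E * (cmod (\<Sum>i\<in>I. d i * ft (u i) E))\<^sup>2"
              using ft_v by eventually_elim simp
          qed
          also have "complex_of_real \<dots> =
              (LINT E|lborel. (\<Sum>p\<in>I \<times> I. (cnj (d (fst p)) * d (snd p)) * (P n e E *\<^sub>R g p E)))"
            by (simp only: integral_complex_of_real[symmetric] of_real_mult sq sum_distrib_left scaleR_conv_of_real mult_ac)
          also have "\<dots> = (\<Sum>p\<in>I \<times> I. (cnj (d (fst p)) * d (snd p)) * (LINT E|lborel. P n e E *\<^sub>R g p E))"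
          proof -
            have "integrable lborel (\<lambda>E. (cnj (d (fst p)) * d (snd p)) * (P n e E *\<^sub>R g p E))"
              if "p \<in> I \<times> I" for p
              by (intro integrable_mult_right Pg that)
            then show ?thesis
              by (simp only: Bochner_Integration.integral_sum integral_mult_right_zero)
          qed
          finally have "complex_of_real (Im (cinner ?v (x n))) =
              (\<Sum>p\<in>I \<times> I. (cnj (d (fst p)) * d (snd p)) * (LINT E|lborel. P n e E *\<^sub>R g p E))" .
          then show ?thesis by (metis Re_complex_of_real)
        qed
        moreover have "(\<lambda>n. Re (\<Sum>p\<in>I \<times> I. (cnj (d (fst p)) * d (snd p)) * (LINT E|lborel. P n e E *\<^sub>R g p E)))
            \<longlonglongrightarrow> Re (\<Sum>p\<in>I \<times> I. (cnj (d (fst p)) * d (snd p)) * (pi *\<^sub>R g p e))"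
          using elim unfolding P_def[symmetric] by (intro tendsto_Re tendsto_sum tendsto_mult_left) auto
        moreover have "(\<Sum>p\<in>I \<times> I. (cnj (d (fst p)) * d (snd p)) * (pi *\<^sub>R g p e)) =
            complex_of_real (pi * (cmod (\<Sum>i\<in>I. d i * ft (u i) e))\<^sup>2)"
          unfolding of_real_mult sq by (simp add: sum_distrib_left scaleR_conv_of_real mult_ac)
        ultimately show "(\<lambda>n. Im (cinner (\<Sum>i\<in>I. d i *\<^sub>C u i) (x n))) \<longlonglongrightarrow>
            pi * (cmod (\<Sum>i\<in>I. d i * ft (u i) e))\<^sup>2"
          by (simp only: Re_complex_of_real)
      qed
    qed
  qed
qed

end

section \<open>Unitarity of matrix-valued multipliers\<close>

text \<open>The test sets are bounded because a nonzero constant is not integrable over a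
  \<open>\<sigma>\<close> of infinite measure; the windows from -n to n then exhaust
  \<open>\<sigma>\<close>.\<close>

lemma AE_eq_const_if_indicator_integrals:
  fixes q :: "real \<Rightarrow> real"
  assumes \<sigma> [measurable]: "\<sigma> \<in> sets borel"
    and B: "\<And>B. B \<in> sets borel \<Longrightarrow> B \<subseteq> \<sigma> \<Longrightarrow> bounded B \<Longrightarrow>
      integrable lborel (\<lambda>E. indicator B E * q E) \<and>
      (LINT E|lborel. indicator B E * q E) = (LINT E|lborel. indicator B E * c)"
  shows "AE E in lborel. E \<in> \<sigma> \<longrightarrow> q E = c"
proof -
  have "AE E in lborel. E \<in> \<sigma> \<inter> {- real n..real n} \<longrightarrow> q E = c" for n
  proof -
    let ?B = "\<sigma> \<inter> {- real n..real n}"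
    have cint: "integrable lborel (\<lambda>E. indicator B E * c)"
      if "B \<in> sets borel" "bounded B" for B :: "real set"
      using that emeasure_bounded_finite[of B] by (intro integrable_mult_left integrable_real_indicator) auto
    have bdd: "bounded (B \<inter> ?B)" for B
      by (rule bounded_subset[of "{- real n..real n}"]) auto
    have "AE E in lborel. indicator ?B E * q E - indicator ?B E * c = 0"
    proof (rule sigma_finite_measure.density_zero[OF sigma_finite_lborel])
      show "integrable lborel (\<lambda>E. indicator ?B E * q E - indicator ?B E * c)"
        using B[of ?B] cint[of ?B] bdd[of UNIV] by simp
      fix S :: "real set" assume S: "S \<in> sets lborel"
      then have *: "S \<inter> ?B \<in> sets borel" "S \<inter> ?B \<subseteq> \<sigma>" by auto
      have "(LINT E:S|lborel. indicator ?B E * q E - indicator ?B E * c) =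
          (LINT E|lborel. indicator (S \<inter> ?B) E * q E - indicator (S \<inter> ?B) E * c)"
        unfolding set_lebesgue_integral_def
        by (intro Bochner_Integration.integral_cong) (auto simp: indicator_def)
      also have "\<dots> = 0"
        using B[OF *] cint[OF *(1)] bdd[of S] by simp
      finally show "(LINT E:S|lborel. indicator ?B E * q E - indicator ?B E * c) = 0" .
    qed
    then show ?thesis by eventually_elim (auto simp: indicator_def)
  qed
  then have "AE E in lborel. \<forall>n. E \<in> \<sigma> \<inter> {- real n..real n} \<longrightarrow> q E = c"
    unfolding AE_all_countable by blast
  then show ?thesis
  proof eventually_elim
    case (elim E)
    obtain n where "\<bar>E\<bar> \<le> real n" using real_arch_simple by blast
    then show ?case using elim[rule_format, of n] by (auto simp: abs_le_iff)
  qed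
qed

text \<open>The hypotheses are the isometry conditions of the matrix with rows (a, b) and (c, d) on
  the vectors (1,0), (0,1), (1,1) and (1,i), so its columns are orthonormal. Orthogonality gives
  |a||b| = |c||d|; eliminating |c| and |d| leaves the norm of the first row.\<close>

lemma unitary_2x2_row:
  fixes a b c d :: complex
  assumes "(cmod a)\<^sup>2 + (cmod c)\<^sup>2 = 1" "(cmod b)\<^sup>2 + (cmod d)\<^sup>2 = 1"
    and "(cmod (a + b))\<^sup>2 + (cmod (c + d))\<^sup>2 = 2"
    and "(cmod (a + \<i> * b))\<^sup>2 + (cmod (c + \<i> * d))\<^sup>2 = 2"
  shows "(cmod a)\<^sup>2 + (cmod b)\<^sup>2 = 1"
proof -
  have "cnj a * b + cnj c * d = 0"
    using assms unfolding cmod_power2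
    by (simp add: complex_eq_iff power2_eq_square algebra_simps)
  then have "cmod (cnj a * b) = cmod (cnj c * d)"
    by (metis add_eq_0_iff norm_minus_cancel)
  then have "(cmod a)\<^sup>2 * (cmod b)\<^sup>2 = (cmod c)\<^sup>2 * (cmod d)\<^sup>2"
    by (simp add: norm_mult flip: power_mult_distrib)
  moreover have "(cmod c)\<^sup>2 = 1 - (cmod a)\<^sup>2" "(cmod d)\<^sup>2 = 1 - (cmod b)\<^sup>2"
    using assms by auto
  ultimately show ?thesis by (simp add: algebra_simps)
qed

section \<open>Resolvents at nonreal energies\<close>

text \<open>Since \<open>cinner x (A x)\<close> is real, the imaginary part of
  \<open>cinner x (A x - z *\<^sub>C x)\<close> comes from z alone; Cauchy-Schwarz does the
  rest.\<close>

lemma self_adjoint_nonreal_bound: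
  assumes sa: "self_adjoint_on V D A" and x: "x \<in> D"
  shows "\<bar>Im z\<bar> * norm x \<le> norm (A x - z *\<^sub>C x)"
proof (cases "x = 0")
  case False
  have "cinner (A x) x = cinner x (A x)"
    using sa x by (simp add: self_adjoint_on_def)
  then have "Im (cinner x (A x)) = 0"
    using cinner_commute[of x "A x"] by (simp add: complex_eq_iff)
  then have "Im (cinner x (A x - z *\<^sub>C x)) = - Im z * (norm x)\<^sup>2"
    by (simp add: cinner_diff_right cinner_scaleC_right cinner_self flip: of_real_power)
  then have "\<bar>Im z\<bar> * (norm x)\<^sup>2 = \<bar>Im (cinner x (A x - z *\<^sub>C x))\<bar>"
    by (simp add: abs_mult)
  also have "\<dots> \<le> norm x * norm (A x - z *\<^sub>C x)"
    using abs_Im_le_cmod cinner_bound order_trans by blast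
  finally have "norm x * (\<bar>Im z\<bar> * norm x) \<le> norm x * norm (A x - z *\<^sub>C x)"
    by (simp add: power2_eq_square mult_ac)
  then show ?thesis using False by simp
qed simp

text \<open>Needed for the system Hamiltonian, for which no spectrum is prescribed. The range of A -
  z is closed by the lower bound, and a vector orthogonal to it lies in the kernel of A - cnj z,
  which is zero by the same bound.\<close>

lemma self_adjoint_everywhere_surj:
  fixes A :: "'h::complex_hilbert \<Rightarrow> 'h"
  assumes V: "closed V" "cvec.subspace V" and sa: "self_adjoint_on V V A" and z: "Im z \<noteq> 0"
    and y: "y \<in> V"
  shows "\<exists>x\<in>V. A x - z *\<^sub>C x = y"
proof -
  have AV: "A x \<in> V" if "x \<in> V" for x using sa that by (auto simp: self_adjoint_on_def)
  have sym: "cinner (A u) x = cinner u (A x)" if "u \<in> V" "x \<in> V" for u x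
    using sa that by (simp add: self_adjoint_on_def)
  have lin: "A (u + a *\<^sub>C x) = A u + a *\<^sub>C A x" if "u \<in> V" "x \<in> V" for u x a
    using sa that by (simp add: self_adjoint_on_def clinear_on_def)
  note mem = cvec.subspace_add[OF V(2)] cvec.subspace_diff[OF V(2)] cvec.subspace_scale[OF V(2)]
  define T where "T w x = A x - w *\<^sub>C x" for w x
  have TV: "T w x \<in> V" if "x \<in> V" for w x using that by (simp add: T_def mem AV)
  have T_adj: "cinner u (T w x) = cinner (T (cnj w) u) x" if "u \<in> V" "x \<in> V" for u x w
    using that by (simp add: T_def cinner_diff_left cinner_diff_right cinner_scaleC_left
        cinner_scaleC_right sym)
  have T_lin: "T w (u + a *\<^sub>C x) = T w u + a *\<^sub>C T w x" if "u \<in> V" "x \<in> V" for u x a w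
    using that by (simp add: T_def lin scaleC_add_right scaleC_scaleC cvec.scale_right_diff_distrib mult.commute)
  have T_diff: "T w (u - x) = T w u - T w x" if "u \<in> V" "x \<in> V" for u x w
    using T_lin[OF that, of w "- 1"] by (simp add: cvec.scale_minus_left scaleC_one)
  let ?W = "T z ` V"
  have W: "cvec.subspace ?W"
  proof (rule cvec.subspaceI)
    have 0: "0 \<in> V" using V(2) by (rule cvec.subspace_0)
    then have "T z 0 = 0" using T_diff[OF 0 0] by simp
    then show "0 \<in> ?W" using 0 by (metis image_eqI)
    show "a + b \<in> ?W" if ab: "a \<in> ?W" "b \<in> ?W" for a b
    proof -
      obtain u x where "a = T z u" "b = T z x" "u \<in> V" "x \<in> V" using ab by blast
      then show ?thesis using T_lin[of u x z 1] mem by (auto simp: scaleC_one intro!: image_eqI[of _ _ "u + x"])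
    qed
    show "c *\<^sub>C a \<in> ?W" if a: "a \<in> ?W" for c a
    proof -
      obtain u where "a = T z u" "u \<in> V" using a by blast
      then show ?thesis using T_lin[OF 0, of u z c] \<open>T z 0 = 0\<close> mem by (auto intro!: image_eqI[of _ _ "c *\<^sub>C u"])
    qed
  qed
  have "closed ?W"
    unfolding closed_sequential_limits
  proof (intro allI impI, elim conjE)
    fix f l assume "\<forall>n. f n \<in> ?W" and f: "f \<longlonglongrightarrow> l"
    then have "\<forall>n. \<exists>x. x \<in> V \<and> f n = T z x" by blast
    then obtain x where x: "\<And>n. x n \<in> V" "\<And>n. f n = T z (x n)" by metis
    have "Cauchy f" using f by (rule LIMSEQ_imp_Cauchy)
    have "Cauchy x"
    proof (rule metric_CauchyI)
      fix e :: real assume "e > 0"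
      then obtain N where N: "\<And>m n. m \<ge> N \<Longrightarrow> n \<ge> N \<Longrightarrow> dist (f m) (f n) < \<bar>Im z\<bar> * e"
        using \<open>Cauchy f\<close> z by (metis metric_CauchyD mult_pos_pos zero_less_abs_iff)
      have "dist (x m) (x n) < e" if "m \<ge> N" "n \<ge> N" for m n
      proof -
        have "\<bar>Im z\<bar> * norm (x m - x n) \<le> norm (T z (x m - x n))"
          unfolding T_def using x by (intro self_adjoint_nonreal_bound[OF sa] mem)
        also have "\<dots> < \<bar>Im z\<bar> * e"
          using N[OF that] x by (simp add: T_diff dist_norm)
        finally show ?thesis using z by (simp add: dist_norm)
      qed
      then show "\<exists>N. \<forall>m\<ge>N. \<forall>n\<ge>N. dist (x m) (x n) < e" by blast
    qed
    then obtain x0 where x0: "x \<longlonglongrightarrow> x0" using Cauchy_convergent_iff convergent_def by blast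
    have x0V: "x0 \<in> V" using closed_sequentially V(1) x(1) x0 by blast
    have lV: "l \<in> V" using closed_sequentially V(1) f x TV by metis
    \<comment> \<open>Moving \<open>T z\<close> to the other side of the inner product identifies
      the limit weakly, so continuity of \<open>A\<close> is never invoked.\<close>
    have eq: "cinner u (l - T z x0) = 0" if u: "u \<in> V" for u
    proof -
      have "(\<lambda>n. cinner u (f n)) \<longlonglongrightarrow> cinner u l" by (rule tendsto_cinner_right[OF f])
      moreover have "(\<lambda>n. cinner u (f n)) \<longlonglongrightarrow> cinner (T (cnj z) u) x0"
        using u x by (simp add: T_adj tendsto_cinner_right[OF x0])
      ultimately have "cinner u l = cinner u (T z x0)"
        using LIMSEQ_unique u x0V by (simp add: T_adj)
      then show ?thesis by (simp add: cinner_diff_right)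
    qed
    have "l = T z x0" using eq[of "l - T z x0"] lV x0V by (simp add: mem TV)
    then show "l \<in> ?W" using x0V by blast
  qed
  then obtain w where w: "w \<in> ?W" "\<And>v. v \<in> ?W \<Longrightarrow> cinner v (y - w) = 0"
    using projection_exists[OF _ W, of y] by blast
  have rV: "y - w \<in> V" using y w(1) TV by (auto intro: mem)
  have "cinner u (T (cnj z) (y - w)) = 0" if "u \<in> V" for u
    using w(2)[of "T z u"] that by (simp add: T_adj[OF that rV])
  then have "T (cnj z) (y - w) = 0" using TV[OF rV] by (metis cinner_self_eq_0)
  then have "y - w = 0"
    using self_adjoint_nonreal_bound[OF sa rV, of "cnj z"] z unfolding T_def
    by (simp add: mult_le_0_iff)
  then show ?thesis using w(1) by (auto simp: T_def)
qed

section \<open>The scattering system\<close>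

text \<open>Keeps the reservoir index in the form \<open>1\<close>, in which the facts about
  \<open>PiR R 1\<close> are stated.\<close>

declare One_nat_def [simp del]

lemma fermi_dirac_measurable [measurable]: "fermi_dirac b m \<in> borel_measurable borel"
  unfolding fermi_dirac_def by measurable

lemma fermi_dirac_bound: "\<bar>fermi_dirac b m E\<bar> \<le> 1"
proof -
  have "0 < 1 + exp (b * (E - m))" by (simp add: add_pos_pos)
  then show ?thesis unfolding fermi_dirac_def by (simp add: divide_le_eq abs_of_pos)
qed

locale scattering_system =
  fixes R :: "'h::complex_hilbert two_reservoirs" and M :: nat
    and Tm :: "nat \<Rightarrow> nat \<Rightarrow> real \<Rightarrow> complex"
    and \<Omega> :: "pm \<Rightarrow> ('h \<Rightarrow> complex) \<Rightarrow> 'h \<Rightarrow> complex" and X :: "real set"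
  assumes decoupled: "decoupled_system R M"
    and coupled: "coupling R M"
    and scattering: "scattering_theory R"
    and transition: "transition_matrix R Tm"
    and technical: "technical_assumptions R Tm \<Omega> X"
begin

section \<open>The orthogonal decomposition of the one-particle space\<close>

lemma orth_sum: "orthogonal_sum R M" and free_ham: "free_hamiltonians R" and free_eig: "free_eigenfunctions R"
  using decoupled by (auto simp: decoupled_system_def)

lemma sp_subspace: "j \<in> {1,2} \<Longrightarrow> cvec.subspace (sp R j)"
  using orth_sum by (auto simp: orthogonal_sum_def)

lemma spS_subspace: "cvec.subspace (spS R)"
  using orth_sum cvec.subspace_span unfolding orthogonal_sum_def by metis

lemma orth:
  "x \<in> spS R \<Longrightarrow> y \<in> sp R 1 \<Longrightarrow> cinner x y = 0" "x \<in> spS R \<Longrightarrow> y \<in> sp R 2 \<Longrightarrow> cinner x y = 0"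
  "y \<in> spS R \<Longrightarrow> x \<in> sp R 1 \<Longrightarrow> cinner x y = 0" "y \<in> spS R \<Longrightarrow> x \<in> sp R 2 \<Longrightarrow> cinner x y = 0"
  "x \<in> sp R 1 \<Longrightarrow> y \<in> sp R 2 \<Longrightarrow> cinner x y = 0" "x \<in> sp R 2 \<Longrightarrow> y \<in> sp R 1 \<Longrightarrow> cinner x y = 0"
  using orth_sum cinner_commute[of x y] by (auto simp: orthogonal_sum_def)

lemma proj_components:
  assumes "a \<in> spS R" "b \<in> sp R 1" "c \<in> sp R 2"
  shows "PiS R (a + b + c) = a" "PiR R 1 (a + b + c) = b" "PiR R 2 (a + b + c) = c"
  using assms unfolding PiS_def PiR_def
  by (auto intro!: ortho_proj_eq spS_subspace sp_subspace simp: cinner_add_right cinner_diff_right orth)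

lemma decomposition:
  obtains a b c where "a \<in> spS R" "b \<in> sp R 1" "c \<in> sp R 2" "x = a + b + c"
  using orth_sum unfolding orthogonal_sum_def by metis

lemma PiS_mem [simp]: "PiS R x \<in> spS R"
  and PiR_mem1: "PiR R 1 x \<in> sp R 1" and PiR_mem2: "PiR R 2 x \<in> sp R 2"
  and proj_sum: "PiS R x + PiR R 1 x + PiR R 2 x = x"
  by (cases rule: decomposition[of x]; simp add: proj_components)+

lemma PiR_mem [simp]: "j \<in> {1,2} \<Longrightarrow> PiR R j x \<in> sp R j"
  using PiR_mem1 PiR_mem2 by auto

lemma sp_zero: "0 \<in> spS R" "j \<in> {1,2} \<Longrightarrow> 0 \<in> sp R j"
  using spS_subspace sp_subspace cvec.subspace_0 by blast+

lemma proj_linear: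
  "PiS R (x + a *\<^sub>C y) = PiS R x + a *\<^sub>C PiS R y"
  "j \<in> {1,2} \<Longrightarrow> PiR R j (x + a *\<^sub>C y) = PiR R j x + a *\<^sub>C PiR R j y"
proof -
  have m: "PiS R x + a *\<^sub>C PiS R y \<in> spS R" "PiR R 1 x + a *\<^sub>C PiR R 1 y \<in> sp R 1"
    "PiR R 2 x + a *\<^sub>C PiR R 2 y \<in> sp R 2"
    using spS_subspace sp_subspace by (auto intro!: cvec.subspace_add cvec.subspace_scale)
  have "x + a *\<^sub>C y = (PiS R x + PiR R 1 x + PiR R 2 x) + a *\<^sub>C (PiS R y + PiR R 1 y + PiR R 2 y)"
    by (simp add: proj_sum)
  also have "\<dots> = (PiS R x + a *\<^sub>C PiS R y) + (PiR R 1 x + a *\<^sub>C PiR R 1 y) + (PiR R 2 x + a *\<^sub>C PiR R 2 y)"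
    by (simp add: scaleC_add_right algebra_simps)
  finally have eq: "x + a *\<^sub>C y = \<dots>" .
  show "PiS R (x + a *\<^sub>C y) = PiS R x + a *\<^sub>C PiS R y"
    "j \<in> {1,2} \<Longrightarrow> PiR R j (x + a *\<^sub>C y) = PiR R j x + a *\<^sub>C PiR R j y"
    unfolding eq using proj_components[OF m] by auto
qed

lemma PiR_spS: "j \<in> {1,2} \<Longrightarrow> x \<in> spS R \<Longrightarrow> PiR R j x = 0"
  using proj_components[of x 0 0] sp_zero by auto

lemma PiR_sp: "j \<in> {1,2} \<Longrightarrow> k \<in> {1,2} \<Longrightarrow> x \<in> sp R k \<Longrightarrow> PiR R j x = (if j = k then x else 0)"
  and PiS_sp: "k \<in> {1,2} \<Longrightarrow> x \<in> sp R k \<Longrightarrow> PiS R x = 0"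
  using proj_components[of 0 x 0] proj_components[of 0 0 x] sp_zero by auto

lemma PiR_0 [simp]: "j \<in> {1,2} \<Longrightarrow> PiR R j 0 = 0"
  using PiR_spS sp_zero by blast

lemma PiR_scale: "j \<in> {1,2} \<Longrightarrow> PiR R j (a *\<^sub>C y) = a *\<^sub>C PiR R j y"
  using proj_linear(2)[of j 0 a y] by simp

lemma PiR_add: "j \<in> {1,2} \<Longrightarrow> PiR R j (x + y) = PiR R j x + PiR R j y"
  using proj_linear(2)[of j x 1 y] by (simp add: scaleC_one)

lemma PiR_sum: "j \<in> {1,2} \<Longrightarrow> PiR R j (\<Sum>i\<in>I. f i) = (\<Sum>i\<in>I. PiR R j (f i))"
  by (induction I rule: infinite_finite_induct) (auto simp: PiR_add)

lemma cinner_proj_sum: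
  "cinner x y = cinner (PiS R x) (PiS R y) + cinner (PiR R 1 x) (PiR R 1 y) + cinner (PiR R 2 x) (PiR R 2 y)"
proof -
  have "cinner x y = cinner (PiS R x + PiR R 1 x + PiR R 2 x) (PiS R y + PiR R 1 y + PiR R 2 y)"
    by (simp add: proj_sum)
  also have "\<dots> = cinner (PiS R x) (PiS R y) + cinner (PiR R 1 x) (PiR R 1 y) + cinner (PiR R 2 x) (PiR R 2 y)"
    by (simp add: cinner_add_left cinner_add_right orth)
  finally show ?thesis .
qed

lemma cinner_PiR_mem:
  assumes "j \<in> {1,2}" "y \<in> sp R j"
  shows "cinner (PiR R j x) y = cinner x y" "cinner y (PiR R j x) = cinner y x"
  using assms cinner_proj_sum[of x y] cinner_proj_sum[of y x] by (auto simp: PiR_sp PiS_sp)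

lemma cinner_PiR: "j \<in> {1,2} \<Longrightarrow> cinner (PiR R j x) y = cinner x (PiR R j y)"
  using cinner_PiR_mem[of j "PiR R j y" x] cinner_PiR_mem[of j "PiR R j x" y] by simp

lemma norm_proj_sum:
  "(norm x)\<^sup>2 = (norm (PiS R x))\<^sup>2 + (norm (PiR R 1 x))\<^sup>2 + (norm (PiR R 2 x))\<^sup>2"
  using cinner_proj_sum[of x x] unfolding cinner_self by (metis of_real_add of_real_eq_iff)

text \<open>As the orthogonal complement of the two reservoirs, the system space is an intersection
  of kernels of continuous functionals.\<close>

lemma spS_closed: "closed (spS R)"
proof -
  have "spS R = {x. \<forall>y\<in>sp R 1 \<union> sp R 2. cinner y x = 0}"
  proof (intro equalityI subsetI CollectI ballI)
    fix x assume x: "x \<in> {x. \<forall>y\<in>sp R 1 \<union> sp R 2. cinner y x = 0}"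
    have "PiR R j x = 0" if j: "j \<in> {1,2}" for j
      using x j cinner_PiR_mem(1)[OF j PiR_mem[OF j], of x x] cinner_PiR_mem(2)[OF j PiR_mem[OF j], of x x]
      by (auto simp: cinner_self PiR_mem1 PiR_mem2)
    then have "x = PiS R x" using proj_sum[of x] by simp
    then show "x \<in> spS R" by (metis PiS_mem)
  qed (auto simp: orth)
  also have "\<dots> = (\<Inter>y\<in>sp R 1 \<union> sp R 2. {x. cinner y x = 0})" by auto
  also have "closed \<dots>"
    by (intro closed_INT ballI closed_Collect_eq linear_continuous_on bounded_linear_cinner_right
        continuous_on_const)
  finally show ?thesis .
qed

lemma Pi0_linear: "Pi0 R (x + a *\<^sub>C y) = Pi0 R x + a *\<^sub>C Pi0 R y"
  unfolding Pi0_def by (simp add: proj_linear scaleC_add_right)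

lemma PiR_PiR: "j \<in> {1,2} \<Longrightarrow> k \<in> {1,2} \<Longrightarrow> PiR R j (PiR R k x) = (if j = k then PiR R k x else 0)"
  by (rule PiR_sp[OF _ _ PiR_mem])

lemma PiR_Pi0: "j \<in> {1,2} \<Longrightarrow> PiR R j (Pi0 R x) = PiR R j x"
  unfolding Pi0_def by (auto simp: PiR_add PiR_PiR)

lemma Pi0_Pi0 [simp]: "Pi0 R (Pi0 R x) = Pi0 R x"
  using Pi0_def[of R "Pi0 R x"] by (simp add: PiR_Pi0 flip: Pi0_def)

lemma range_Pi0: "x \<in> range (Pi0 R) \<longleftrightarrow> Pi0 R x = x"
  by (metis Pi0_Pi0 rangeE rangeI)

lemma sp_Pi0: "j \<in> {1,2} \<Longrightarrow> x \<in> sp R j \<Longrightarrow> Pi0 R x = x"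
  by (auto simp: Pi0_def PiR_sp)

lemma cinner_Pi0: "cinner (Pi0 R x) y = cinner x (Pi0 R y)"
  by (simp add: Pi0_def cinner_add_left cinner_add_right cinner_PiR)

lemma norm_Pi0: "(norm (Pi0 R x))\<^sup>2 = (norm (PiR R 1 x))\<^sup>2 + (norm (PiR R 2 x))\<^sup>2"
proof -
  have "PiS R (Pi0 R x) = 0"
    using proj_components[OF sp_zero(1) PiR_mem1 PiR_mem2] by (simp add: Pi0_def)
  then show ?thesis
    using norm_proj_sum[of "Pi0 R x"] by (simp add: PiR_Pi0)
qed

lemma norm_Pi0_le: "norm (Pi0 R x) \<le> norm x"
  by (rule power2_le_imp_le) (simp_all add: norm_Pi0 norm_proj_sum[of x])

subsection \<open>Free spectral representations\<close>

lemma spectral_rep: "j \<in> {1,2} \<Longrightarrow>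
    simple_spectral_rep j (sp R j) (domR R j) (hamR R j) (sigma0 R) (fourier R)"
  using free_eig free_ham sp_subspace
  by unfold_locales (auto simp: free_eigenfunctions_def free_hamiltonians_def)

abbreviation fh :: "nat \<Rightarrow> 'h \<Rightarrow> real \<Rightarrow> complex" where
  "fh j \<equiv> simple_spectral_rep.ft j (sigma0 R) (fourier R)"

lemma fh_eq: "j \<in> {1,2} \<Longrightarrow> fh j x E = indicator (sigma0 R) E *\<^sub>R fourier R j x E"
  by (rule simple_spectral_rep.ft_def[OF spectral_rep])

lemma sigma0_borel [measurable]: "sigma0 R \<in> sets borel"
  using free_ham by (simp add: free_hamiltonians_def)

lemma fh_measurable: "j \<in> {1,2} \<Longrightarrow> fh j (PiR R j x) \<in> borel_measurable lborel"
  by (rule simple_spectral_rep.ft_measurable[OF spectral_rep]) auto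

lemma fh_measurable' [measurable]:
  "fh 1 (PiR R 1 x) \<in> borel_measurable lborel" "fh 2 (PiR R 2 x) \<in> borel_measurable lborel"
  by (rule fh_measurable, simp)+

lemma self_adjoint_R: "j \<in> {1,2} \<Longrightarrow> self_adjoint_on (sp R j) (domR R j) (hamR R j)"
  and self_adjoint_S: "self_adjoint_on (spS R) (spS R) (hamS R)"
  using free_ham by (auto simp: free_hamiltonians_def)

lemma self_adjoint_onD:
  assumes "self_adjoint_on V D A"
  shows "D \<subseteq> V" "A ` D \<subseteq> V" "clinear_on D A"
  using assms by (auto simp: self_adjoint_on_def)

lemma hamR_mem: "j \<in> {1,2} \<Longrightarrow> x \<in> domR R j \<Longrightarrow> hamR R j x \<in> sp R j"
  using self_adjoint_onD(2)[OF self_adjoint_R] by blast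

lemma domR_mem: "j \<in> {1,2} \<Longrightarrow> x \<in> domR R j \<Longrightarrow> x \<in> sp R j"
  using self_adjoint_onD(1)[OF self_adjoint_R] by blast

lemma hamS_mem: "x \<in> spS R \<Longrightarrow> hamS R x \<in> spS R"
  using self_adjoint_onD(2)[OF self_adjoint_S] by blast

lemma H0_components:
  assumes x: "x \<in> dom0 R"
  shows "PiR R 1 (H0 R x - z *\<^sub>C x) = hamR R 1 (PiR R 1 x) - z *\<^sub>C PiR R 1 x"
    "PiR R 2 (H0 R x - z *\<^sub>C x) = hamR R 2 (PiR R 2 x) - z *\<^sub>C PiR R 2 x"
    "PiS R (H0 R x - z *\<^sub>C x) = hamS R (PiS R x) - z *\<^sub>C PiS R x"
proof -
  have d: "PiR R 1 x \<in> domR R 1" "PiR R 2 x \<in> domR R 2" using x by (auto simp: dom0_def)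
  have m: "hamS R (PiS R x) - z *\<^sub>C PiS R x \<in> spS R" "hamR R 1 (PiR R 1 x) - z *\<^sub>C PiR R 1 x \<in> sp R 1"
    "hamR R 2 (PiR R 2 x) - z *\<^sub>C PiR R 2 x \<in> sp R 2"
    using d spS_subspace sp_subspace
    by (auto intro!: cvec.subspace_diff cvec.subspace_scale hamR_mem hamS_mem)
  have "z *\<^sub>C x = z *\<^sub>C PiS R x + z *\<^sub>C PiR R 1 x + z *\<^sub>C PiR R 2 x"
    by (simp add: proj_sum flip: scaleC_add_right)
  then have "H0 R x - z *\<^sub>C x = (hamS R (PiS R x) - z *\<^sub>C PiS R x) + (hamR R 1 (PiR R 1 x) - z *\<^sub>C PiR R 1 x)
      + (hamR R 2 (PiR R 2 x) - z *\<^sub>C PiR R 2 x)"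
    by (simp add: H0_def algebra_simps)
  then show "PiR R 1 (H0 R x - z *\<^sub>C x) = hamR R 1 (PiR R 1 x) - z *\<^sub>C PiR R 1 x"
    "PiR R 2 (H0 R x - z *\<^sub>C x) = hamR R 2 (PiR R 2 x) - z *\<^sub>C PiR R 2 x"
    "PiS R (H0 R x - z *\<^sub>C x) = hamS R (PiS R x) - z *\<^sub>C PiS R x"
    using proj_components[OF m] by simp_all
qed

text \<open>The equation decouples into three blocks. On the reservoirs the prescribed real spectrum
  gives bijectivity at nonreal z; on the system, solvability and uniqueness come from
  self-adjointness. Uniqueness is essential because \<open>resolvent\<close> is a definite
  description.\<close>

lemma resolvent_H0:
  fixes v :: 'h
  assumes z: "Im z \<noteq> 0"
  shows "resolvent (dom0 R) (H0 R) z v \<in> dom0 R" (is "?r \<in> _")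
    and "H0 R (resolvent (dom0 R) (H0 R) z v) - z *\<^sub>C resolvent (dom0 R) (H0 R) z v = v"
proof -
  have bij: "bij_betw (\<lambda>x. hamR R j x - z *\<^sub>C x) (domR R j) (sp R j)" if "j \<in> {1,2}" for j
  proof -
    have "z \<notin> complex_of_real ` sigma0 R" using z by auto
    then have "z \<notin> spectrum_on (sp R j) (domR R j) (hamR R j)"
      using free_ham that by (auto simp: free_hamiltonians_def)
    then show ?thesis by (simp add: spectrum_on_def)
  qed
  obtain xS where xS: "xS \<in> spS R" "hamS R xS - z *\<^sub>C xS = PiS R v"
    using self_adjoint_everywhere_surj[OF spS_closed spS_subspace self_adjoint_S z PiS_mem] by blast
  have "\<exists>x\<in>domR R j. hamR R j x - z *\<^sub>C x = PiR R j v" if "j \<in> {1,2}" for j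
  proof -
    have "PiR R j v \<in> (\<lambda>x. hamR R j x - z *\<^sub>C x) ` domR R j"
      using bij_betw_imp_surj_on[OF bij[OF that]] PiR_mem[OF that, of v] by simp
    then show ?thesis unfolding image_iff by metis
  qed
  then obtain x1 x2 where x: "x1 \<in> domR R 1" "hamR R 1 x1 - z *\<^sub>C x1 = PiR R 1 v"
    "x2 \<in> domR R 2" "hamR R 2 x2 - z *\<^sub>C x2 = PiR R 2 v"
    by (meson insertI1 insertI2)
  let ?x = "xS + x1 + x2"
  have c: "PiS R ?x = xS" "PiR R 1 ?x = x1" "PiR R 2 ?x = x2"
    using xS x domR_mem by (auto intro!: proj_components)
  have xd: "?x \<in> dom0 R" using x c by (auto simp: dom0_def)
  have xv: "H0 R ?x - z *\<^sub>C ?x = v"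
    using proj_sum[of "H0 R ?x - z *\<^sub>C ?x"] H0_components[OF xd, of z] xS x proj_sum[of v]
    by (simp add: c)
  have "?r \<in> dom0 R \<and> H0 R ?r - z *\<^sub>C ?r = v"
    unfolding resolvent_def
  proof (rule theI[where P = "\<lambda>x. x \<in> dom0 R \<and> H0 R x - z *\<^sub>C x = v"])
    show "?x \<in> dom0 R \<and> H0 R ?x - z *\<^sub>C ?x = v" using xd xv by simp
    fix y assume y: "y \<in> dom0 R \<and> H0 R y - z *\<^sub>C y = v"
    have R: "PiR R j y = PiR R j ?x" if j: "j \<in> {1,2}" for j
    proof (rule inj_onD[OF bij_betw_imp_inj_on[OF bij[OF j]]])
      show "PiR R j y \<in> domR R j" "PiR R j ?x \<in> domR R j"
        using y xd j by (auto simp: dom0_def)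
      show "hamR R j (PiR R j y) - z *\<^sub>C PiR R j y = hamR R j (PiR R j ?x) - z *\<^sub>C PiR R j ?x"
        using H0_components[of y z] H0_components[OF xd, of z] y xv j by auto
    qed
    have "hamS R (PiS R y - xS) - z *\<^sub>C (PiS R y - xS) = 0"
    proof -
      have "hamS R (PiS R y + (- 1) *\<^sub>C xS) = hamS R (PiS R y) + (- 1) *\<^sub>C hamS R xS"
        using self_adjoint_onD(3)[OF self_adjoint_S] xS(1) PiS_mem unfolding clinear_on_def by blast
      then have e1: "hamS R (PiS R y - xS) = hamS R (PiS R y) - hamS R xS"
        by (simp add: cvec.scale_minus_left scaleC_one)
      have e2: "hamS R (PiS R y) - z *\<^sub>C PiS R y = hamS R xS - z *\<^sub>C xS"
        using H0_components(3)[of y z] y xS by simp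
      have "hamS R (PiS R y - xS) - z *\<^sub>C (PiS R y - xS) =
          (hamS R (PiS R y) - z *\<^sub>C PiS R y) - (hamS R xS - z *\<^sub>C xS)"
        unfolding e1 cvec.scale_right_diff_distrib by simp
      then show ?thesis unfolding e2 by simp
    qed
    moreover have "\<bar>Im z\<bar> * norm (PiS R y - xS) \<le> norm (hamS R (PiS R y - xS) - z *\<^sub>C (PiS R y - xS))"
      using xS spS_subspace
      by (intro self_adjoint_nonreal_bound[OF self_adjoint_S] cvec.subspace_diff) auto
    ultimately have "PiS R y = xS" using z by (simp add: mult_le_0_iff)
    then show "y = ?x"
      using proj_sum[of y] R[of 1] R[of 2] c by simp
  qed
  then show "?r \<in> dom0 R" "H0 R ?r - z *\<^sub>C ?r = v" by auto
qed

subsection \<open>Wave operators\<close>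

lemma Omega_Pi0: "Omega R p (Pi0 R x) = Omega R p x"
  by (simp add: Omega_def moller_evolution_def)

lemma Omega_unitary: "unitary_onto (range (Pi0 R)) (H_ac R) (Omega R p)"
  using scattering by (simp add: scattering_theory_def)

text \<open>Unitarity gives linearity on the range of \<open>Pi0 R\<close>; it spreads to all
  vectors because \<open>Omega R p\<close> factors through \<open>Pi0 R\<close>.\<close>

lemma Omega_linear: "Omega R p (x + a *\<^sub>C y) = Omega R p x + a *\<^sub>C Omega R p y"
proof -
  have "Omega R p (Pi0 R x + a *\<^sub>C Pi0 R y) = Omega R p (Pi0 R x) + a *\<^sub>C Omega R p (Pi0 R y)"
    using Omega_unitary[of p] by (auto simp: unitary_onto_def clinear_on_def)
  then show ?thesis
    unfolding Pi0_linear[symmetric] by (simp only: Omega_Pi0)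
qed

lemma cinner_Omega: "cinner (Omega R p x) (Omega R p y) = cinner (Pi0 R x) y"
proof -
  have "cinner (Omega R p (Pi0 R x)) (Omega R p (Pi0 R y)) = cinner (Pi0 R x) (Pi0 R y)"
    using Omega_unitary[of p] by (auto simp: unitary_onto_def)
  then show ?thesis by (simp add: Omega_Pi0 flip: cinner_Pi0)
qed

lemma norm_Omega: "norm (Omega R p x) = norm (Pi0 R x)"
proof -
  have "complex_of_real ((norm (Omega R p x))\<^sup>2) = complex_of_real ((norm (Pi0 R x))\<^sup>2)"
    unfolding cinner_self[symmetric] cinner_Omega by (simp add: cinner_Pi0[of x "Pi0 R x"] cinner_Pi0[of x x])
  then show ?thesis by (metis norm_ge_zero of_real_eq_iff power2_eq_iff_nonneg)
qed

abbreviation Om' :: "pm \<Rightarrow> 'h \<Rightarrow> 'h" where "Om' p \<equiv> cadjoint (Omega R p)"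

lemma cinner_Om': "cinner (Om' p x) y = cinner x (Omega R p y)"
  by (rule cadjoint_eq[of _ 1]) (auto simp: Omega_linear norm_Omega norm_Pi0_le)

lemma Om'_Omega: "Om' p (Omega R p x) = Pi0 R x"
proof (rule cinner_ext)
  fix z
  have "cinner (Om' p (Omega R p x)) z = cinner (Pi0 R x) z"
    by (simp add: cinner_Om' cinner_Omega)
  then show "cinner z (Om' p (Omega R p x)) = cinner z (Pi0 R x)"
    by (metis cinner_commute)
qed

text \<open>Asymptotic completeness: both wave operators have range \<open>H_ac R\<close>, so
  \<open>Omega R Plus x = Omega R Minus z\<close> for some z, and then \<open>S_op R x\<close> is
  \<open>Pi0 R z\<close>, whose norm both isometries preserve.\<close>

lemma S_op_isometry: "norm (S_op R x) = norm (Pi0 R x)" "Pi0 R (S_op R x) = S_op R x"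
proof -
  have "Omega R Plus (Pi0 R x) \<in> H_ac R"
    using Omega_unitary[of Plus] by (auto simp: unitary_onto_def)
  then have "Omega R Plus (Pi0 R x) \<in> Omega R Minus ` range (Pi0 R)"
    using Omega_unitary[of Minus] by (simp add: unitary_onto_def)
  then obtain z where z: "Omega R Plus x = Omega R Minus z"
    by (auto simp: Omega_Pi0)
  then have "S_op R x = Pi0 R z" by (simp add: S_op_def Om'_Omega)
  then show "norm (S_op R x) = norm (Pi0 R x)" "Pi0 R (S_op R x) = S_op R x"
    using norm_Omega[of Plus x] norm_Omega[of Minus z] z by simp_all
qed

end

lemma gelfand_tripleD:
  assumes "gelfand_triple V K kin"
  shows "hilbert_form K kin" "K \<subseteq> V" "\<exists>C. \<forall>u\<in>K. norm u \<le> C * knorm kin u"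
proof -
  have *: "cvec.subspace K" "K \<subseteq> V"
    "\<forall>u\<in>K. \<forall>v\<in>K. \<forall>w\<in>K. \<forall>a. kin u (v + a *\<^sub>C w) = kin u v + a * kin u w"
    "\<forall>u\<in>K. \<forall>v\<in>K. kin u v = cnj (kin v u)"
    "\<forall>u\<in>K. u \<noteq> 0 \<longrightarrow> 0 < Re (kin u u)"
    "\<exists>C. \<forall>u\<in>K. norm u \<le> C * knorm kin u"
    "\<forall>X. (\<forall>n. X n \<in> K) \<and> (\<forall>\<epsilon>>0. \<exists>N. \<forall>m\<ge>N. \<forall>n\<ge>N. knorm kin (X m - X n) < \<epsilon>) \<longrightarrow>
        (\<exists>x\<in>K. (\<lambda>n. knorm kin (X n - x)) \<longlonglongrightarrow> 0)"
    using assms unfolding gelfand_triple_def by - (elim conjE, assumption)+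
  show "K \<subseteq> V" "\<exists>C. \<forall>u\<in>K. norm u \<le> C * knorm kin u" by fact+
  show "hilbert_form K kin"
  proof
    show "cvec.subspace K" by fact
    show "kin u v = cnj (kin v u)" if "u \<in> K" "v \<in> K" for u v
      using *(4)[rule_format, OF that] .
    show "\<exists>x\<in>K. (\<lambda>n. knorm kin (X n - x)) \<longlonglongrightarrow> 0"
      if "\<And>n. X n \<in> K" "\<And>\<epsilon>. \<epsilon> > 0 \<Longrightarrow> \<exists>N. \<forall>m\<ge>N. \<forall>n\<ge>N. knorm kin (X m - X n) < \<epsilon>" for X
      using *(7)[rule_format, of X] that by simp
  qed (use *(3,5) in auto)
qed

context scattering_system
begin

subsection \<open>Unitarity of the scattering matrix\<close>

definition Sm :: "nat \<Rightarrow> nat \<Rightarrow> real \<Rightarrow> complex" where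
  "Sm j k E = (if j = k then 1 else 0) - 2 * complex_of_real pi * \<i> * Tm j k E"

lemma Tm_measurable:
  "j \<in> {1,2} \<Longrightarrow> k \<in> {1,2} \<Longrightarrow> (\<lambda>E. indicator (sigma0 R) E *\<^sub>R Tm j k E) \<in> borel_measurable lborel"
  using transition by (auto simp: transition_matrix_def set_borel_measurable_def)

lemma fh_PiR_S_op:
  assumes x: "Pi0 R x = x" and j: "j \<in> {1,2}"
  shows "AE E in lborel. fh j (PiR R j (S_op R x)) E =
    Sm j 1 E * fh 1 (PiR R 1 x) E + Sm j 2 E * fh 2 (PiR R 2 x) E"
proof -
  interpret simple_spectral_rep j "sp R j" "domR R j" "hamR R j" "sigma0 R" "fourier R"
    by (rule spectral_rep[OF j])
  let ?c = "2 * complex_of_real pi * \<i>"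
  have "S_op R x = x + (- ?c) *\<^sub>C T_op R x"
    by (simp add: T_op_def scaleC_scaleC cvec.scale_minus_left scaleC_one)
  then have eq: "PiR R j (S_op R x) = PiR R j x + (- ?c) *\<^sub>C PiR R j (T_op R x)"
    using proj_linear(2)[OF j, of x "- ?c" "T_op R x"] by simp
  have "AE E in lborel. E \<in> sigma0 R \<longrightarrow>
        fourier R j (PiR R j (T_op R x)) E = (\<Sum>k\<in>{1,2}. Tm j k E * fourier R k (PiR R k x) E)"
    using transition j x range_Pi0[of x] unfolding transition_matrix_def by blast
  then show ?thesis
    using ft_linear[OF PiR_mem[OF j] PiR_mem[OF j], of x "- ?c" "T_op R x"]
  proof eventually_elim
    case (elim E)
    have "fh j (PiR R j (T_op R x)) E = Tm j 1 E * fh 1 (PiR R 1 x) E + Tm j 2 E * fh 2 (PiR R 2 x) E"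
      using elim(1) j by (cases "E \<in> sigma0 R") (auto simp: fh_eq)
    then have "fh j (PiR R j (S_op R x)) E = fh j (PiR R j x) E - ?c * (Tm j 1 E * fh 1 (PiR R 1 x) E + Tm j 2 E * fh 2 (PiR R 2 x) E)"
      unfolding eq elim(2) by simp
    then show ?case
      using j by (auto simp: Sm_def algebra_simps)
  qed
qed

text \<open>Apply isometry of S to the vector whose transform is the constant
  \<open>\<alpha>\<close> on a bounded set B. As B varies, S(E) must preserve the norm of
  \<open>\<alpha>\<close> for almost every E. The null set depends on \<open>\<alpha>\<close>, which
  is harmless because finitely many test vectors suffice.\<close>

lemma S_column_norm:
  "AE E in lborel. E \<in> sigma0 R \<longrightarrow>
    (cmod (Sm 1 1 E * \<alpha> 1 + Sm 1 2 E * \<alpha> 2))\<^sup>2 + (cmod (Sm 2 1 E * \<alpha> 1 + Sm 2 2 E * \<alpha> 2))\<^sup>2 =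
    (cmod (\<alpha> 1))\<^sup>2 + (cmod (\<alpha> (2::nat)))\<^sup>2"
proof (rule AE_eq_const_if_indicator_integrals[OF sigma0_borel])
  let ?\<sigma> = "sigma0 R"
  let ?r = "\<lambda>j E. Sm j 1 E * \<alpha> 1 + Sm j 2 E * \<alpha> 2"
  let ?q = "\<lambda>E. (cmod (?r 1 E))\<^sup>2 + (cmod (?r 2 E))\<^sup>2"
  let ?c = "(cmod (\<alpha> 1))\<^sup>2 + (cmod (\<alpha> 2))\<^sup>2"
  fix B assume B: "B \<in> sets borel" "B \<subseteq> ?\<sigma>" "bounded B"
  have iB: "integrable lborel (\<lambda>E. indicator B E :: real)"
    using B emeasure_bounded_finite[of B] by (intro integrable_real_indicator) auto
  have "\<exists>x\<in>sp R k. AE E in lborel. fh k x E = indicator B E * \<alpha> k" if k: "k \<in> {1,2}" for k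
  proof -
    have eq: "indicator ?\<sigma> E *\<^sub>R (indicator B E * \<alpha> k) = indicator B E * \<alpha> k" for E
      using B(2) by (auto simp: indicator_def)
    have sq: "(cmod (indicator B E * \<alpha> k))\<^sup>2 = indicator B E * (cmod (\<alpha> k))\<^sup>2" for E
      by (auto simp: indicator_def)
    have "L2_on ?\<sigma> (\<lambda>E. indicator B E * \<alpha> k)"
    proof (rule L2_onI; simp only: eq sq)
      show "integrable lborel (\<lambda>E. indicator B E * (cmod (\<alpha> k))\<^sup>2)" using iB by simp
      show "(\<lambda>E. indicator B E * \<alpha> k) \<in> borel_measurable lborel" using B(1) by measurable
    qed
    from simple_spectral_rep.ft_surj[OF spectral_rep[OF k] this] show ?thesis
      unfolding eq by blast
  qed
  then obtain x1 x2 where x: "x1 \<in> sp R 1" "AE E in lborel. fh 1 x1 E = indicator B E * \<alpha> 1"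
    "x2 \<in> sp R 2" "AE E in lborel. fh 2 x2 E = indicator B E * \<alpha> 2"
    by (meson insertI1 insertI2)
  define x where "x = x1 + x2"
  have Px: "PiR R 1 x = x1" "PiR R 2 x = x2"
    using x by (simp_all add: x_def PiR_add PiR_sp[where k = 1] PiR_sp[where k = 2])
  have x0: "Pi0 R x = x" by (simp add: Pi0_def Px) (simp add: x_def)
  have norm_int: "(norm (PiR R j y))\<^sup>2 = (LINT E|lborel. (cmod (fh j (PiR R j y) E))\<^sup>2)"
    and sq_int: "integrable lborel (\<lambda>E. (cmod (fh j (PiR R j y) E))\<^sup>2)" if "j \<in> {1,2}" for j y
    using simple_spectral_rep.ft_norm[OF spectral_rep PiR_mem]
      simple_spectral_rep.ft_integrable_sq[OF spectral_rep PiR_mem] that by auto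
  have Sx: "AE E in lborel. fh j (PiR R j (S_op R x)) E = indicator B E * ?r j E" if j: "j \<in> {1,2}" for j
    using fh_PiR_S_op[OF x0 j] x(2,4)
    by eventually_elim (simp add: Px algebra_simps)
  have rm: "(\<lambda>E. indicator B E * ?r j E) \<in> borel_measurable lborel" if j: "j \<in> {1,2}" for j
  proof -
    \<comment> \<open>\<open>Tm\<close> is known to be measurable only after cut-off to
      \<open>sigma0 R\<close>; this cut-off can be inserted because B lies inside.\<close>
    have "(\<lambda>E. indicator B E * ?r j E) = (\<lambda>E. indicator B E *
        (((if j = 1 then 1 else 0) - 2 * complex_of_real pi * \<i> * (indicator ?\<sigma> E *\<^sub>R Tm j 1 E)) * \<alpha> 1 +
         ((if j = 2 then 1 else 0) - 2 * complex_of_real pi * \<i> * (indicator ?\<sigma> E *\<^sub>R Tm j 2 E)) * \<alpha> 2))"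
      using B(2) by (auto simp: fun_eq_iff indicator_def Sm_def)
    also have "\<dots> \<in> borel_measurable lborel"
      using B(1) Tm_measurable[OF j, of 1] Tm_measurable[OF j, of 2] by measurable
    finally show ?thesis .
  qed
  have sq_ind: "(cmod (indicator B E * z))\<^sup>2 = indicator B E * (cmod z)\<^sup>2" for E z
    by (auto simp: indicator_def)
  have Sx_sq: "AE E in lborel. (cmod (fh j (PiR R j (S_op R x)) E))\<^sup>2 = indicator B E * (cmod (?r j E))\<^sup>2"
    if j: "j \<in> {1,2}" for j
    using Sx[OF j] by eventually_elim (simp only: sq_ind)
  have rm_sq: "(\<lambda>E. indicator B E * (cmod (?r j E))\<^sup>2) \<in> borel_measurable lborel" if "j \<in> {1,2}" for j
    using rm[OF that] unfolding sq_ind[symmetric] by measurable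
  have int_r: "integrable lborel (\<lambda>E. indicator B E * (cmod (?r j E))\<^sup>2)"
    and norm_S: "(norm (PiR R j (S_op R x)))\<^sup>2 = (LINT E|lborel. indicator B E * (cmod (?r j E))\<^sup>2)"
    if j: "j \<in> {1,2}" for j
  proof -
    show "integrable lborel (\<lambda>E. indicator B E * (cmod (?r j E))\<^sup>2)"
      using sq_int[OF j] integrable_cong_AE[OF borel_measurable_integrable[OF sq_int[OF j]] rm_sq[OF j] Sx_sq[OF j]]
      by simp
    show "(norm (PiR R j (S_op R x)))\<^sup>2 = (LINT E|lborel. indicator B E * (cmod (?r j E))\<^sup>2)"
      unfolding norm_int[OF j]
      by (rule integral_cong_AE[OF borel_measurable_integrable[OF sq_int[OF j]] rm_sq[OF j] Sx_sq[OF j]])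
  qed
  have norm_x: "(norm (PiR R k x))\<^sup>2 = (LINT E|lborel. indicator B E * (cmod (\<alpha> k))\<^sup>2)" if k: "k \<in> {1,2}" for k
    unfolding norm_int[OF k]
  proof (rule integral_cong_AE)
    show "(\<lambda>E. (cmod (fh k (PiR R k x) E))\<^sup>2) \<in> borel_measurable lborel"
      using sq_int[OF k] by (rule borel_measurable_integrable)
    show "(\<lambda>E. indicator B E * (cmod (\<alpha> k))\<^sup>2) \<in> borel_measurable lborel" using B(1) by measurable
    have "AE E in lborel. fh k (PiR R k x) E = indicator B E * \<alpha> k" using x k Px by auto
    then show "AE E in lborel. (cmod (fh k (PiR R k x) E))\<^sup>2 = indicator B E * (cmod (\<alpha> k))\<^sup>2"
      by eventually_elim (simp only: sq_ind)
  qed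
  have "(norm (S_op R x))\<^sup>2 = (norm x)\<^sup>2" using S_op_isometry(1)[of x] x0 by simp
  then have eq: "(norm (PiR R 1 (S_op R x)))\<^sup>2 + (norm (PiR R 2 (S_op R x)))\<^sup>2 =
      (norm (PiR R 1 x))\<^sup>2 + (norm (PiR R 2 x))\<^sup>2"
    using norm_Pi0[of "S_op R x"] norm_Pi0[of x] S_op_isometry(2)[of x] x0 by simp
  show "integrable lborel (\<lambda>E. indicator B E * ?q E) \<and>
      (LINT E|lborel. indicator B E * ?q E) = (LINT E|lborel. indicator B E * ?c)"
  proof
    show "integrable lborel (\<lambda>E. indicator B E * ?q E)"
      using int_r[of 1] int_r[of 2] by (simp add: distrib_left)
    have "(LINT E|lborel. indicator B E * ?q E) =
        (LINT E|lborel. indicator B E * (cmod (?r 1 E))\<^sup>2) + (LINT E|lborel. indicator B E * (cmod (?r 2 E))\<^sup>2)"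
      unfolding distrib_left using int_r[of 1] int_r[of 2] by (intro Bochner_Integration.integral_add) auto
    also have "\<dots> = (LINT E|lborel. indicator B E * (cmod (\<alpha> 1))\<^sup>2) + (LINT E|lborel. indicator B E * (cmod (\<alpha> 2))\<^sup>2)"
      using eq norm_S[of 1] norm_S[of 2] norm_x[of 1] norm_x[of 2] by simp
    also have "\<dots> = (LINT E|lborel. indicator B E * ?c)"
      unfolding distrib_left using iB by (intro Bochner_Integration.integral_add[symmetric]) auto
    finally show "(LINT E|lborel. indicator B E * ?q E) = (LINT E|lborel. indicator B E * ?c)" .
  qed
qed

text \<open>The test vectors (1,0), (0,1), (1,1) and (1,i) determine the columns of S(E), which
  would yield T_21. Passing to the first row gives T_12 instead, after which |1 - 2 pi i T_11|^2 = 1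
  + 4 pi Im T_11 + 4 pi^2 |T_11|^2 is inserted.\<close>

lemma optical_theorem:
  "AE E in lborel. E \<in> sigma0 R \<longrightarrow> Im (Tm 1 1 E) = - pi * ((cmod (Tm 1 1 E))\<^sup>2 + (cmod (Tm 1 2 E))\<^sup>2)"
  using S_column_norm[of "\<lambda>k. if k = 1 then 1 else 0"] S_column_norm[of "\<lambda>k. if k = 1 then 0 else 1"]
    S_column_norm[of "\<lambda>k. 1"] S_column_norm[of "\<lambda>k. if k = 1 then 1 else \<i>"]
proof eventually_elim
  case (elim E)
  show ?case
  proof
    assume E: "E \<in> sigma0 R"
    have "(cmod (Sm 1 1 E))\<^sup>2 + (cmod (Sm 1 2 E))\<^sup>2 = 1"
    proof (rule unitary_2x2_row)
      show "(cmod (Sm 1 1 E))\<^sup>2 + (cmod (Sm 2 1 E))\<^sup>2 = 1"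
        using elim(1)[rule_format, OF E] by simp
      show "(cmod (Sm 1 2 E))\<^sup>2 + (cmod (Sm 2 2 E))\<^sup>2 = 1"
        using elim(2)[rule_format, OF E] by simp
      show "(cmod (Sm 1 1 E + Sm 1 2 E))\<^sup>2 + (cmod (Sm 2 1 E + Sm 2 2 E))\<^sup>2 = 2"
        using elim(3)[rule_format, OF E] by simp
      show "(cmod (Sm 1 1 E + \<i> * Sm 1 2 E))\<^sup>2 + (cmod (Sm 2 1 E + \<i> * Sm 2 2 E))\<^sup>2 = 2"
        using elim(4)[rule_format, OF E] by (simp add: mult.commute[of \<i>])
    qed
    moreover have "(cmod (Sm 1 1 E))\<^sup>2 = 1 + 4 * pi * Im (Tm 1 1 E) + 4 * pi\<^sup>2 * (cmod (Tm 1 1 E))\<^sup>2"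
      unfolding cmod_power2 Sm_def by (simp add: power2_eq_square algebra_simps)
    moreover have "(cmod (Sm 1 2 E))\<^sup>2 = 4 * pi\<^sup>2 * (cmod (Tm 1 2 E))\<^sup>2"
      unfolding cmod_power2 Sm_def by (simp add: power2_eq_square algebra_simps)
    ultimately have "4 * pi * (Im (Tm 1 1 E) + pi * ((cmod (Tm 1 1 E))\<^sup>2 + (cmod (Tm 1 2 E))\<^sup>2)) = 0"
      by (simp add: power2_eq_square algebra_simps)
    then show "Im (Tm 1 1 E) = - pi * ((cmod (Tm 1 1 E))\<^sup>2 + (cmod (Tm 1 2 E))\<^sup>2)"
      by simp
  qed
qed

subsection \<open>Distorted eigenfunctions\<close>

definition \<Psi> :: "nat \<Rightarrow> real \<Rightarrow> 'h \<Rightarrow> complex" where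
  "\<Psi> k E = \<Omega> Plus (psi0_tot R k E)"

lemma gelfand: "k \<in> {1,2} \<Longrightarrow> gelfand_triple (sp R k) (spK R k) (innerK R k)"
  using free_eig by (auto simp: free_eigenfunctions_def)

lemma hilbert_form_K:
  assumes k: "k \<in> {1,2}"
  shows "hilbert_form (spK R k) (innerK R k)"
  using gelfand_tripleD(1)[OF gelfand[OF k]] .

lemma spK_sp: "k \<in> {1,2} \<Longrightarrow> x \<in> spK R k \<Longrightarrow> x \<in> sp R k"
  using gelfand_tripleD(2)[OF gelfand] by blast

lemma Ktot_PiR: "k \<in> {1,2} \<Longrightarrow> u \<in> Ktot R \<Longrightarrow> PiR R k u \<in> spK R k"
  by (auto simp: Ktot_def)

lemma spK_Ktot: "k \<in> {1,2} \<Longrightarrow> x \<in> spK R k \<Longrightarrow> x \<in> Ktot R"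
  using hilbert_form.mem_0[OF hilbert_form_K[of 1]] hilbert_form.mem_0[OF hilbert_form_K[of 2]]
  by (auto simp: Ktot_def PiR_sp[OF _ _ spK_sp])

lemma spS_Ktot: "x \<in> spS R \<Longrightarrow> x \<in> Ktot R"
  using hilbert_form.mem_0[OF hilbert_form_K[of 1]] hilbert_form.mem_0[OF hilbert_form_K[of 2]]
  by (auto simp: Ktot_def PiR_spS)

lemma Ktot_linear: "u \<in> Ktot R \<Longrightarrow> v \<in> Ktot R \<Longrightarrow> u + a *\<^sub>C v \<in> Ktot R"
  using hilbert_form.mems[OF hilbert_form_K] by (auto simp: Ktot_def proj_linear)

lemma Ktot_subspace: "cvec.subspace (Ktot R)"
proof (rule cvec.subspaceI)
  show z: "0 \<in> Ktot R" using spS_Ktot sp_zero by blast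
  show "x + y \<in> Ktot R" if "x \<in> Ktot R" "y \<in> Ktot R" for x y
    using Ktot_linear[OF that, of 1] by (simp add: scaleC_one)
  show "c *\<^sub>C x \<in> Ktot R" if "x \<in> Ktot R" for c x
    using Ktot_linear[OF z that, of c] by simp
qed

lemma knorm_le_Ktot_norm:
  assumes k: "k \<in> {1,2}"
  shows "knorm (innerK R k) (PiR R k u) \<le> Ktot_norm R u"
proof -
  have "(knorm (innerK R k) (PiR R k u))\<^sup>2 \<le>
      (norm (PiS R u))\<^sup>2 + (\<Sum>j\<in>{1,2}. (knorm (innerK R j) (PiR R j u))\<^sup>2)"
    using k by auto
  then show ?thesis
    unfolding Ktot_norm_def by (rule real_le_rsqrt)
qed

text \<open>Extension by zero places the dual of one \<open>K\<^sub>k\<close> in the orthogonal sum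
  on which the extended wave operators act.\<close>

lemma antidual_PiR_Kdual0:
  assumes k: "k \<in> {1,2}" and \<psi>: "\<psi> \<in> antidual (spK R k) (knorm (innerK R k))"
  shows "(\<lambda>w. \<psi> (PiR R k w)) \<in> Kdual0 R"
proof -
  interpret hilbert_form "spK R k" "innerK R k" by (rule hilbert_form_K[OF k])
  have lin: "\<psi> (u + a *\<^sub>C v) = \<psi> u + cnj a * \<psi> v" if "u \<in> spK R k" "v \<in> spK R k" for u v a
    using \<psi> that by (auto simp: antidual_def)
  obtain C where C: "\<And>u. u \<in> spK R k \<Longrightarrow> cmod (\<psi> u) \<le> C * knorm (innerK R k) u"
    using \<psi> unfolding antidual_def by blast
  have "cmod (\<psi> (PiR R k u)) \<le> \<bar>C\<bar> * Ktot_norm R u" if "u \<in> Ktot R" for u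
  proof -
    have u: "PiR R k u \<in> spK R k" using that k by (rule Ktot_PiR[rotated])
    have "cmod (\<psi> (PiR R k u)) \<le> C * knorm (innerK R k) (PiR R k u)" by (rule C[OF u])
    also have "\<dots> \<le> \<bar>C\<bar> * knorm (innerK R k) (PiR R k u)"
      using u by (intro mult_right_mono) auto
    also have "\<dots> \<le> \<bar>C\<bar> * Ktot_norm R u"
      by (intro mult_left_mono knorm_le_Ktot_norm k) auto
    finally show ?thesis .
  qed
  moreover have "\<psi> 0 = 0" using lin[of 0 0 1] by simp
  ultimately show ?thesis
    unfolding Kdual0_def Kdual_def antidual_def
    using lin Ktot_PiR[OF k] k by (auto simp: proj_linear PiR_spS)
qed

lemma psi0_antidual: "k \<in> {1,2} \<Longrightarrow> E \<in> sigma0 R \<Longrightarrow> psi0 R k E \<in> antidual (spK R k) (knorm (innerK R k))"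
  using free_eig by (auto simp: free_eigenfunctions_def)

lemma psi0_tot_Kdual0: "k \<in> {1,2} \<Longrightarrow> E \<in> sigma0 R \<Longrightarrow> psi0_tot R k E \<in> Kdual0 R"
  using antidual_PiR_Kdual0[OF _ psi0_antidual] by (simp add: psi0_tot_def[abs_def])

lemma bounded_ext: "bounded_extension R p (\<Omega> p)"
  using technical by (simp add: technical_assumptions_def)

lemma \<Psi>_Kdual: "k \<in> {1,2} \<Longrightarrow> E \<in> sigma0 R \<Longrightarrow> \<Psi> k E \<in> Kdual R"
  using bounded_ext[of Plus] psi0_tot_Kdual0 by (auto simp: bounded_extension_def \<Psi>_def)

text \<open>By reflexivity of \<open>K\<^sub>k\<close>, the extended wave operator is the transpose of a map
  \<open>K \<rightarrow> K\<^sub>k\<close>, which coincides with \<open>\<Pi>\<^sub>k \<Omega>\<^sub>+\<^sup>*\<close>.\<close>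

lemma fourier_Om':
  assumes k: "k \<in> {1,2}" and u: "u \<in> Ktot R"
  shows "AE E in lborel. E \<in> sigma0 R \<longrightarrow> fourier R k (PiR R k (Om' Plus u)) E = cnj (\<Psi> k E u)"
proof -
  interpret hilbert_form "spK R k" "innerK R k" by (rule hilbert_form_K[OF k])
  note be = bounded_ext[of Plus, unfolded bounded_extension_def]
  define L where "L \<psi> = \<Omega> Plus (\<lambda>w. \<psi> (PiR R k w)) u" for \<psi>
  obtain C where C: "\<And>\<psi> c. \<psi> \<in> Kdual0 R \<Longrightarrow> c \<ge> 0 \<Longrightarrow> (\<And>u. u \<in> Ktot R \<Longrightarrow> cmod (\<psi> u) \<le> c * Ktot_norm R u) \<Longrightarrow>
      cmod (\<Omega> Plus \<psi> u) \<le> C * c * Ktot_norm R u"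
    using be u by metis
  obtain \<kappa> where \<kappa>: "\<kappa> \<in> spK R k" "\<And>\<psi>. \<psi> \<in> antidual (spK R k) (knorm (innerK R k)) \<Longrightarrow> L \<psi> = \<psi> \<kappa>"
  proof (rule reflexive[of L])
    fix \<psi> \<phi> a
    assume "\<psi> \<in> antidual (spK R k) (knorm (innerK R k))" "\<phi> \<in> antidual (spK R k) (knorm (innerK R k))"
    then have "(\<lambda>w. \<psi> (PiR R k w)) \<in> Kdual0 R" "(\<lambda>w. \<phi> (PiR R k w)) \<in> Kdual0 R"
      by - (rule antidual_PiR_Kdual0[OF k], assumption)+
    from be[THEN conjunct2, THEN conjunct1, rule_format, OF this u, of a]
    show "L (\<lambda>w. \<psi> w + a * \<phi> w) = L \<psi> + a * L \<phi>"
      unfolding L_def .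
  next
    fix \<psi> c
    assume \<psi>: "\<psi> \<in> antidual (spK R k) (knorm (innerK R k))" and c: "0 \<le> c"
      and bd: "\<And>u. u \<in> spK R k \<Longrightarrow> cmod (\<psi> u) \<le> c * knorm (innerK R k) u"
    have "cmod (L \<psi>) \<le> C * c * Ktot_norm R u"
      unfolding L_def
    proof (rule C[OF antidual_PiR_Kdual0[OF k \<psi>] c])
      fix w assume w: "w \<in> Ktot R"
      have "cmod (\<psi> (PiR R k w)) \<le> c * knorm (innerK R k) (PiR R k w)"
        by (intro bd Ktot_PiR k w)
      also have "\<dots> \<le> c * Ktot_norm R w"
        by (intro mult_left_mono knorm_le_Ktot_norm k c)
      finally show "cmod (\<psi> (PiR R k w)) \<le> c * Ktot_norm R w" .
    qed
    then show "cmod (L \<psi>) \<le> C * Ktot_norm R u * c" by (simp add: mult_ac)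
  qed (rule that)
  have "PiR R k (Om' Plus u) = \<kappa>"
  proof -
    \<comment> \<open>Ordinary vectors \<open>x\<close> of \<open>sp R k\<close> embed in the dual,
      and there the extended wave operator is the original one. Hence \<open>\<kappa>\<close> has
      the same inner products as the projected adjoint applied to \<open>u\<close>.\<close>
    have emb: "cinner \<kappa> x = cinner (PiR R k (Om' Plus u)) x" if x: "x \<in> sp R k" for x
    proof -
      obtain B where B: "\<And>w. w \<in> spK R k \<Longrightarrow> norm w \<le> B * knorm (innerK R k) w"
        using gelfand_tripleD(3)[OF gelfand[OF k]] by blast
      have "cmod (cinner w x) \<le> (B * norm x) * knorm (innerK R k) w" if "w \<in> spK R k" for w
        using cinner_bound[of w x] mult_right_mono[OF B[OF that], of "norm x"] by (simp add: mult_ac)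
      then have "embed x \<in> antidual (spK R k) (knorm (innerK R k))"
        unfolding antidual_def embed_def by (auto simp: cinner_add_left cinner_scaleC_left)
      then have "cinner \<kappa> x = L (embed x)"
        using \<kappa>(2) by (simp add: embed_def)
      also have "(\<lambda>w. embed x (PiR R k w)) = embed x"
        using cinner_PiR_mem(1)[OF k x] by (simp add: embed_def fun_eq_iff)
      then have "L (embed x) = \<Omega> Plus (embed x) u" by (simp add: L_def)
      also have "\<dots> = cinner u (Omega R Plus x)"
        using be u x sp_Pi0[OF k x] range_Pi0[of x] by blast
      also have "\<dots> = cinner (PiR R k (Om' Plus u)) x"
        using cinner_PiR_mem(1)[OF k x] by (simp add: cinner_Om')
      finally show ?thesis .
    qed
    let ?d = "PiR R k (Om' Plus u) - \<kappa>"
    have "?d \<in> sp R k"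
      using \<kappa>(1) spK_sp[OF k] PiR_mem[OF k] sp_subspace[OF k] by (auto intro: cvec.subspace_diff)
    then have "cinner ?d ?d = 0" using emb[of ?d] by (simp add: cinner_diff_left)
    then show ?thesis by simp
  qed
  moreover have "AE E in lborel. E \<in> sigma0 R \<longrightarrow> fourier R k \<kappa> E = cnj (psi0 R k E \<kappa>)"
    using free_eig k \<kappa>(1) unfolding free_eigenfunctions_def by blast
  \<comment> \<open>The same representation evaluated at the generalized eigenfunction holds for
    every energy in \<open>sigma0 R\<close>; the null set comes only from the Fourier transform of
    the single vector \<open>\<kappa>\<close>.\<close>
  moreover have "psi0 R k E \<kappa> = \<Psi> k E u" if "E \<in> sigma0 R" for E
    using \<kappa>(2)[OF psi0_antidual[OF k that]] by (simp add: L_def \<Psi>_def psi0_tot_def[abs_def])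
  ultimately show ?thesis by (auto elim: eventually_mono)
qed

subsection \<open>The coupling\<close>

text \<open>One index set for the whole coupling: first component 0 labels the direct term between
  the reservoirs, 1 and 2 the terms between system and reservoir. Index \<open>i\<close> stands for
  \<open>cv i\<close> times |av i><bv i| plus its adjoint.\<close>

definition Iv :: "(nat \<times> nat) set" where
  "Iv = Sigma {0, 1, 2} (\<lambda>j. {..<(if j = 0 then n12 R else nS R j)})"

definition cv :: "nat \<times> nat \<Rightarrow> complex" where
  "cv = (\<lambda>(j, l). complex_of_real (if j = 0 then coef12 R l else coefS R j l))"

definition av :: "nat \<times> nat \<Rightarrow> 'h" where
  "av = (\<lambda>(j, l). if j = 0 then vec12 R 1 l else vecS R j l)"

definition bv :: "nat \<times> nat \<Rightarrow> 'h" where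
  "bv = (\<lambda>(j, l). if j = 0 then vec12 R 2 l else vecR R j l)"

lemma finite_Iv [simp]: "finite Iv"
  by (auto simp: Iv_def)

lemma cnj_cv [simp]: "cnj (cv i) = cv i"
  by (simp add: cv_def split: prod.split)

lemma V_gen_sum: "V_gen R \<psi> = (\<Sum>i\<in>Iv. cv i *\<^sub>C (\<psi> (bv i) *\<^sub>C av i + \<psi> (av i) *\<^sub>C bv i))"
proof -
  have "(\<Sum>i\<in>Iv. cv i *\<^sub>C (\<psi> (bv i) *\<^sub>C av i + \<psi> (av i) *\<^sub>C bv i)) =
      (\<Sum>j\<in>{0,1,2}. \<Sum>l<(if j = 0 then n12 R else nS R j).
        cv (j, l) *\<^sub>C (\<psi> (bv (j, l)) *\<^sub>C av (j, l) + \<psi> (av (j, l)) *\<^sub>C bv (j, l)))"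
    unfolding Iv_def by (subst sum.Sigma) (auto simp: case_prod_unfold)
  also have "\<dots> = V_gen R \<psi>"
    by (simp add: V_gen_def cv_def av_def bv_def add_ac)
  finally show ?thesis ..
qed

lemma av_Ktot: "i \<in> Iv \<Longrightarrow> av i \<in> Ktot R" and bv_Ktot: "i \<in> Iv \<Longrightarrow> bv i \<in> Ktot R"
proof -
  have c: "l < nS R j \<Longrightarrow> vecS R j l \<in> Ktot R" "l < nS R j \<Longrightarrow> vecR R j l \<in> Ktot R"
    "l < n12 R \<Longrightarrow> vec12 R j l \<in> Ktot R" if "j \<in> {1,2}" for j l
    using coupled technical that
    by (auto simp: coupling_def technical_assumptions_def intro: spS_Ktot spK_Ktot)
  show "i \<in> Iv \<Longrightarrow> av i \<in> Ktot R" "i \<in> Iv \<Longrightarrow> bv i \<in> Ktot R"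
    using c by (auto simp: Iv_def av_def bv_def)
qed

lemma PiR_Ktot: "k \<in> {1,2} \<Longrightarrow> u \<in> Ktot R \<Longrightarrow> PiR R k u \<in> Ktot R"
  using spK_Ktot Ktot_PiR by blast

lemma V_gen_Ktot: "V_gen R \<psi> \<in> Ktot R"
  unfolding V_gen_sum
  by (intro cvec.subspace_sum[OF Ktot_subspace] cvec.subspace_scale[OF Ktot_subspace]
      cvec.subspace_add[OF Ktot_subspace] av_Ktot bv_Ktot)

text \<open>Symmetry of the projection moves it onto the coupling vectors, leaving a finite sum of
  rank-one terms whose traces \<open>parseval\<close> can evaluate.\<close>

lemma cinner_commutator:
  "cinner y (commutator (V_op R) (PiR R 1) x) = (\<Sum>i\<in>Iv. cv i *
    (cinner (PiR R 1 (bv i)) x * cinner y (av i) + cinner (PiR R 1 (av i)) x * cinner y (bv i)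
     - cinner (bv i) x * cinner y (PiR R 1 (av i)) - cinner (av i) x * cinner y (PiR R 1 (bv i))))"
proof -
  have V: "cinner y (V_op R x) = (\<Sum>i\<in>Iv. cv i * (cinner (bv i) x * cinner y (av i) + cinner (av i) x * cinner y (bv i)))"
    for x y
    by (simp add: V_op_def V_gen_sum embed_def cinner_sum_right cinner_scaleC_right cinner_add_right)
  have "cinner y (commutator (V_op R) (PiR R 1) x) = cinner y (V_op R (PiR R 1 x)) - cinner (PiR R 1 y) (V_op R x)"
    by (simp add: commutator_def cinner_diff_right cinner_PiR)
  also have "\<dots> = (\<Sum>i\<in>Iv. cv i *
    (cinner (PiR R 1 (bv i)) x * cinner y (av i) + cinner (PiR R 1 (av i)) x * cinner y (bv i)
     - cinner (bv i) x * cinner y (PiR R 1 (av i)) - cinner (av i) x * cinner y (PiR R 1 (bv i))))"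
    unfolding V sum_subtractf[symmetric]
    by (intro sum.cong refl) (simp add: cinner_PiR algebra_simps)
  finally show ?thesis .
qed

end

text \<open>Makes the exceptional set of energies a null set: each isolated point is singled out by
  a member of a countable basis, and this assignment is injective.\<close>

lemma discrete_imp_countable:
  fixes X :: "'a::second_countable_topology set"
  assumes "discrete X"
  shows "countable X"
proof -
  obtain B :: "'a set set" where B: "countable B" "topological_basis B"
    using ex_countable_basis by blast
  have "\<exists>b\<in>B. b \<inter> X = {x}" if x: "x \<in> X" for x
  proof -
    obtain T where T: "open T" "T \<inter> X = {x}"
      using assms x unfolding discrete_def isolated_in_def by blast
    then obtain b where "b \<in> B" "x \<in> b" "b \<subseteq> T"
      using topological_basisE[OF B(2), of T x] by blast
    then show ?thesis using T(2) x by blast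
  qed
  then obtain b where b: "\<And>x. x \<in> X \<Longrightarrow> b x \<in> B" "\<And>x. x \<in> X \<Longrightarrow> b x \<inter> X = {x}" by metis
  have "inj_on b X"
    using b(2) by (intro inj_onI) (metis singleton_inject)
  moreover have "countable (b ` X)"
    using b(1) B(1) by (intro countable_subset[OF _ B(1)]) auto
  ultimately show ?thesis by (rule countable_image_inj_on[rotated])
qed

lemma antidual_sum:
  assumes \<psi>: "\<psi> \<in> antidual K N" and K: "cvec.subspace K" and u: "\<And>i. i \<in> I \<Longrightarrow> u i \<in> K"
  shows "\<psi> (\<Sum>i\<in>I. a i *\<^sub>C u i) = (\<Sum>i\<in>I. cnj (a i) * \<psi> (u i))"
proof -
  have lin: "\<psi> (v + c *\<^sub>C w) = \<psi> v + cnj c * \<psi> w" if "v \<in> K" "w \<in> K" for v w c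
    using \<psi> that by (simp add: antidual_def)
  have z: "\<psi> 0 = 0" using lin[of 0 0 1] cvec.subspace_0[OF K] by simp
  show ?thesis
    using u
  proof (induction I rule: infinite_finite_induct)
    case (insert i I)
    have "(\<Sum>i\<in>I. a i *\<^sub>C u i) \<in> K"
      using insert by (intro cvec.subspace_sum[OF K] cvec.subspace_scale[OF K]) auto
    then have "\<psi> ((\<Sum>i\<in>I. a i *\<^sub>C u i) + a i *\<^sub>C u i) = \<psi> (\<Sum>i\<in>I. a i *\<^sub>C u i) + cnj (a i) * \<psi> (u i)"
      using insert by (intro lin) auto
    then show ?case using insert by (simp add: add.commute)
  qed (auto simp: z)
qed

context scattering_system
begin

subsection \<open>The Lippmann-Schwinger equation\<close>

lemma \<Psi>_antidual: "k \<in> {1,2} \<Longrightarrow> E \<in> sigma0 R \<Longrightarrow> \<Psi> k E \<in> antidual (Ktot R) (Ktot_norm R)"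
  using \<Psi>_Kdual by (simp add: Kdual_def)

text \<open>The boolean distinguishes |av><bv| from its adjoint. The result is a fixed finite family
  of vectors with coefficients depending on \<open>\<psi>\<close>, the shape required by
  \<open>resolvent_boundary_value\<close>.\<close>

lemma PiR_V_gen:
  "PiR R 1 (V_gen R \<psi>) = (\<Sum>p\<in>Iv \<times> UNIV.
     (cv (fst p) * \<psi> (if snd p then bv (fst p) else av (fst p))) *\<^sub>C
     PiR R 1 (if snd p then av (fst p) else bv (fst p)))"
proof -
  have "PiR R 1 (V_gen R \<psi>) = (\<Sum>i\<in>Iv. \<Sum>t\<in>UNIV. (cv i * \<psi> (if t then bv i else av i)) *\<^sub>C
     PiR R 1 (if t then av i else bv i))"
    by (simp add: V_gen_sum PiR_sum PiR_scale PiR_add scaleC_add_right scaleC_scaleC UNIV_bool add.commute)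
  then show ?thesis
    by (simp add: sum.cartesian_product case_prod_unfold)
qed

text \<open>The vector \<open>V_gen R (\<Psi> k E)\<close> depends on E, so all null sets are fixed
  beforehand for the vectors \<open>w p\<close>; only the coefficients \<open>d E p\<close> vary
  with the energy.\<close>

lemma Im_lippmann_schwinger:
  assumes k: "k \<in> {1,2}"
  shows "AE E in lborel. E \<in> sigma0 R \<longrightarrow> Im (\<Psi> k E (PiR R 1 (V_gen R (\<Psi> k E)))) =
    (if k = 1 then - Im (Tm 1 1 E) else 0) - pi * (cmod (Tm 1 k E))\<^sup>2"
proof -
  interpret r1: simple_spectral_rep 1 "sp R 1" "domR R 1" "hamR R 1" "sigma0 R" "fourier R"
    by (rule spectral_rep) simp
  let ?J = "Iv \<times> (UNIV :: bool set)"
  define w where "w p = PiR R 1 (if snd p then av (fst p) else bv (fst p))" for p :: "(nat \<times> nat) \<times> bool"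
  define d where "d E p = cv (fst p) * \<Psi> k E (if snd p then bv (fst p) else av (fst p))"
    for E and p :: "(nat \<times> nat) \<times> bool"
  have wK: "w p \<in> spK R 1" if "p \<in> ?J" for p
    using that av_Ktot bv_Ktot Ktot_PiR[of 1] by (auto simp: w_def)
  have w1: "w p \<in> sp R 1" for p by (simp add: w_def PiR_mem1)
  obtain \<epsilon> :: "nat \<Rightarrow> real" where \<epsilon>: "\<And>n. \<epsilon> n > 0" "\<epsilon> \<longlonglongrightarrow> 0"
    and lim: "AE e in lborel. \<forall>d x. (\<forall>n. x n \<in> domR R 1 \<and>
        hamR R 1 (x n) - (complex_of_real e + \<i> * complex_of_real (\<epsilon> n)) *\<^sub>C x n = (\<Sum>i\<in>?J. d i *\<^sub>C w i)) \<longrightarrow>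
      (\<lambda>n. Im (cinner (\<Sum>i\<in>?J. d i *\<^sub>C w i) (x n))) \<longlonglongrightarrow> pi * (cmod (\<Sum>i\<in>?J. d i * r1.ft (w i) e))\<^sup>2"
  proof (rule r1.resolvent_boundary_value[of ?J w])
    show "hamR R 1 x \<in> sp R 1" if "x \<in> domR R 1" for x using hamR_mem[of 1] that by simp
    show "finite ?J" by simp
    show "w p \<in> sp R 1" for p by (rule w1)
  qed (rule that)
  have ftw: "AE E in lborel. \<forall>p\<in>?J. E \<in> sigma0 R \<longrightarrow> r1.ft (w p) E = cnj (psi0 R 1 E (w p))"
  proof (rule AE_finite_allI)
    fix p assume "p \<in> ?J"
    then have "AE E in lborel. E \<in> sigma0 R \<longrightarrow> fourier R 1 (w p) E = cnj (psi0 R 1 E (w p))"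
      using free_eig wK unfolding free_eigenfunctions_def by blast
    then show "AE E in lborel. E \<in> sigma0 R \<longrightarrow> r1.ft (w p) E = cnj (psi0 R 1 E (w p))"
      by eventually_elim (simp add: r1.ft_def)
  qed simp
  have "countable X" using technical by (auto simp: technical_assumptions_def intro: discrete_imp_countable)
  then have X: "AE E in lborel. E \<notin> X"
    by (intro AE_not_in countable_imp_null_set_lborel)
  show ?thesis
    using lim ftw X
  proof eventually_elim
    case (elim E)
    show ?case
    proof
      assume E: "E \<in> sigma0 R"
      define v where "v = V_gen R (\<Psi> k E)"
      define r where "r \<epsilon> = resolvent (dom0 R) (H0 R) (complex_of_real E + \<i> * complex_of_real \<epsilon>) v" for \<epsilon> :: real
      have vsum: "PiR R 1 v = (\<Sum>p\<in>?J. d E p *\<^sub>C w p)"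
        unfolding v_def PiR_V_gen d_def w_def ..
      have res: "r (\<epsilon> n) \<in> dom0 R" "H0 R (r (\<epsilon> n)) - (complex_of_real E + \<i> * complex_of_real (\<epsilon> n)) *\<^sub>C r (\<epsilon> n) = v" for n
        unfolding r_def using \<epsilon>(1)[of n] by (auto intro!: resolvent_H0)
      have "(\<lambda>n. Im (cinner (PiR R 1 v) (PiR R 1 (r (\<epsilon> n))))) \<longlonglongrightarrow> pi * (cmod (\<Sum>p\<in>?J. d E p * r1.ft (w p) E))\<^sup>2"
      proof -
        have "\<forall>n. PiR R 1 (r (\<epsilon> n)) \<in> domR R 1 \<and> hamR R 1 (PiR R 1 (r (\<epsilon> n)))
            - (complex_of_real E + \<i> * complex_of_real (\<epsilon> n)) *\<^sub>C PiR R 1 (r (\<epsilon> n)) = (\<Sum>p\<in>?J. d E p *\<^sub>C w p)"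
        proof
          fix n
          show "PiR R 1 (r (\<epsilon> n)) \<in> domR R 1 \<and> hamR R 1 (PiR R 1 (r (\<epsilon> n)))
            - (complex_of_real E + \<i> * complex_of_real (\<epsilon> n)) *\<^sub>C PiR R 1 (r (\<epsilon> n)) = (\<Sum>p\<in>?J. d E p *\<^sub>C w p)"
            unfolding H0_components(1)[OF res(1), symmetric] res(2) vsum[symmetric]
            using res(1)[of n] by (simp add: dom0_def)
        qed
        then show ?thesis
          unfolding vsum
          by (rule elim(1)[THEN spec[of _ "d E"], THEN spec[of _ "\<lambda>n. PiR R 1 (r (\<epsilon> n))"], THEN mp])
      qed
      then have L1: "(\<lambda>n. Im (cinner (PiR R 1 v) (r (\<epsilon> n)))) \<longlonglongrightarrow> pi * (cmod (\<Sum>p\<in>?J. d E p * r1.ft (w p) E))\<^sup>2"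
        using cinner_PiR_mem(2)[of 1 "PiR R 1 v"] by (simp add: PiR_mem1)
      \<comment> \<open>This sum is the pointwise meaning of the transform of
        \<open>PiR R 1 v\<close> at E. Expanding \<open>psi0 R 1 E\<close> over the same family
        identifies it with the transition amplitude.\<close>
      have T: "(\<Sum>p\<in>?J. d E p * r1.ft (w p) E) = Tm 1 k E"
      proof -
        have "Tm 1 k E = cnj (psi0_tot R 1 E v)"
          using technical k E elim(3) unfolding technical_assumptions_def v_def \<Psi>_def by blast
        also have "psi0_tot R 1 E v = (\<Sum>p\<in>?J. cnj (d E p) * psi0 R 1 E (w p))"
          unfolding psi0_tot_def vsum
          using psi0_antidual[of 1 E] E wK hilbert_form.subspace[OF hilbert_form_K[of 1]]
          by (intro antidual_sum) auto
        finally have "Tm 1 k E = (\<Sum>p\<in>?J. d E p * cnj (psi0 R 1 E (w p)))" by simp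
        also have "\<dots> = (\<Sum>p\<in>?J. d E p * r1.ft (w p) E)"
          using elim(2) E by (intro sum.cong refl) auto
        finally show ?thesis ..
      qed
      have "PiR R 1 v \<in> Ktot R" unfolding v_def by (intro PiR_Ktot V_gen_Ktot) simp
      then have LS: "((\<lambda>\<epsilon>. cinner (PiR R 1 v) (r \<epsilon>)) \<longlongrightarrow> psi0_tot R k E (PiR R 1 v) - \<Psi> k E (PiR R 1 v)) (at_right 0)"
        using technical k E elim(3) unfolding technical_assumptions_def Let_def v_def r_def \<Psi>_def
        by (auto dest!: spec[of _ Plus])
      \<comment> \<open>The Lippmann-Schwinger limit exists along the full filter, so the sequence
        from the Poisson integrals is enough to identify its imaginary part.\<close>
      have "filterlim \<epsilon> (at_right 0) sequentially"
        unfolding filterlim_at using \<epsilon> by (auto intro!: always_eventually simp: less_imp_neq[symmetric])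
      from tendsto_Im[OF filterlim_compose[OF LS this]]
      have "(\<lambda>n. Im (cinner (PiR R 1 v) (r (\<epsilon> n)))) \<longlonglongrightarrow> Im (psi0_tot R k E (PiR R 1 v) - \<Psi> k E (PiR R 1 v))" .
      then have eq: "Im (psi0_tot R k E (PiR R 1 v) - \<Psi> k E (PiR R 1 v)) = pi * (cmod (Tm 1 k E))\<^sup>2"
        using LIMSEQ_unique L1 unfolding T by blast
      \<comment> \<open>The free term pairs with a vector of reservoir 1: for k = 1 it is the
        conjugate of T_11, for k = 2 it vanishes.\<close>
      have "Im (psi0_tot R k E (PiR R 1 v)) = (if k = 1 then - Im (Tm 1 1 E) else 0)"
      proof (cases "k = 1")
        case True
        have "Tm 1 k E = cnj (psi0_tot R 1 E v)"
          using technical k E elim(3) unfolding technical_assumptions_def v_def \<Psi>_def by blast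
        then show ?thesis
          using True by (simp add: psi0_tot_def PiR_PiR)
      next
        case False
        have "psi0 R k E 0 = 0"
          using antidual_sum[OF psi0_antidual[OF k E] hilbert_form.subspace[OF hilbert_form_K[OF k]], of "{}"]
          by simp
        then show ?thesis
          using False k by (simp add: psi0_tot_def PiR_PiR)
      qed
      with eq show "Im (\<Psi> k E (PiR R 1 (V_gen R (\<Psi> k E)))) =
          (if k = 1 then - Im (Tm 1 1 E) else 0) - pi * (cmod (Tm 1 k E))\<^sup>2"
        unfolding v_def by simp
    qed
  qed
qed

end

subsection \<open>The steady current\<close>

locale steady_state = scattering_system +
  fixes F0 :: "'a \<Rightarrow> 'a" and \<beta> \<mu> :: "nat \<Rightarrow> real"
  assumes init: "initial_state R \<beta> \<mu> F0"
begin

abbreviation f :: "nat \<Rightarrow> real \<Rightarrow> real" where "f k \<equiv> fermi_dirac (\<beta> k) (\<mu> k)"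

definition F :: "nat \<Rightarrow> 'a \<Rightarrow> real \<Rightarrow> complex" where
  "F k u = fh k (PiR R k (Om' Plus u))"

definition \<rho> :: "'a \<Rightarrow> 'a" where
  "\<rho> x = Omega R Plus (Pi0 R (F0 (Pi0 R (Om' Plus x))))"

definition G :: "nat \<Rightarrow> 'a \<Rightarrow> 'a \<Rightarrow> real \<Rightarrow> complex" where
  "G k x y E = complex_of_real (f k E) * (cnj (F k x E) * F k y E)"

lemma G_integrable:
  assumes k: "k \<in> {1,2}"
  shows "integrable lborel (G k x y)"
proof (rule Bochner_Integration.integrable_bound)
  have i: "integrable lborel (\<lambda>E. cnj (F k x E) * F k y E)"
    unfolding F_def by (rule simple_spectral_rep.ft_integrable_mult[OF spectral_rep[OF k] PiR_mem[OF k] PiR_mem[OF k]])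
  then show "integrable lborel (\<lambda>E. cnj (F k x E) * F k y E)" .
  show "G k x y \<in> borel_measurable lborel"
    unfolding G_def using borel_measurable_integrable[OF i] by measurable
  show "AE E in lborel. norm (G k x y E) \<le> norm (cnj (F k x E) * F k y E)"
    using fermi_dirac_bound by (intro AE_I2) (simp add: G_def norm_mult mult_left_le_one_le)
qed

lemma cinner_\<rho>: "cinner x (\<rho> y) = (\<Sum>k\<in>{1,2}. LINT E|lborel. G k x y E)"
proof -
  let ?y = "\<lambda>k. op_function (sp R k) (sigma0 R) (fourier R k) (f k) (PiR R k (Om' Plus y))"
  have "cinner x (\<rho> y) = cinner (Om' Plus x) (\<Sum>k\<in>{1,2}. ?y k)"
    using init by (simp add: \<rho>_def cinner_Om'[symmetric] initial_state_def)
  also have "\<dots> = (\<Sum>k\<in>{1,2}. cinner (Om' Plus x) (?y k))" by (rule cinner_sum_right)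
  also have "\<dots> = (\<Sum>k\<in>{1,2}. LINT E|lborel. G k x y E)"
  proof (rule sum.cong[OF refl])
    fix k :: nat assume k: "k \<in> {1,2}"
    interpret simple_spectral_rep k "sp R k" "domR R k" "hamR R k" "sigma0 R" "fourier R"
      by (rule spectral_rep[OF k])
    have "?y k \<in> sp R k"
      by (rule op_function_ft(1)[OF PiR_mem[OF k] fermi_dirac_measurable fermi_dirac_bound])
    then have "cinner (Om' Plus x) (?y k) = cinner (PiR R k (Om' Plus x)) (?y k)"
      using cinner_PiR_mem(1)[OF k] by simp
    also have "\<dots> = (LINT E|lborel. G k x y E)"
      unfolding G_def F_def
      by (rule cinner_op_function[OF PiR_mem[OF k] PiR_mem[OF k] fermi_dirac_measurable fermi_dirac_bound])
    finally show "cinner (Om' Plus x) (?y k) = (LINT E|lborel. G k x y E)" .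
  qed
  finally show ?thesis .
qed

lemma \<rho>_symmetric: "cinner (\<rho> x) y = cinner x (\<rho> y)"
proof -
  have "cnj (G k y x E) = G k x y E" for k E by (simp add: G_def)
  then have "cnj (LINT E|lborel. G k y x E) = (LINT E|lborel. G k x y E)" for k
  proof -
    have "cnj (LINT E|lborel. G k y x E) = (LINT E|lborel. cnj (G k y x E))" by simp
    also have "\<dots> = (LINT E|lborel. G k x y E)" using \<open>\<And>k E. cnj (G k y x E) = G k x y E\<close> by simp
    finally show ?thesis .
  qed
  then have "cnj (cinner y (\<rho> x)) = cinner x (\<rho> y)"
    unfolding cinner_\<rho> cnj_sum by simp
  then show ?thesis by (simp flip: cinner_commute)
qed

text \<open>Channel-k density of the trace: over a basis,
  \<open>cinner p x * cinner x (\<rho> q)\<close> sums to \<open>cinner p (\<rho> q)\<close>, whose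
  channel-k density is \<open>G k p q\<close>.\<close>

definition Q :: "nat \<Rightarrow> real \<Rightarrow> complex" where
  "Q k E = (\<Sum>i\<in>Iv. cv i * (G k (PiR R 1 (bv i)) (av i) E + G k (PiR R 1 (av i)) (bv i) E
     - G k (bv i) (PiR R 1 (av i)) E - G k (av i) (PiR R 1 (bv i)) E))"

lemma Q_integrable: "k \<in> {1,2} \<Longrightarrow> integrable lborel (Q k)"
  unfolding Q_def
  by (intro Bochner_Integration.integrable_sum integrable_mult_right Bochner_Integration.integrable_add
      Bochner_Integration.integrable_diff G_integrable)

lemma has_trace_current: "has_trace (current_op R F0) (\<Sum>k\<in>{1,2}. LINT E|lborel. Q k E)"
proof -
  let ?b = "\<lambda>x y. cinner x (\<rho> y)"
  let ?\<tau> = "\<Sum>i\<in>Iv. cv i * (?b (PiR R 1 (bv i)) (av i) + ?b (PiR R 1 (av i)) (bv i)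
     - ?b (bv i) (PiR R 1 (av i)) - ?b (av i) (PiR R 1 (bv i)))"
  have diag: "cinner x (current_op R F0 x) = (\<Sum>i\<in>Iv. cv i *
    (cinner (PiR R 1 (bv i)) x * cinner x (\<rho> (av i)) + cinner (PiR R 1 (av i)) x * cinner x (\<rho> (bv i))
     - cinner (bv i) x * cinner x (\<rho> (PiR R 1 (av i))) - cinner (av i) x * cinner x (\<rho> (PiR R 1 (bv i)))))" for x
  proof -
    \<comment> \<open>Symmetry of \<open>\<rho>\<close> moves it to the left factor, so every
      diagonal term becomes a product of two inner products with the basis vector.\<close>
    have "cinner x (current_op R F0 x) = cinner (\<rho> x) (commutator (V_op R) (PiR R 1) x)"
      by (simp add: current_op_def \<rho>_symmetric) (simp add: \<rho>_def)
    then show ?thesis by (simp only: cinner_commutator \<rho>_symmetric)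
  qed
  have "has_trace (current_op R F0) ?\<tau>"
    unfolding has_trace_def diag
    by (intro allI impI has_sum_sum_finite has_sum_cmult_right has_sum_add has_sum_diff_complex parseval)
  moreover have "?\<tau> = (\<Sum>k\<in>{1,2}. LINT E|lborel. Q k E)"
  proof -
    have eq: "(LINT E|lborel. Q k E) = (\<Sum>i\<in>Iv. cv i * ((LINT E|lborel. G k (PiR R 1 (bv i)) (av i) E)
      + (LINT E|lborel. G k (PiR R 1 (av i)) (bv i) E)
      - (LINT E|lborel. G k (bv i) (PiR R 1 (av i)) E) - (LINT E|lborel. G k (av i) (PiR R 1 (bv i)) E)))"
      if k: "k \<in> {1,2}" for k
    proof (rule has_bochner_integral_integral_eq)
      show "has_bochner_integral lborel (Q k) (\<Sum>i\<in>Iv. cv i * ((LINT E|lborel. G k (PiR R 1 (bv i)) (av i) E)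
      + (LINT E|lborel. G k (PiR R 1 (av i)) (bv i) E)
      - (LINT E|lborel. G k (bv i) (PiR R 1 (av i)) E) - (LINT E|lborel. G k (av i) (PiR R 1 (bv i)) E)))"
        unfolding Q_def
        by (intro has_bochner_integral_sum has_bochner_integral_mult_right has_bochner_integral_add
            has_bochner_integral_diff has_bochner_integral_integrable G_integrable[OF k])
    qed
    show ?thesis
      by (simp add: cinner_\<rho> eq sum.distrib sum_subtractf sum_distrib_left algebra_simps)
  qed
  ultimately show ?thesis by simp
qed

lemma Q_AE:
  assumes k: "k \<in> {1,2}"
  shows "AE E in lborel. Q k E = complex_of_real (indicator (sigma0 R) E * f k E) *
    (2 * \<i> * complex_of_real (Im (\<Psi> k E (PiR R 1 (V_gen R (\<Psi> k E))))))"
proof -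
  have AE_F: "AE E in lborel. F k u E = indicator (sigma0 R) E * cnj (\<Psi> k E u)" if "u \<in> Ktot R" for u
    using fourier_Om'[OF k that]
    by eventually_elim (auto simp: F_def fh_eq[OF k] indicator_def)
  have "AE E in lborel. \<forall>i\<in>Iv. F k (av i) E = indicator (sigma0 R) E * cnj (\<Psi> k E (av i))"
    "AE E in lborel. \<forall>i\<in>Iv. F k (bv i) E = indicator (sigma0 R) E * cnj (\<Psi> k E (bv i))"
    "AE E in lborel. \<forall>i\<in>Iv. F k (PiR R 1 (av i)) E = indicator (sigma0 R) E * cnj (\<Psi> k E (PiR R 1 (av i)))"
    "AE E in lborel. \<forall>i\<in>Iv. F k (PiR R 1 (bv i)) E = indicator (sigma0 R) E * cnj (\<Psi> k E (PiR R 1 (bv i)))"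
    by (auto intro!: AE_finite_allI AE_F av_Ktot bv_Ktot PiR_Ktot)
  then show ?thesis
  proof eventually_elim
    case (elim E)
    let ?\<psi> = "\<Psi> k E" and ?P = "PiR R 1"
    show ?case
    proof (cases "E \<in> sigma0 R")
      case False
      then show ?thesis using elim by (simp add: Q_def G_def)
    next
      case True
      \<comment> \<open>Half of the commutator's terms form \<open>z\<close>, the other half form
        its conjugate, so the density is the real weight times \<open>z - cnj z\<close>.
        Antilinearity of \<open>\<Psi> k E\<close> is what makes \<open>z\<close> equal to its value
        at the projected \<open>V_gen\<close>.\<close>
      define z where "z = (\<Sum>i\<in>Iv. cv i * (?\<psi> (?P (bv i)) * cnj (?\<psi> (av i)) + ?\<psi> (?P (av i)) * cnj (?\<psi> (bv i))))"
      have "Q k E = (\<Sum>i\<in>Iv. complex_of_real (f k E) * (cv i * (?\<psi> (?P (bv i)) * cnj (?\<psi> (av i)) + ?\<psi> (?P (av i)) * cnj (?\<psi> (bv i))))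
          - complex_of_real (f k E) * (cv i * (cnj (?\<psi> (?P (bv i))) * ?\<psi> (av i) + cnj (?\<psi> (?P (av i))) * ?\<psi> (bv i))))"
        unfolding Q_def G_def using elim True
        by (intro sum.cong refl) (simp add: algebra_simps)
      also have "\<dots> = complex_of_real (f k E) * (z - cnj z)"
        unfolding z_def by (simp add: sum_subtractf sum_distrib_left right_diff_distrib)
      also have "z = ?\<psi> (?P (V_gen R ?\<psi>))"
      proof -
        have m: "(if snd p then av (fst p) else bv (fst p)) \<in> Ktot R" if "p \<in> Iv \<times> UNIV" for p :: "(nat \<times> nat) \<times> bool"
          using that av_Ktot bv_Ktot by auto
        have "?\<psi> (?P (V_gen R ?\<psi>)) = (\<Sum>p\<in>Iv \<times> UNIV. cnj (cv (fst p) * ?\<psi> (if snd p then bv (fst p) else av (fst p))) *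
            ?\<psi> (?P (if snd p then av (fst p) else bv (fst p))))"
          unfolding PiR_V_gen
          by (rule antidual_sum[OF \<Psi>_antidual[OF k True] Ktot_subspace]) (intro PiR_Ktot m, auto)
        also have "\<dots> = (\<Sum>i\<in>Iv. \<Sum>t\<in>UNIV. cnj (cv i * ?\<psi> (if t then bv i else av i)) *
            ?\<psi> (?P (if t then av i else bv i)))"
          by (simp add: sum.cartesian_product case_prod_unfold)
        also have "\<dots> = z"
          unfolding z_def by (intro sum.cong refl) (simp add: UNIV_bool algebra_simps)
        finally show ?thesis ..
      qed
      finally show ?thesis
        using True by (simp add: complex_diff_cnj mult_ac)
    qed
  qed
qed

text \<open>\<open>op_trace\<close> and the set integral have default values when undefined, so the
  first two claims are what give the third its meaning.\<close>

lemma steady_current_formula: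
  "\<exists>c. has_trace (current_op R F0) c"
  "set_integrable lborel (sigma0 R) (\<lambda>E. (f 1 E - f 2 E) * (cmod (Tm 1 2 E))\<^sup>2)"
  "steady_current R F0 e = complex_of_real (- 2 * pi * e *
     (LINT E:sigma0 R|lborel. (f 1 E - f 2 E) * (cmod (Tm 1 2 E))\<^sup>2))"
proof -
  let ?\<sigma> = "sigma0 R"
  define P where "P k E = f k E * (cmod (indicator ?\<sigma> E *\<^sub>R Tm 1 2 E))\<^sup>2" for k E
  have P_eq: "P k E = indicator ?\<sigma> E * (f k E * (cmod (Tm 1 2 E))\<^sup>2)" for k E
    by (simp add: P_def indicator_def)
  have [measurable]: "(\<lambda>E. indicator ?\<sigma> E *\<^sub>R Tm 1 2 E) \<in> borel_measurable borel"
    using Tm_measurable[of 1 2] by simp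
  have P_meas: "P k \<in> borel_measurable borel" for k
    unfolding P_def by measurable
  \<comment> \<open>The optical theorem turns the k = 1 contribution -Im T_11 - pi |T_11|^2 into +pi
    |T_12|^2, while k = 2 gives -pi |T_12|^2.\<close>
  define s :: "nat \<Rightarrow> real" where "s k = (if k = 1 then 1 else - 1)" for k
  have QP: "AE E in lborel. Q k E = (2 * \<i> * complex_of_real (s k * pi)) * complex_of_real (P k E)"
    if k: "k \<in> {1,2}" for k
    using Q_AE[OF k] Im_lippmann_schwinger[OF k] optical_theorem
  proof eventually_elim
    case (elim E)
    show ?case
    proof (cases "E \<in> ?\<sigma>")
      case False
      then show ?thesis using elim(1) by (simp add: P_eq)
    next
      case True
      have "Im (\<Psi> k E (PiR R 1 (V_gen R (\<Psi> k E)))) = s k * pi * (cmod (Tm 1 2 E))\<^sup>2"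
        using elim(2,3) True k by (auto simp: s_def algebra_simps)
      then show ?thesis using elim(1) True by (simp add: P_eq)
    qed
  qed
  \<comment> \<open>Integrability is inherited from the trace density \<open>Q k\<close>, of which
    \<open>P k\<close> is a nonzero constant multiple almost everywhere.\<close>
  have P_int: "integrable lborel (P k)" if k: "k \<in> {1,2}" for k
  proof -
    define c where "c = 2 * \<i> * complex_of_real (s k * pi)"
    have c: "c \<noteq> 0" by (simp add: c_def s_def)
    have "integrable lborel (\<lambda>E. c * complex_of_real (P k E))"
      unfolding c_def using P_meas[of k]
      by (intro integrable_cong_AE_imp[OF Q_integrable[OF k] _ QP[OF k]]) measurable
    then have "integrable lborel (\<lambda>E. (1 / c) * (c * complex_of_real (P k E)))"
      by (rule integrable_mult_right)
    then have "integrable lborel (\<lambda>E. complex_of_real (P k E))" using c by simp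
    then show ?thesis by (simp add: complex_of_real_integrable_eq)
  qed
  have Q_int: "(LINT E|lborel. Q k E) = 2 * \<i> * complex_of_real (s k * pi) * complex_of_real (LINT E|lborel. P k E)"
    if k: "k \<in> {1,2}" for k
  proof -
    have "(LINT E|lborel. Q k E) = (LINT E|lborel. (2 * \<i> * complex_of_real (s k * pi)) * complex_of_real (P k E))"
    proof (rule integral_cong_AE)
      show "Q k \<in> borel_measurable lborel" by (rule borel_measurable_integrable[OF Q_integrable[OF k]])
      show "(\<lambda>E. (2 * \<i> * complex_of_real (s k * pi)) * complex_of_real (P k E)) \<in> borel_measurable lborel"
        using P_meas[of k] by measurable
    qed (rule QP[OF k])
    then show ?thesis by simp
  qed
  have eq: "(\<lambda>E. indicator ?\<sigma> E *\<^sub>R ((f 1 E - f 2 E) * (cmod (Tm 1 2 E))\<^sup>2)) = (\<lambda>E. P 1 E - P 2 E)"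
    by (simp add: P_eq fun_eq_iff algebra_simps)
  show "\<exists>c. has_trace (current_op R F0) c" using has_trace_current by blast
  show "set_integrable lborel ?\<sigma> (\<lambda>E. (f 1 E - f 2 E) * (cmod (Tm 1 2 E))\<^sup>2)"
    unfolding set_integrable_def eq using P_int[of 1] P_int[of 2] by simp
  have "(LINT E:?\<sigma>|lborel. (f 1 E - f 2 E) * (cmod (Tm 1 2 E))\<^sup>2) = (LINT E|lborel. P 1 E) - (LINT E|lborel. P 2 E)"
    unfolding set_lebesgue_integral_def eq using P_int[of 1] P_int[of 2] by simp
  moreover have "op_trace (current_op R F0) =
      2 * \<i> * complex_of_real pi * complex_of_real ((LINT E|lborel. P 1 E) - (LINT E|lborel. P 2 E))"
    using op_trace_eq[OF has_trace_current] Q_int[of 1] Q_int[of 2] by (simp add: s_def algebra_simps)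
  ultimately show "steady_current R F0 e = complex_of_real (- 2 * pi * e *
     (LINT E:?\<sigma>|lborel. (f 1 E - f 2 E) * (cmod (Tm 1 2 E))\<^sup>2))"
    unfolding steady_current_def by (simp only:) (simp add: mult_ac)
qed

end

theorem proposition1:
  fixes R :: "'h::complex_hilbert two_reservoirs"
    and M :: nat
    and Tm :: "nat \<Rightarrow> nat \<Rightarrow> real \<Rightarrow> complex"
    and \<Omega> :: "pm \<Rightarrow> ('h \<Rightarrow> complex) \<Rightarrow> 'h \<Rightarrow> complex"
    and X :: "real set"
    and F0 :: "'h \<Rightarrow> 'h"
    and \<beta> \<mu> :: "nat \<Rightarrow> real"
    and e :: real
  assumes "decoupled_system R M"
    and "coupling R M"
    and "scattering_theory R"
    and "transition_matrix R Tm"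
    and "technical_assumptions R Tm \<Omega> X"
    and "\<And>j. j \<in> {1,2} \<Longrightarrow> \<beta> j > 0"
    and "initial_state R \<beta> \<mu> F0"
    and "e > 0"
  shows "(\<exists>c. has_trace (current_op R F0) c) \<and>
         set_integrable lborel (sigma0 R)
           (\<lambda>E. (fermi_dirac (\<beta> 1) (\<mu> 1) E - fermi_dirac (\<beta> 2) (\<mu> 2) E) * (cmod (Tm 1 2 E))\<^sup>2) \<and>
         steady_current R F0 e =
           complex_of_real (- 2 * pi * e *
             (LINT E:sigma0 R|lborel.
                (fermi_dirac (\<beta> 1) (\<mu> 1) E - fermi_dirac (\<beta> 2) (\<mu> 2) E) * (cmod (Tm 1 2 E))\<^sup>2))"
proof -
  interpret steady_state R M Tm \<Omega> X F0 \<beta> \<mu>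
    by unfold_locales (fact assms)+
  show ?thesis using steady_current_formula by blast
qed

end
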